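(* Let $d\ge 1$ and let $p:\mathbb{R}^d\to\mathbb{C}$ have the form $p(\xi)=p_0+\sum_{j=1}^h p_{m_j}(\xi)$, where $p_0\in\mathbb{C}$, $0<m_1<m_2<\dots<m_h=M$, and each $p_{m_j}$ is smooth in $\mathbb{R}^d\setminus\{0\}$ and positively homogeneous of degree $m_j$. Suppose that there is $C>0$ such that $|p(\xi)|\ge C\langle\xi\rangle^M$ for all $\xi\in\mathbb{R}^d$, and that at least one of the $p_{m_j}$ is not smooth (on $\mathbb{R}^d$); let $m=\min\{m_j:\ p_{m_j}\text{ is not smooth}\}>0$. Let $F:\mathbb{C}\to\mathbb{C}$ be a measurable function for which there is an exponent $r>1$ such that for every compact set $K\subset\mathbb{C}$ there is a constant $C_K$ with $|F(z)|\le C_K|z|^r$ for all $z\in K$. Let $u$ be a distribution solution of $p(D)u=F(u)$ in $\mathbb{R}^d$ satisfying $\langle x\rangle^{\epsilon_0}u\in L^\infty(\mathbb{R}^d)$ for some $\epsilon_0>0$. Then $\langle x\rangle^{m+d}u\in L^\infty(\mathbb{R}^d)$.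
   Context: Here $\langle x\rangle=(1+|x|^2)^{1/2}$. Positively homogeneous of degree $\mu>0$ means $f(t\xi)=t^{\mu}f(\xi)$ for $t>0$, $\xi\ne 0$, with $f(0)=0$; "not smooth" means not $C^\infty$ on all of $\mathbb{R}^d$. The Fourier transform is $\widehat{u}(\xi)=\int_{\mathbb{R}^d}e^{-ix\xi}u(x)\,dx$, and $p(D)$ is the Fourier multiplier with symbol $p$, i.e. $\widehat{p(D)\varphi}=p\,\widehat{\varphi}$ for Schwartz $\varphi$. For $u\in L^\infty(\mathbb{R}^d)$, $p(D)u$ is the tempered distribution defined by $\langle p(D)u,\varphi\rangle=\int_{\mathbb{R}^d}u\,(\check p(D)\varphi)\,dx$ for Schwartz $\varphi$, where $\check p(\xi)=p(-\xi)$ (the function $\check p(D)\varphi$ is integrable). $F(u)$ denotes $x\mapsto F(u(x))$, and a distribution solution is a $u$ for which $p(D)u=F(u)$ as tempered distributions. *)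

theory Defs
  imports "HOL-Analysis.Analysis"
begin

definition japanese_bracket :: "'a::euclidean_space \<Rightarrow> real" where
  "japanese_bracket x = sqrt (1 + (norm x)\<^sup>2)"

(* A multi-index is encoded as a list of basis vectors:
   iter_pderiv [e_1, ..., e_k] f is the iterated partial derivative D_{e_1} ... D_{e_k} f. *)
primrec iter_pderiv :: "'a::euclidean_space list \<Rightarrow> ('a \<Rightarrow> complex) \<Rightarrow> 'a \<Rightarrow> complex" where
  "iter_pderiv [] f = f"
| "iter_pderiv (v # vs) f = (\<lambda>x. frechet_derivative (iter_pderiv vs f) (at x) v)"

(* C-infinity on S; meant for open S only.  Differentiability of all iterated partial
   derivatives entails their continuity. *)
definition smooth_on :: "'a::euclidean_space set \<Rightarrow> ('a \<Rightarrow> complex) \<Rightarrow> bool" where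
  "smooth_on S f \<longleftrightarrow> (\<forall>vs. set vs \<subseteq> Basis \<longrightarrow> iter_pderiv vs f differentiable_on S)"

definition pos_homogeneous :: "real \<Rightarrow> ('a::euclidean_space \<Rightarrow> complex) \<Rightarrow> bool" where
  "pos_homogeneous \<mu> f \<longleftrightarrow>
     f 0 = 0 \<and> (\<forall>t>0. \<forall>\<xi>. \<xi> \<noteq> 0 \<longrightarrow> f (t *\<^sub>R \<xi>) = complex_of_real (t powr \<mu>) * f \<xi>)"

definition schwartz :: "('a::euclidean_space \<Rightarrow> complex) \<Rightarrow> bool" where
  "schwartz \<phi> \<longleftrightarrow> smooth_on UNIV \<phi> \<and>
     (\<forall>(k::nat) vs. set vs \<subseteq> Basis \<longrightarrow>
        bounded (range (\<lambda>x. complex_of_real (japanese_bracket x ^ k) * iter_pderiv vs \<phi> x)))"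

(* Membership of a pointwise-defined representative in L-infinity with respect to Lebesgue measure. *)
definition Linfty :: "('a::euclidean_space \<Rightarrow> complex) \<Rightarrow> bool" where
  "Linfty f \<longleftrightarrow> f \<in> borel_measurable lebesgue \<and> (\<exists>C. AE x in lebesgue. norm (f x) \<le> C)"

definition fourier :: "('a::euclidean_space \<Rightarrow> complex) \<Rightarrow> 'a \<Rightarrow> complex" where
  "fourier f \<xi> = (LINT x|lebesgue. exp (- \<i> * complex_of_real (x \<bullet> \<xi>)) * f x)"

definition inverse_fourier :: "('a::euclidean_space \<Rightarrow> complex) \<Rightarrow> 'a \<Rightarrow> complex" where
  "inverse_fourier g x =
     complex_of_real (1 / (2 * pi) ^ DIM('a)) *
     (LINT \<xi>|lebesgue. exp (\<i> * complex_of_real (x \<bullet> \<xi>)) * g \<xi>)"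

(* p(D) acting on Schwartz functions.  For continuous p of polynomial growth the product
   p * fourier \<phi> is integrable, so the inverse transform is an absolutely convergent integral. *)
definition fourier_multiplier ::
  "('a::euclidean_space \<Rightarrow> complex) \<Rightarrow> ('a \<Rightarrow> complex) \<Rightarrow> 'a \<Rightarrow> complex" where
  "fourier_multiplier p \<phi> = inverse_fourier (\<lambda>\<xi>. p \<xi> * fourier \<phi> \<xi>)"

definition function_distribution ::
  "('a::euclidean_space \<Rightarrow> complex) \<Rightarrow> ('a \<Rightarrow> complex) \<Rightarrow> complex" where
  "function_distribution g \<phi> = (LINT x|lebesgue. g x * \<phi> x)"

(* p(D)u for u in L-infinity, as a functional of the Schwartz function \<phi>. *)
definition multiplier_distribution ::
  "('a::euclidean_space \<Rightarrow> complex) \<Rightarrow> ('a \<Rightarrow> complex) \<Rightarrow> ('a \<Rightarrow> complex) \<Rightarrow> complex" where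
  "multiplier_distribution p u \<phi> =
     (LINT x|lebesgue. u x * fourier_multiplier (\<lambda>\<xi>. p (- \<xi>)) \<phi> x)"

definition distribution_solution ::
  "('a::euclidean_space \<Rightarrow> complex) \<Rightarrow> (complex \<Rightarrow> complex) \<Rightarrow> ('a \<Rightarrow> complex) \<Rightarrow> bool" where
  "distribution_solution p F u \<longleftrightarrow>
     (\<forall>\<phi>. schwartz \<phi> \<longrightarrow>
        multiplier_distribution p u \<phi> = function_distribution (\<lambda>x. F (u x)) \<phi>)"

end

theory Submission
  imports Defs "HOL-Probability.Probability"
begin

text \<open>
  Writing \<open>q = 1 / p\<close>, the equation becomes \<open>u = K * F(u)\<close> with \<open>K\<close> the inverse Fourier transform of \<open>q\<close>. Near the
  origin \<open>q\<close> has a singularity no worse than a homogeneous function of degree \<open>m\<close>, so \<open>K\<close> decays like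
  \<open>\<bar>x\<bar> powr (- m - d)\<close>; at infinity \<open>q\<close> is a symbol of order \<open>- M < 0\<close>, so \<open>K\<close> is locally integrable. If
  \<open>u = O(\<langle>x\<rangle> powr (- \<sigma>))\<close>, then \<open>F(u) = O(\<langle>x\<rangle> powr (- r \<sigma>))\<close> and the convolution has order
  \<open>\<langle>x\<rangle> powr (- min (r \<sigma>) (m + d))\<close>; as \<open>r > 1\<close>, finitely many steps suffice.

  Since \<open>q\<close> is neither smooth at the origin nor integrable, \<open>K\<close> itself is never formed. The equation is tested with
  the Schwartz function whose transform is \<open>q\<close> times a character, a Gaussian, and the factor \<open>exp (- \<epsilon>\<^sup>2 / \<bar>\<xi>\<bar>\<^sup>2)\<close>,
  which is flat at the origin. The decay of \<open>u\<close> makes \<open>\<epsilon> \<rightarrow> 0\<close> possible and leaves an identity for the Gaussian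
  mollifications of \<open>u\<close>, with kernels bounded uniformly in the width of the Gaussian.
\<close>

section \<open>Classes of families of functions with graded conditions on the partial derivatives\<close>

text \<open>Two borderline phenomena shape the argument. Uniformly in \<epsilon> the flat factor is
  only a symbol of order 0, so the regularised kernels are bounded by \<langle>x\<rangle> to the
  power -d, which just misses integrability; this is where any positive decay of \<open>u\<close>
  and \<open>F(u)\<close> is spent. The second is the exact rate m + d at infinity: derivatives of
  order j of a function singular like |\<xi>|^m are integrable only for j < m + d, so plain
  integration by parts stops short of the rate. Instead k = ceiling of m derivatives are traded for
  powers of x, which leaves a symbol of order -a with 0 \<le> a < 1, and N-th differences with a
  step of length about 1 / |x| give the sharp bound |x|^(a - d) for those. Terms of \<open>p\<close>
  that are smooth at the origin may have degree below m and must not count as singular. The weights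
  near the origin therefore use the exponent \<open>min 0 (m - j)\<close> rather than homogeneity.
  The width of the Gaussian is finally removed by duality: the mollifications are bounded pointwise
  and tested against bounded functions of compact support.\<close>

definition partial_family :: "'a::euclidean_space \<Rightarrow> ('s \<Rightarrow> 'a \<Rightarrow> complex) \<Rightarrow> 's \<Rightarrow> 'a \<Rightarrow> complex" where
  "partial_family v f t \<xi> = frechet_derivative (f t) (at \<xi>) v"

text \<open>
  Families rather than single functions occur because bounds must hold uniformly in the cutoff parameters \<open>t \<in> T\<close>.
  The predicate \<open>Q j\<close> is imposed on all partial derivatives of order \<open>j \<le> n\<close>, so that one product rule and one rule for
  reciprocals serve symbol estimates, limits at the origin, and rapid decay alike. Symbols are only smooth off the
  origin, which is why everything is local to an open set \<open>S\<close>.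
\<close>

primrec symbol_class :: "'a::euclidean_space set \<Rightarrow> 's set \<Rightarrow> nat \<Rightarrow> (nat \<Rightarrow> ('s \<Rightarrow> 'a \<Rightarrow> complex) \<Rightarrow> bool)
    \<Rightarrow> ('s \<Rightarrow> 'a \<Rightarrow> complex) \<Rightarrow> bool" where
  "symbol_class S T 0 Q f \<longleftrightarrow> Q 0 f"
| "symbol_class S T (Suc n) Q f \<longleftrightarrow> Q 0 f \<and> (\<forall>t\<in>T. \<forall>\<xi>\<in>S. f t differentiable (at \<xi>)) \<and>
     (\<forall>v\<in>Basis. symbol_class S T n (\<lambda>j. Q (Suc j)) (partial_family v f))"

definition families_eq_on :: "'a set \<Rightarrow> 's set \<Rightarrow> ('s \<Rightarrow> 'a \<Rightarrow> complex) \<Rightarrow> ('s \<Rightarrow> 'a \<Rightarrow> complex) \<Rightarrow> bool" where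
  "families_eq_on S T f g \<longleftrightarrow> (\<forall>t\<in>T. \<forall>\<xi>\<in>S. f t \<xi> = g t \<xi>)"

text \<open>Differentiation rules are equalities valid only on \<open>S\<close> and for parameters
  in \<open>T\<close>; a predicate has to be blind to all other values before one side of a rule can
  replace the other.\<close>

definition local_family :: "'a set \<Rightarrow> 's set \<Rightarrow> (nat \<Rightarrow> ('s \<Rightarrow> 'a \<Rightarrow> complex) \<Rightarrow> bool) \<Rightarrow> bool" where
  "local_family S T Q \<longleftrightarrow> (\<forall>j f g. Q j f \<longrightarrow> families_eq_on S T f g \<longrightarrow> Q j g)"

definition add_closed :: "(nat \<Rightarrow> ('s \<Rightarrow> 'a \<Rightarrow> complex) \<Rightarrow> bool) \<Rightarrow> bool" where
  "add_closed Q \<longleftrightarrow> (\<forall>j f g. Q j f \<longrightarrow> Q j g \<longrightarrow> Q j (\<lambda>t \<xi>. f t \<xi> + g t \<xi>))"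

lemma local_family_Suc: "local_family S T Q \<Longrightarrow> local_family S T (\<lambda>j. Q (Suc j))"
  by (auto simp: local_family_def)

lemma add_closed_Suc: "add_closed Q \<Longrightarrow> add_closed (\<lambda>j. Q (Suc j))"
  by (auto simp: add_closed_def)

lemma iter_pderiv_append: "iter_pderiv (vs @ ws) f = iter_pderiv vs (iter_pderiv ws f)"
  by (induction vs) auto

lemma families_eq_on_differentiable:
  assumes "open S" "families_eq_on S T f g" "t \<in> T" "\<xi> \<in> S" "f t differentiable (at \<xi>)"
  shows "g t differentiable (at \<xi>)"
  using assms unfolding differentiable_def families_eq_on_def
  by (meson has_derivative_transform_within_open)

lemma families_eq_on_partial_family:
  assumes "open S" "families_eq_on S T f g" and d: "\<And>t \<xi>. t \<in> T \<Longrightarrow> \<xi> \<in> S \<Longrightarrow> f t differentiable (at \<xi>)"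
  shows "families_eq_on S T (partial_family v f) (partial_family v g)"
  unfolding families_eq_on_def partial_family_def
proof (intro ballI)
  fix t \<xi> assume t: "t \<in> T" "\<xi> \<in> S"
  show "frechet_derivative (f t) (at \<xi>) v = frechet_derivative (g t) (at \<xi>) v"
    using frechet_derivative_transform_within_open[OF d[OF t] assms(1) t(2)] assms(2) t(1)
    unfolding families_eq_on_def by simp
qed

text \<open>As \<open>S\<close> is open, the derivative at a point of \<open>S\<close> sees only
  values in \<open>S\<close>, so agreement on \<open>S\<close> is inherited by every partial
  derivative.\<close>

lemma symbol_class_cong:
  assumes "open S"
  shows "local_family S T Q \<Longrightarrow> families_eq_on S T f g \<Longrightarrow> symbol_class S T n Q f \<Longrightarrow> symbol_class S T n Q g"
proof (induction n arbitrary: Q f g)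
  case 0
  then show ?case unfolding local_family_def by (metis symbol_class.simps(1))
next
  case (Suc n)
  have d: "\<And>t \<xi>. t \<in> T \<Longrightarrow> \<xi> \<in> S \<Longrightarrow> f t differentiable (at \<xi>)"
    using Suc.prems by simp
  have "symbol_class S T n (\<lambda>j. Q (Suc j)) (partial_family v g)" if "v \<in> Basis" for v
    using Suc.IH[OF local_family_Suc[OF Suc.prems(1)] families_eq_on_partial_family[OF assms Suc.prems(2) d]] Suc.prems(3) that
    by simp
  moreover have "Q 0 g" using Suc.prems unfolding local_family_def by (metis symbol_class.simps(2))
  ultimately show ?case
    using families_eq_on_differentiable[OF assms Suc.prems(2)] d by auto
qed

lemma symbol_class_mono:
  "(\<And>j f. j \<le> n \<Longrightarrow> Q j f \<Longrightarrow> R j f) \<Longrightarrow> symbol_class S T n Q f \<Longrightarrow> symbol_class S T n R f"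
proof (induction n arbitrary: Q R f)
  case (Suc n)
  show ?case using Suc.prems Suc.IH[of "\<lambda>j. Q (Suc j)" "\<lambda>j. R (Suc j)"] by auto
qed auto

text \<open>Each term of the product rule leaves one factor undifferentiated; that factor is given
  at order \<open>Suc n\<close> and needed at order \<open>n\<close>.\<close>

lemma symbol_class_Suc_imp: "symbol_class S T (Suc n) Q f \<Longrightarrow> symbol_class S T n Q f"
proof (induction n arbitrary: Q f)
  case 0
  then show ?case by simp
next
  case (Suc n)
  then show ?case by (subst symbol_class.simps(2)) (auto simp del: symbol_class.simps(2) simp: symbol_class.simps(2)[of _ _ "Suc n"])
qed

lemma symbol_class_base: "symbol_class S T n Q f \<Longrightarrow> Q 0 f"
  by (cases n) auto

lemma frechet_derivative_add:
  fixes f g :: "'a::euclidean_space \<Rightarrow> complex"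
  assumes "f differentiable (at \<xi>)" "g differentiable (at \<xi>)"
  shows "frechet_derivative (\<lambda>x. f x + g x) (at \<xi>) v
    = frechet_derivative f (at \<xi>) v + frechet_derivative g (at \<xi>) v"
proof -
  have "((\<lambda>x. f x + g x) has_derivative
      (\<lambda>h. frechet_derivative f (at \<xi>) h + frechet_derivative g (at \<xi>) h)) (at \<xi>)"
    using assms by (intro has_derivative_add) (simp_all add: frechet_derivative_works)
  then show ?thesis by (simp flip: frechet_derivative_at)
qed

lemma frechet_derivative_minus:
  fixes f :: "'a::euclidean_space \<Rightarrow> complex"
  assumes "f differentiable (at \<xi>)"
  shows "frechet_derivative (\<lambda>x. - f x) (at \<xi>) v = - frechet_derivative f (at \<xi>) v"
proof -
  have "((\<lambda>x. - f x) has_derivative (\<lambda>h. - frechet_derivative f (at \<xi>) h)) (at \<xi>)"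
    using assms by (intro has_derivative_minus) (simp_all add: frechet_derivative_works)
  then show ?thesis by (simp flip: frechet_derivative_at)
qed

section \<open>Sums, products and reciprocals in the graded classes\<close>

lemma symbol_class_add:
  assumes "open S"
  shows "local_family S T Q \<Longrightarrow> add_closed Q \<Longrightarrow> symbol_class S T n Q f \<Longrightarrow> symbol_class S T n Q g
    \<Longrightarrow> symbol_class S T n Q (\<lambda>t \<xi>. f t \<xi> + g t \<xi>)"
proof (induction n arbitrary: Q f g)
  case 0
  then show ?case by (auto simp: add_closed_def)
next
  case (Suc n)
  have "symbol_class S T n (\<lambda>j. Q (Suc j)) (partial_family v (\<lambda>t \<xi>. f t \<xi> + g t \<xi>))" if "v \<in> Basis" for v
  proof (rule symbol_class_cong[OF assms local_family_Suc[OF Suc.prems(1)]])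
    show "symbol_class S T n (\<lambda>j. Q (Suc j)) (\<lambda>t \<xi>. partial_family v f t \<xi> + partial_family v g t \<xi>)"
      using Suc.prems that
      by (intro Suc.IH local_family_Suc add_closed_Suc) auto
    show "families_eq_on S T (\<lambda>t \<xi>. partial_family v f t \<xi> + partial_family v g t \<xi>) (partial_family v (\<lambda>t \<xi>. f t \<xi> + g t \<xi>))"
      using Suc.prems(3,4) unfolding families_eq_on_def partial_family_def by (simp add: frechet_derivative_add)
  qed
  then show ?case using Suc.prems by (auto simp: add_closed_def)
qed

lemma frechet_derivative_mult_complex:
  fixes f g :: "'a::euclidean_space \<Rightarrow> complex"
  assumes "f differentiable (at \<xi>)" "g differentiable (at \<xi>)"
  shows "frechet_derivative (\<lambda>x. f x * g x) (at \<xi>) v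
    = frechet_derivative f (at \<xi>) v * g \<xi> + f \<xi> * frechet_derivative g (at \<xi>) v"
proof -
  have "((\<lambda>x. f x * g x) has_derivative
      (\<lambda>h. f \<xi> * frechet_derivative g (at \<xi>) h + frechet_derivative f (at \<xi>) h * g \<xi>)) (at \<xi>)"
    using assms by (intro has_derivative_mult) (simp_all add: frechet_derivative_works)
  then show ?thesis by (simp flip: frechet_derivative_at add: add.commute)
qed

text \<open>Leibniz's rule without binomial coefficients: of the two terms of the first derivative,
  one shifts the grading of \<open>A\<close>, the other that of \<open>B\<close>, and both land in
  the shifted \<open>D\<close>. Keeping three separate gradings is what makes the induction go
  through.\<close>

lemma symbol_class_mult:
  assumes "open S"
  shows "local_family S T D \<Longrightarrow> add_closed D
    \<Longrightarrow> (\<And>i j f g. i + j \<le> n \<Longrightarrow> A i f \<Longrightarrow> B j g \<Longrightarrow> D (i + j) (\<lambda>t \<xi>. f t \<xi> * g t \<xi>))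
    \<Longrightarrow> symbol_class S T n A f \<Longrightarrow> symbol_class S T n B g \<Longrightarrow> symbol_class S T n D (\<lambda>t \<xi>. f t \<xi> * g t \<xi>)"
proof (induction n arbitrary: A B D f g)
  case 0
  have "D (0 + 0) (\<lambda>t \<xi>. f t \<xi> * g t \<xi>)" using 0 by (intro 0) auto
  then show ?case by simp
next
  case (Suc n)
  have "symbol_class S T n (\<lambda>j. D (Suc j)) (partial_family v (\<lambda>t \<xi>. f t \<xi> * g t \<xi>))" if "v \<in> Basis" for v
  proof (rule symbol_class_cong[OF assms local_family_Suc[OF Suc.prems(1)]])
    have 1: "symbol_class S T n (\<lambda>j. D (Suc j)) (\<lambda>t \<xi>. partial_family v f t \<xi> * g t \<xi>)"
    proof (rule Suc.IH[of _ "\<lambda>j. A (Suc j)" B])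
      show "D (Suc (i + j)) (\<lambda>t \<xi>. f t \<xi> * g t \<xi>)" if "i + j \<le> n" "A (Suc i) f" "B j g" for i j f g
        using Suc.prems(3)[of "Suc i" j f g] that by simp
    qed (use Suc.prems that symbol_class_Suc_imp[OF Suc.prems(5)] in \<open>auto intro: local_family_Suc add_closed_Suc\<close>)
    have 2: "symbol_class S T n (\<lambda>j. D (Suc j)) (\<lambda>t \<xi>. f t \<xi> * partial_family v g t \<xi>)"
    proof (rule Suc.IH[of _ A "\<lambda>j. B (Suc j)"])
      show "D (Suc (i + j)) (\<lambda>t \<xi>. f t \<xi> * g t \<xi>)" if "i + j \<le> n" "A i f" "B (Suc j) g" for i j f g
        using Suc.prems(3)[of i "Suc j" f g] that by simp
    qed (use Suc.prems that symbol_class_Suc_imp[OF Suc.prems(4)] in \<open>auto intro: local_family_Suc add_closed_Suc\<close>)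
    show "symbol_class S T n (\<lambda>j. D (Suc j)) (\<lambda>t \<xi>. partial_family v f t \<xi> * g t \<xi> + f t \<xi> * partial_family v g t \<xi>)"
      by (rule symbol_class_add[OF assms local_family_Suc[OF Suc.prems(1)] add_closed_Suc[OF Suc.prems(2)] 1 2])
    show "families_eq_on S T (\<lambda>t \<xi>. partial_family v f t \<xi> * g t \<xi> + f t \<xi> * partial_family v g t \<xi>) (partial_family v (\<lambda>t \<xi>. f t \<xi> * g t \<xi>))"
      using Suc.prems(4,5) unfolding families_eq_on_def partial_family_def by (simp add: frechet_derivative_mult_complex)
  qed
  moreover have "D (0 + 0) (\<lambda>t \<xi>. f t \<xi> * g t \<xi>)" using Suc.prems by (intro Suc.prems) auto
  ultimately show ?case using Suc.prems by auto
qed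

lemma symbol_class_sum:
  assumes "open S" "local_family S T Q" "add_closed Q" "symbol_class S T n Q (\<lambda>t \<xi>. 0)" "finite I"
    "\<And>i. i \<in> I \<Longrightarrow> symbol_class S T n Q (f i)"
  shows "symbol_class S T n Q (\<lambda>t \<xi>. \<Sum>i\<in>I. f i t \<xi>)"
  using assms(5,6)
proof (induction I rule: finite_induct)
  case empty
  then show ?case using assms(4) by simp
next
  case (insert x F)
  then show ?case using symbol_class_add[OF assms(1,2,3)] by simp
qed

lemma frechet_derivative_inverse_complex:
  fixes f :: "'a::euclidean_space \<Rightarrow> complex"
  assumes "f differentiable (at \<xi>)" "f \<xi> \<noteq> 0"
  shows "(\<lambda>x. inverse (f x)) differentiable (at \<xi>)"
    "frechet_derivative (\<lambda>x. inverse (f x)) (at \<xi>) v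
    = - (inverse (f \<xi>) * inverse (f \<xi>) * frechet_derivative f (at \<xi>) v)"
proof -
  have *: "((\<lambda>x. inverse (f x)) has_derivative
      (\<lambda>h. - (inverse (f \<xi>) * frechet_derivative f (at \<xi>) h * inverse (f \<xi>)))) (at \<xi>)"
    using assms by (intro Deriv.has_derivative_inverse) (simp_all add: frechet_derivative_works)
  show "(\<lambda>x. inverse (f x)) differentiable (at \<xi>)" using * by (auto simp: differentiable_def)
  show "frechet_derivative (\<lambda>x. inverse (f x)) (at \<xi>) v
    = - (inverse (f \<xi>) * inverse (f \<xi>) * frechet_derivative f (at \<xi>) v)"
    using fun_cong[OF frechet_derivative_at[OF *], of v] by (simp add: mult_ac)
qed

text \<open>Rests on (1/f)' = -(1/f)^2 f'. Knowing 1/f to order \<open>n\<close> gives its square to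
  order \<open>n\<close> in the auxiliary grading \<open>RR\<close>, and one factor f' from the
  shifted \<open>A\<close> returns to \<open>R\<close> one order higher. Only the undifferentiated
  bound \<open>base\<close>, in practice a lower bound for f, has to be supplied from
  outside.\<close>

lemma symbol_class_inverse:
  assumes "open S"
    and R: "local_family S T R" "add_closed R"
    and RR: "local_family S T RR" "add_closed RR"
    and R2: "\<And>i j f g. R i f \<Longrightarrow> R j g \<Longrightarrow> RR (i + j) (\<lambda>t \<xi>. f t \<xi> * g t \<xi>)"
    and R3: "\<And>i j f g. RR i f \<Longrightarrow> A (Suc j) g \<Longrightarrow> R (Suc (i + j)) (\<lambda>t \<xi>. - (f t \<xi> * g t \<xi>))"
    and nz: "\<And>t \<xi>. t \<in> T \<Longrightarrow> \<xi> \<in> S \<Longrightarrow> f t \<xi> \<noteq> 0"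
    and base: "R 0 (\<lambda>t \<xi>. inverse (f t \<xi>))"
  shows "symbol_class S T n A f \<Longrightarrow> symbol_class S T n R (\<lambda>t \<xi>. inverse (f t \<xi>))"
proof (induction n)
  case 0
  then show ?case using base by simp
next
  case (Suc n)
  have IH: "symbol_class S T n R (\<lambda>t \<xi>. inverse (f t \<xi>))"
    using Suc symbol_class_Suc_imp by blast
  have d: "\<And>t \<xi>. t \<in> T \<Longrightarrow> \<xi> \<in> S \<Longrightarrow> f t differentiable (at \<xi>)" using Suc.prems by simp
  have "symbol_class S T n (\<lambda>j. R (Suc j)) (partial_family v (\<lambda>t \<xi>. inverse (f t \<xi>)))" if v: "v \<in> Basis" for v
  proof (rule symbol_class_cong[OF assms(1) local_family_Suc[OF R(1)]])
    have *: "symbol_class S T n RR (\<lambda>t \<xi>. inverse (f t \<xi>) * inverse (f t \<xi>))"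
      by (rule symbol_class_mult[OF assms(1) RR R2 IH IH])
    \<comment> \<open>The sign is carried inside the target predicate, because \<open>R\<close> is
      not assumed closed under negation; \<open>R3\<close> supplies the minus together with the
      product, and \<open>gen\<close> below moves it back out.\<close>
    let ?D = "\<lambda>j f. R (Suc j) (\<lambda>t \<xi>. - f t \<xi>)"
    have "symbol_class S T n ?D (\<lambda>t \<xi>. inverse (f t \<xi>) * inverse (f t \<xi>) * partial_family v f t \<xi>)"
    proof (rule symbol_class_mult[OF assms(1) _ _ _ *])
      show "symbol_class S T n (\<lambda>j. A (Suc j)) (partial_family v f)" using Suc.prems v by simp
      show "local_family S T ?D"
        unfolding local_family_def families_eq_on_def
      proof (intro allI impI)
        fix j and f g :: "'b \<Rightarrow> 'a \<Rightarrow> complex"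
        assume "R (Suc j) (\<lambda>t \<xi>. - f t \<xi>)" "\<forall>t\<in>T. \<forall>\<xi>\<in>S. f t \<xi> = g t \<xi>"
        then show "R (Suc j) (\<lambda>t \<xi>. - g t \<xi>)"
          using R(1)[unfolded local_family_def families_eq_on_def, rule_format, of "Suc j" "\<lambda>t \<xi>. - f t \<xi>"] by simp
      qed
      show "add_closed ?D"
        unfolding add_closed_def
      proof (intro allI impI)
        fix j and f g :: "'b \<Rightarrow> 'a \<Rightarrow> complex"
        assume "R (Suc j) (\<lambda>t \<xi>. - f t \<xi>)" "R (Suc j) (\<lambda>t \<xi>. - g t \<xi>)"
        from R(2)[unfolded add_closed_def, rule_format, OF this]
        show "R (Suc j) (\<lambda>t \<xi>. - (f t \<xi> + g t \<xi>))" by simp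
      qed
    qed (rule R3)
    moreover have "symbol_class S T n ?D g \<Longrightarrow> symbol_class S T n (\<lambda>j. R (Suc j)) (\<lambda>t \<xi>. - g t \<xi>)" for g
    proof -
      have gen: "symbol_class S T n (\<lambda>j f. Q j (\<lambda>t \<xi>. - f t \<xi>)) g \<Longrightarrow> local_family S T Q \<Longrightarrow> symbol_class S T n Q (\<lambda>t \<xi>. - g t \<xi>)"
        for Q and n g
      proof (induction n arbitrary: Q g)
        case (Suc n)
        have "symbol_class S T n (\<lambda>j. Q (Suc j)) (partial_family v (\<lambda>t \<xi>. - g t \<xi>))" if "v \<in> Basis" for v
        proof (rule symbol_class_cong[OF assms(1) local_family_Suc[OF Suc.prems(2)]])
          show "symbol_class S T n (\<lambda>j. Q (Suc j)) (\<lambda>t \<xi>. - partial_family v g t \<xi>)"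
            using Suc.IH[of "\<lambda>j. Q (Suc j)" "partial_family v g"] Suc.prems that local_family_Suc by auto
          show "families_eq_on S T (\<lambda>t \<xi>. - partial_family v g t \<xi>) (partial_family v (\<lambda>t \<xi>. - g t \<xi>))"
            using Suc.prems unfolding families_eq_on_def partial_family_def by (simp add: frechet_derivative_minus)
        qed
        then show ?case using Suc.prems by auto
      qed auto
      show "symbol_class S T n ?D g \<Longrightarrow> symbol_class S T n (\<lambda>j. R (Suc j)) (\<lambda>t \<xi>. - g t \<xi>)"
        by (rule gen) (auto intro: local_family_Suc R)
    qed
    ultimately show "symbol_class S T n (\<lambda>j. R (Suc j)) (\<lambda>t \<xi>. - (inverse (f t \<xi>) * inverse (f t \<xi>) * partial_family v f t \<xi>))" by simp
    show "families_eq_on S T (\<lambda>t \<xi>. - (inverse (f t \<xi>) * inverse (f t \<xi>) * partial_family v f t \<xi>)) (partial_family v (\<lambda>t \<xi>. inverse (f t \<xi>)))"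
      unfolding families_eq_on_def partial_family_def using d nz by (simp add: frechet_derivative_inverse_complex)
  qed
  then show ?case using base d nz by (auto simp: frechet_derivative_inverse_complex)
qed

text \<open>\<open>iter_pderiv\<close> applies the last element of the list first, whereas
  \<open>symbol_class\<close> peels off the first differentiation; hence the decomposition of the
  list from its end.\<close>

lemma symbol_class_iter_pderiv:
  "symbol_class S T n Q f \<Longrightarrow> set vs \<subseteq> Basis \<Longrightarrow> length vs \<le> n \<Longrightarrow>
    Q (length vs) (\<lambda>t. iter_pderiv vs (f t)) \<and>
    (length vs < n \<longrightarrow> (\<forall>t\<in>T. \<forall>\<xi>\<in>S. iter_pderiv vs (f t) differentiable (at \<xi>)))"
proof (induction n arbitrary: Q f vs)
  case 0
  then show ?case by simp
next
  case (Suc n)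
  show ?case
  proof (cases vs rule: rev_cases)
    case Nil
    then show ?thesis using Suc.prems by simp
  next
    case (snoc ws v)
    have "symbol_class S T n (\<lambda>j. Q (Suc j)) (partial_family v f)" using Suc.prems snoc by simp
    from Suc.IH[OF this, of ws] Suc.prems snoc
    show ?thesis by (simp add: iter_pderiv_append partial_family_def[abs_def])
  qed
qed

text \<open>After \<open>k\<close> derivatives the grading simply starts at \<open>k\<close>.
  Estimates for the derivatives still to come are kept, which is what finite differences after
  \<open>k\<close> integrations by parts call for.\<close>

lemma symbol_class_iter_pderiv_symbol_class:
  "symbol_class S T (n + k) Q f \<Longrightarrow> set vs \<subseteq> Basis \<Longrightarrow> length vs = k \<Longrightarrow>
    symbol_class S T n (\<lambda>j. Q (j + k)) (\<lambda>t. iter_pderiv vs (f t))"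
proof (induction k arbitrary: Q f vs)
  case 0
  then show ?case by simp
next
  case (Suc k)
  obtain ws v where vs: "vs = ws @ [v]" using Suc.prems by (cases vs rule: rev_cases) auto
  have "symbol_class S T (n + k) (\<lambda>j. Q (Suc j)) (partial_family v f)" using Suc.prems vs by simp
  from Suc.IH[OF this, of ws] Suc.prems vs
  show ?case by (simp add: iter_pderiv_append partial_family_def[abs_def])
qed

lemma iter_pderiv_symbol_class:
  assumes "\<And>vs. set vs \<subseteq> Basis \<Longrightarrow> length vs \<le> n \<Longrightarrow> Q (length vs) (\<lambda>t. iter_pderiv vs (f t))"
    and "\<And>vs t \<xi>. set vs \<subseteq> Basis \<Longrightarrow> length vs < n \<Longrightarrow> t \<in> T \<Longrightarrow> \<xi> \<in> S \<Longrightarrow> iter_pderiv vs (f t) differentiable (at \<xi>)"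
  shows "symbol_class S T n Q f"
  using assms
proof (induction n arbitrary: Q f)
  case 0
  from 0(1)[of "[]"] show ?case by simp
next
  case (Suc n)
  have "symbol_class S T n (\<lambda>j. Q (Suc j)) (partial_family v f)" if "v \<in> Basis" for v
  proof (rule Suc.IH)
    fix vs :: "'a list" assume "set vs \<subseteq> Basis" "length vs \<le> n"
    then show "Q (Suc (length vs)) (\<lambda>t. iter_pderiv vs (partial_family v f t))"
      using Suc.prems(1)[of "vs @ [v]"] that by (simp add: iter_pderiv_append partial_family_def[abs_def])
  next
    fix vs :: "'a list" and t \<xi> assume "set vs \<subseteq> Basis" "length vs < n" "t \<in> T" "\<xi> \<in> S"
    then show "iter_pderiv vs (partial_family v f t) differentiable at \<xi>"
      using Suc.prems(2)[of "vs @ [v]"] that by (simp add: iter_pderiv_append partial_family_def[abs_def])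
  qed
  then show ?case using Suc.prems(1)[of "[]"] Suc.prems(2)[of "[]"] by simp
qed

section \<open>Integrals of powers and the Gaussian\<close>

lemma japanese_bracket_ge_1: "1 \<le> japanese_bracket x"
  by (simp add: japanese_bracket_def)

lemma japanese_bracket_pos [simp]: "0 < japanese_bracket x"
  using japanese_bracket_ge_1[of x] by linarith

lemma norm_le_japanese_bracket: "norm x \<le> japanese_bracket x"
  unfolding japanese_bracket_def by (rule real_le_rsqrt) simp

lemma japanese_bracket_le: "japanese_bracket x \<le> 1 + norm x"
  unfolding japanese_bracket_def
  by (rule real_le_lsqrt) (auto simp: power2_eq_square algebra_simps)

lemma japanese_bracket_mono: "norm x \<le> norm y \<Longrightarrow> japanese_bracket x \<le> japanese_bracket y"
  unfolding japanese_bracket_def by (simp add: power_mono)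

text \<open>The bracket is the Euclidean length of (1, |x|), so this is the triangle inequality in
  the plane; replacing the first component 1 by 1 + 1 only enlarges the left side.\<close>

lemma japanese_bracket_add: "japanese_bracket (x + y) \<le> japanese_bracket x + japanese_bracket y"
proof -
  have "japanese_bracket (x + y) = norm (1::real, norm (x + y))"
    by (simp add: japanese_bracket_def norm_Pair)
  also have "\<dots> \<le> norm (1::real, norm x + norm y)"
    unfolding norm_Pair
    by (intro real_sqrt_le_mono add_mono order_refl power_mono) (auto intro: norm_triangle_ineq)
  also have "\<dots> \<le> norm ((1::real, norm x) + (1, norm y))"
    unfolding norm_Pair plus_prod_def by (intro real_sqrt_le_mono add_mono) auto
  also have "\<dots> \<le> norm (1::real, norm x) + norm (1::real, norm y)"
    by (rule norm_triangle_ineq)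
  finally show ?thesis by (simp add: japanese_bracket_def norm_Pair)
qed

lemma measurable_japanese_bracket [measurable]: "japanese_bracket \<in> borel_measurable borel"
  unfolding japanese_bracket_def[abs_def] by measurable

lemma japanese_bracket_minus [simp]: "japanese_bracket (- x) = japanese_bracket x"
  by (simp add: japanese_bracket_def)

text \<open>An invertible affine substitution preserves measurability in both directions, so
  integrability passes both ways for every \<open>f\<close>; for a non-integrable \<open>f\<close>
  the integral identity reads 0 = 0 by convention.\<close>

lemma integrable_lborel_affine:
  fixes f :: "'a::euclidean_space \<Rightarrow> 'b::{banach, second_countable_topology}"
  assumes c: "c \<noteq> 0"
  shows "integrable lborel (\<lambda>x. f (t + c *\<^sub>R x)) \<longleftrightarrow> integrable lborel f"
    and "integral\<^sup>L lborel f = \<bar>c\<bar> ^ DIM('a) *\<^sub>R (\<integral>x. f (t + c *\<^sub>R x) \<partial>lborel)"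
proof -
  have meas: "(\<lambda>x. f (t + c *\<^sub>R x)) \<in> borel_measurable borel \<longleftrightarrow> f \<in> borel_measurable borel"
  proof
    assume *: "(\<lambda>x. f (t + c *\<^sub>R x)) \<in> borel_measurable borel"
    have "(\<lambda>x. (\<lambda>x. f (t + c *\<^sub>R x)) (- (1 / c) *\<^sub>R t + (1 / c) *\<^sub>R x)) \<in> borel_measurable borel"
      by (rule measurable_compose[OF _ *]) measurable
    then show "f \<in> borel_measurable borel" using c by (simp add: scaleR_diff_right)
  next
    assume "f \<in> borel_measurable borel"
    then show "(\<lambda>x. f (t + c *\<^sub>R x)) \<in> borel_measurable borel" by measurable
  qed
  have k: "integrable lborel (\<lambda>x. k *\<^sub>R g x) \<longleftrightarrow> integrable lborel g" if "k \<noteq> 0" for k and g :: "'a \<Rightarrow> 'b"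
  proof
    assume "integrable lborel (\<lambda>x. k *\<^sub>R g x)"
    then have "integrable lborel (\<lambda>x. inverse k *\<^sub>R k *\<^sub>R g x)" by (rule integrable_scaleR_right)
    then show "integrable lborel g" using that by simp
  qed (rule integrable_scaleR_right)
  have A: "integrable lborel (\<lambda>x. f (t + c *\<^sub>R x)) \<longleftrightarrow> integrable lborel f" if "f \<in> borel_measurable borel"
  proof -
    note [measurable] = that
    have "integrable lborel f \<longleftrightarrow>
        integrable (density (distr lborel borel (\<lambda>x. t + c *\<^sub>R x)) (\<lambda>_. ennreal (\<bar>c\<bar> ^ DIM('a)))) f"
      using lborel_affine[OF c, of t] by simp
    also have "\<dots> \<longleftrightarrow> integrable (distr lborel borel (\<lambda>x. t + c *\<^sub>R x)) (\<lambda>x. (\<bar>c\<bar> ^ DIM('a)) *\<^sub>R f x)"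
      by (intro integrable_density) auto
    also have "\<dots> \<longleftrightarrow> integrable lborel (\<lambda>x. (\<bar>c\<bar> ^ DIM('a)) *\<^sub>R f (t + c *\<^sub>R x))"
      by (intro integrable_distr_eq) measurable
    also have "\<dots> \<longleftrightarrow> integrable lborel (\<lambda>x. f (t + c *\<^sub>R x))"
      using c by (intro k) auto
    finally show ?thesis ..
  qed
  show 1: "integrable lborel (\<lambda>x. f (t + c *\<^sub>R x)) \<longleftrightarrow> integrable lborel f"
  proof (cases "f \<in> borel_measurable borel")
    case False
    then show ?thesis using meas borel_measurable_integrable[of lborel f]
        borel_measurable_integrable[of lborel "\<lambda>x. f (t + c *\<^sub>R x)"] by auto
  qed (rule A)
  show "integral\<^sup>L lborel f = \<bar>c\<bar> ^ DIM('a) *\<^sub>R (\<integral>x. f (t + c *\<^sub>R x) \<partial>lborel)"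
  proof (cases "integrable lborel f")
    case True
    then have [measurable]: "f \<in> borel_measurable borel" by auto
    have "integral\<^sup>L lborel f =
        integral\<^sup>L (density (distr lborel borel (\<lambda>x. t + c *\<^sub>R x)) (\<lambda>_. ennreal (\<bar>c\<bar> ^ DIM('a)))) f"
      using lborel_affine[OF c, of t] by simp
    also have "\<dots> = (\<integral>x. (\<bar>c\<bar> ^ DIM('a)) *\<^sub>R f x \<partial>(distr lborel borel (\<lambda>x. t + c *\<^sub>R x)))"
      by (intro integral_density) auto
    also have "\<dots> = (\<integral>x. (\<bar>c\<bar> ^ DIM('a)) *\<^sub>R f (t + c *\<^sub>R x) \<partial>lborel)"
      by (intro integral_distr) measurable
    finally show ?thesis by simp
  next
    case False
    then show ?thesis using 1 by (simp add: not_integrable_integral_eq)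
  qed
qed

text \<open>\<open>lborel\<close> is the image, under the coordinate map, of the product of
  one-dimensional measures over \<open>Basis\<close>; a product of functions of single coordinates
  therefore integrates factor by factor.\<close>

lemma lborel_prod_integrable:
  fixes f :: "'a::euclidean_space \<Rightarrow> real \<Rightarrow> 'b::{real_normed_field,banach,second_countable_topology}"
  assumes f: "\<And>b. b \<in> Basis \<Longrightarrow> integrable lborel (f b)"
  shows "integrable lborel (\<lambda>x::'a. \<Prod>b\<in>Basis. f b (x \<bullet> b))"
    and "(\<integral>(x::'a). (\<Prod>b\<in>Basis. f b (x \<bullet> b)) \<partial>lborel) = (\<Prod>b\<in>Basis. (\<integral>x. f b x \<partial>lborel))"
proof -
  interpret product_sigma_finite "\<lambda>_::'a. lborel :: real measure" by standard
  have [measurable]: "f b \<in> borel_measurable borel" if "b \<in> Basis" for b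
    using borel_measurable_integrable[OF f[OF that]] by simp
  have *: "(\<Prod>b\<in>Basis. f b ((\<Sum>i\<in>Basis. g i *\<^sub>R i) \<bullet> b)) = (\<Prod>b\<in>Basis. f b (g b))" for g :: "'a \<Rightarrow> real"
    by (intro prod.cong) auto
  have m: "(\<lambda>x::'a. \<Prod>b\<in>Basis. f b (x \<bullet> b)) \<in> borel_measurable borel" by measurable
  show "integrable lborel (\<lambda>x::'a. \<Prod>b\<in>Basis. f b (x \<bullet> b))"
    using product_integrable_prod[of Basis f] f m
    by (subst lborel_eq) (simp add: integrable_distr_eq *)
  show "(\<integral>(x::'a). (\<Prod>b\<in>Basis. f b (x \<bullet> b)) \<partial>lborel) = (\<Prod>b\<in>Basis. (\<integral>x. f b x \<partial>lborel))"
    using product_integral_prod[of Basis f] f m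
    by (subst lborel_eq) (simp add: integral_distr *)
qed

section \<open>Integrability of powers at the origin and at infinity\<close>

lemma integrable_lborel_even:
  fixes f :: "real \<Rightarrow> real"
  assumes "f absolutely_integrable_on {0..}" "\<And>x. f (- x) = f x" and [measurable]: "f \<in> borel_measurable borel"
  shows "integrable lborel f"
proof -
  have "set_integrable lborel {0..} f"
    using assms(1) by (auto simp: set_integrable_def integrable_completion)
  then have 1: "integrable lborel (\<lambda>x. indicator {0..} x *\<^sub>R f x)"
    by (simp add: set_integrable_def)
  then have "integrable lborel (\<lambda>x. indicator {0..} (0 + (-1) *\<^sub>R x) *\<^sub>R f (0 + (-1) *\<^sub>R x))"
    using integrable_lborel_affine(1)[of "-1" "\<lambda>x. indicator {0..} x *\<^sub>R f x" 0] by simp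
  with 1 have "integrable lborel (\<lambda>x. indicator {0..} x *\<^sub>R f x + indicator {0..} (-x) *\<^sub>R f (-x))"
    by (intro Bochner_Integration.integrable_add) auto
  then show ?thesis
    by (rule Bochner_Integration.integrable_bound) (auto simp: assms(2) indicator_def)
qed

lemma integrable_powr_near_0:
  fixes b :: real
  assumes "b < 1"
  shows "integrable lborel (\<lambda>x::real. indicator {-1..1} x * \<bar>x\<bar> powr (-b))"
proof (rule integrable_lborel_even)
  have "((\<lambda>x. x powr (-b)) has_integral (1 powr (-b+1) / (-b+1))) {0..1}"
    by (rule has_integral_powr_from_0) (use assms in auto)
  then have "(\<lambda>x. x powr (-b)) absolutely_integrable_on {0..1}"
    by (intro nonnegative_absolutely_integrable_1) (auto simp: integrable_on_def)
  then show "(\<lambda>x. indicator {-1..1} x * \<bar>x\<bar> powr (-b)) absolutely_integrable_on {0..}"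
    unfolding set_integrable_def
    by (rule Bochner_Integration.integrable_cong[THEN iffD1, rotated -1]) (auto simp: indicator_def)
qed (auto simp: indicator_def)

lemma integrable_japanese_bracket_powr_real:
  fixes b :: real
  assumes "1 < b"
  shows "integrable lborel (\<lambda>x::real. japanese_bracket x powr (-b))"
proof (rule integrable_lborel_even)
  have "((\<lambda>x. x powr (-b)) has_integral (- (1 powr (-b+1)) / (-b+1))) {1..}"
    by (rule has_integral_powr_to_inf) (use assms in auto)
  then have "(\<lambda>x. x powr (-b)) absolutely_integrable_on {1..}"
    by (intro nonnegative_absolutely_integrable_1) (auto simp: integrable_on_def)
  then have 1: "integrable lebesgue (\<lambda>x. indicator {1..} x *\<^sub>R (x powr (-b)))"
    by (simp add: set_integrable_def)
  have "integrable lebesgue (\<lambda>x::real. indicator {0..1} x *\<^sub>R (1::real))"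
    by simp
  with 1 have "integrable lebesgue (\<lambda>x. indicator {1..} x *\<^sub>R (x powr (-b)) + indicator {0..1} x *\<^sub>R (1::real))"
    by (intro Bochner_Integration.integrable_add)
  then show "(\<lambda>x::real. japanese_bracket x powr (-b)) absolutely_integrable_on {0..}"
    unfolding set_integrable_def
  proof (rule Bochner_Integration.integrable_bound)
    have "(\<lambda>x::real. indicat_real {0..} x *\<^sub>R japanese_bracket x powr - b) \<in> borel_measurable lborel"
      by measurable
    then show "(\<lambda>x::real. indicat_real {0..} x *\<^sub>R japanese_bracket x powr - b) \<in> borel_measurable lebesgue"
      by (rule measurable_completion)
    have "norm (indicat_real {0..} x *\<^sub>R japanese_bracket x powr - b)
         \<le> norm (indicat_real {1..} x *\<^sub>R x powr - b + indicat_real {0..1} x *\<^sub>R 1)" for x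
    proof -
      have "japanese_bracket x powr (-b) \<le> 1"
        using powr_mono2'[of "-b" 1 "japanese_bracket x"] japanese_bracket_ge_1[of x] assms by auto
      moreover have "japanese_bracket x powr (-b) \<le> x powr (-b)" if "1 \<le> x"
        using powr_mono2'[of "-b" x "japanese_bracket x"] norm_le_japanese_bracket[of x] assms that by auto
      ultimately show ?thesis by (auto simp: indicator_def)
    qed
    then show "AE x in lebesgue. norm (indicat_real {0..} x *\<^sub>R japanese_bracket x powr - b)
         \<le> norm (indicat_real {1..} x *\<^sub>R x powr - b + indicat_real {0..1} x *\<^sub>R 1)" by simp
  qed
qed auto

text \<open>Used in place of polar coordinates: with the exponent shared equally by the d
  coordinates, a radial power is dominated by a product of one-dimensional powers, and the
  thresholds a < d and a > d become a/d < 1 and a/d > 1.\<close>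

lemma powr_eq_prod_Basis:
  assumes "0 < c"
  shows "c powr (-a) = (\<Prod>b\<in>(Basis::'a::euclidean_space set). c powr (-(a / real DIM('a))))"
proof -
  have "(c powr (-(a / real DIM('a)))) ^ DIM('a) = c powr (-(a / real DIM('a)) * real DIM('a))"
    using assms by (simp add: powr_powr flip: powr_realpow)
  then show ?thesis by simp
qed

lemma integrable_japanese_bracket_powr:
  assumes "real DIM('a) < a"
  shows "integrable lborel (\<lambda>x::'a::euclidean_space. japanese_bracket x powr (-a))"
proof -
  let ?d = "real DIM('a)"
  have d: "0 < ?d" by simp
  have "integrable lborel (\<lambda>x::'a. \<Prod>b\<in>Basis. japanese_bracket (x \<bullet> b) powr (-(a / ?d)))"
    by (rule lborel_prod_integrable(1), rule integrable_japanese_bracket_powr_real)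
       (use assms in \<open>simp add: field_simps\<close>)
  then show ?thesis
  proof (rule Bochner_Integration.integrable_bound)
    have "japanese_bracket x powr (-a) \<le> (\<Prod>b\<in>Basis. japanese_bracket (x \<bullet> b) powr (-(a / ?d)))" for x :: 'a
    proof -
      have "japanese_bracket x powr (-a) = (\<Prod>b\<in>(Basis::'a set). japanese_bracket x powr (-(a / ?d)))"
        by (rule powr_eq_prod_Basis) simp
      also have "\<dots> \<le> (\<Prod>b\<in>Basis. japanese_bracket (x \<bullet> b) powr (-(a / ?d)))"
      proof (intro prod_mono conjI)
        fix b :: 'a assume "b \<in> Basis"
        then have "japanese_bracket (x \<bullet> b) \<le> japanese_bracket x"
          using Basis_le_norm[of b x] by (auto simp: intro!: japanese_bracket_mono)
        then show "japanese_bracket x powr (-(a / ?d)) \<le> japanese_bracket (x \<bullet> b) powr (-(a / ?d))"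
          using assms d by (intro powr_mono2') (auto simp: divide_nonneg_pos)
      qed auto
      finally show ?thesis .
    qed
    then show "AE x::'a in lborel. norm (japanese_bracket x powr - a)
        \<le> norm (\<Prod>b\<in>Basis. japanese_bracket (x \<bullet> b) powr - (a / real DIM('a)))"
      by (auto simp: prod_nonneg)
  qed measurable
qed

lemma integrable_norm_powr_near_0:
  assumes "0 \<le> a" "a < real DIM('a)"
  shows "integrable lborel (\<lambda>x::'a::euclidean_space. indicator {x. norm x \<le> 1} x * norm x powr (-a))"
proof -
  let ?d = "real DIM('a)"
  have d: "0 < ?d" by simp
  have "integrable lborel (\<lambda>x::'a. \<Prod>b\<in>Basis. indicator {-1..1} (x \<bullet> b) * \<bar>x \<bullet> b\<bar> powr (-(a / ?d)))"
    by (rule lborel_prod_integrable(1), rule integrable_powr_near_0)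
       (use assms in \<open>simp add: field_simps\<close>)
  then show ?thesis
  proof (rule Bochner_Integration.integrable_bound)
    \<comment> \<open>The coordinate hyperplanes are removed because \<open>0 powr\<close> anything
      is 0: there the product vanishes and dominates nothing.\<close>
    have ae: "AE x::'a in lborel. \<forall>b\<in>Basis. x \<bullet> b \<noteq> 0"
    proof (intro AE_finite_allI)
      fix b :: 'a assume "b \<in> Basis"
      then have "negligible {x. x \<bullet> b = 0}"
        by (rule negligible_standard_hyperplane)
      then have "AE x in lebesgue. x \<bullet> b \<noteq> 0"
        using AE_not_in[of "{x. x \<bullet> b = 0}" lebesgue] by (simp add: negligible_iff_null_sets)
      then show "AE x in lborel. x \<bullet> b \<noteq> 0"
        by (simp add: AE_completion_iff)
    qed simp
    have that: "indicator {x. norm x \<le> 1} x * norm x powr (-a)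
      \<le> (\<Prod>b\<in>Basis. indicator {-1..1} (x \<bullet> b) * \<bar>x \<bullet> b\<bar> powr (-(a / ?d)))"
      if nz: "\<forall>b\<in>Basis. x \<bullet> b \<noteq> 0" for x :: 'a
    proof (cases "norm x \<le> 1")
      case True
      have "norm x powr (-a) = (\<Prod>b\<in>(Basis::'a set). norm x powr (-(a / ?d)))"
      proof (rule powr_eq_prod_Basis)
        show "0 < norm x" using nz nonempty_Basis by fastforce
      qed
      also have "\<dots> \<le> (\<Prod>b\<in>Basis. indicator {-1..1} (x \<bullet> b) * \<bar>x \<bullet> b\<bar> powr (-(a / ?d)))"
      proof (intro prod_mono conjI)
        fix b :: 'a assume b: "b \<in> Basis"
        have "\<bar>x \<bullet> b\<bar> \<le> norm x" using b by (rule Basis_le_norm)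
        moreover have "norm x powr (-(a / ?d)) \<le> \<bar>x \<bullet> b\<bar> powr (-(a / ?d))"
          using assms d nz b calculation by (intro powr_mono2') (auto simp: divide_nonneg_pos)
        ultimately show "norm x powr (-(a / ?d)) \<le> indicator {-1..1} (x \<bullet> b) * \<bar>x \<bullet> b\<bar> powr (-(a / ?d))"
          using True by (auto simp: indicator_def)
      qed auto
      finally show ?thesis using True by simp
    next
      case False
      then show ?thesis by (simp add: prod_nonneg)
    qed
    with ae show "AE x::'a in lborel. norm (indicator {x. norm x \<le> 1} x * norm x powr (-a))
      \<le> norm (\<Prod>b\<in>Basis. indicator {-1..1} (x \<bullet> b) * \<bar>x \<bullet> b\<bar> powr (-(a / ?d)))"
    proof (elim AE_mp[OF _ AE_I2], intro impI)
      fix x :: 'a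
      assume *: "\<forall>b\<in>Basis. x \<bullet> b \<noteq> 0"
      have z: "0 \<le> (indicator {x. norm x \<le> 1} x * norm x powr (-a) :: real)" by simp
      from order_trans[OF z that[OF *]] that[OF *] z
      show "norm (indicator {x. norm x \<le> 1} x * norm x powr (-a))
        \<le> norm (\<Prod>b\<in>Basis. indicator {-1..1} (x \<bullet> b) * \<bar>x \<bullet> b\<bar> powr (-(a / ?d)))"
        by (simp only: real_norm_def abs_of_nonneg)
    qed
  qed measurable
qed

text \<open>Scaling x = R y contributes R^d from the measure and R^(-a) from the integrand. The
  explicit power of R is the source of the rate |x|^(a - d) in the kernel bound, where R is of size
  1 / |x|.\<close>

lemma integral_norm_powr_inner:
  assumes "0 \<le> a" "a < real DIM('a)" "0 < R"
  shows "integrable lborel (\<lambda>x::'a::euclidean_space. indicator {x. norm x \<le> R} x * norm x powr (-a))"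
    and "(\<integral>(x::'a). indicator {x. norm x \<le> R} x * norm x powr (-a) \<partial>lborel)
      = R powr (real DIM('a) - a) * (\<integral>(x::'a). indicator {x. norm x \<le> 1} x * norm x powr (-a) \<partial>lborel)"
proof -
  have *: "indicator {x. norm x \<le> R} (0 + R *\<^sub>R x) * norm (0 + R *\<^sub>R x) powr (-a)
    = R powr (-a) * (indicator {x. norm x \<le> 1} x * norm x powr (-a))" for x :: 'a
    using assms(3) by (auto simp: indicator_def powr_mult field_simps)
  show "integrable lborel (\<lambda>x::'a. indicator {x. norm x \<le> R} x * norm x powr (-a))"
    by (subst integrable_lborel_affine(1)[of R _ 0, symmetric])
       (use assms in \<open>simp_all only: *, auto intro: integrable_norm_powr_near_0\<close>)
  show "(\<integral>(x::'a). indicator {x. norm x \<le> R} x * norm x powr (-a) \<partial>lborel)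
      = R powr (real DIM('a) - a) * (\<integral>(x::'a). indicator {x. norm x \<le> 1} x * norm x powr (-a) \<partial>lborel)"
    using assms(3)
    by (subst integrable_lborel_affine(2)[of R _ 0], simp, simp only: *)
       (simp add: powr_diff powr_minus divide_inverse powr_realpow)
qed

lemma integral_norm_powr_outer:
  assumes "real DIM('a) < a" "0 < R"
  shows "integrable lborel (\<lambda>x::'a::euclidean_space. indicator {x. R \<le> norm x} x * norm x powr (-a))"
    and "(\<integral>(x::'a). indicator {x. R \<le> norm x} x * norm x powr (-a) \<partial>lborel)
      = R powr (real DIM('a) - a) * (\<integral>(x::'a). indicator {x. 1 \<le> norm x} x * norm x powr (-a) \<partial>lborel)"
proof -
  have *: "indicator {x. R \<le> norm x} (0 + R *\<^sub>R x) * norm (0 + R *\<^sub>R x) powr (-a)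
    = R powr (-a) * (indicator {x. 1 \<le> norm x} x * norm x powr (-a))" for x :: 'a
    using assms(2) by (auto simp: indicator_def powr_mult field_simps)
  have a: "0 < a" using assms(1) by (rule order.strict_trans1[rotated]) simp
  have "integrable lborel (\<lambda>x::'a. 2 powr a * japanese_bracket x powr (-a))"
    using integrable_japanese_bracket_powr[OF assms(1)] by simp
  then have I: "integrable lborel (\<lambda>x::'a. indicator {x. 1 \<le> norm x} x * norm x powr (-a))"
  proof (rule Bochner_Integration.integrable_bound)
    have "norm x powr (-a) \<le> 2 powr a * japanese_bracket x powr (-a)" if "1 \<le> norm x" for x :: 'a
    proof -
      have "japanese_bracket x \<le> 2 * norm x" using japanese_bracket_le[of x] that by simp
      then have "(2 * norm x) powr (-a) \<le> japanese_bracket x powr (-a)"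
        using a by (intro powr_mono2') auto
      then have "2 powr a * (2 * norm x) powr (-a) \<le> 2 powr a * japanese_bracket x powr (-a)"
        by (intro mult_left_mono) auto
      moreover have "2 powr a * (2 * norm x) powr (-a) = norm x powr (-a)"
        by (simp add: powr_mult powr_minus)
      ultimately show ?thesis by simp
    qed
    then show "AE x::'a in lborel. norm (indicator {x. 1 \<le> norm x} x * norm x powr (-a))
      \<le> norm (2 powr a * japanese_bracket x powr (-a))"
      by (auto simp: indicator_def)
  qed measurable
  show "integrable lborel (\<lambda>x::'a. indicator {x. R \<le> norm x} x * norm x powr (-a))"
    by (subst integrable_lborel_affine(1)[of R _ 0, symmetric])
       (use assms I in \<open>simp_all only: *, auto\<close>)
  show "(\<integral>(x::'a). indicator {x. R \<le> norm x} x * norm x powr (-a) \<partial>lborel)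
      = R powr (real DIM('a) - a) * (\<integral>(x::'a). indicator {x. 1 \<le> norm x} x * norm x powr (-a) \<partial>lborel)"
    using assms(2)
    by (subst integrable_lborel_affine(2)[of R _ 0], simp, simp only: *)
       (simp add: powr_diff powr_minus divide_inverse powr_realpow)
qed

section \<open>The Gaussian density and its transform\<close>

definition gauss :: "'a::euclidean_space \<Rightarrow> real" where
  "gauss x = (1 / sqrt (2 * pi)) ^ DIM('a) * exp (- (norm x)\<^sup>2 / 2)"

lemma gauss_prod: "gauss x = (\<Prod>b\<in>Basis. std_normal_density (x \<bullet> b))"
  unfolding gauss_def std_normal_density_def prod.distrib prod_constant
  by (simp add: exp_sum[symmetric] sum_negf sum_divide_distrib[symmetric] power2_norm_eq_inner
        euclidean_inner[of x x] flip: power2_eq_square)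

lemma gauss_nonneg [simp]: "0 \<le> gauss x"
  by (simp add: gauss_def)

lemma measurable_gauss [measurable]: "gauss \<in> borel_measurable borel"
  unfolding gauss_def[abs_def] by measurable

lemma integrable_gauss: "integrable lborel (gauss :: 'a::euclidean_space \<Rightarrow> real)"
  and integral_gauss: "(\<integral>(x::'a::euclidean_space). gauss x \<partial>lborel) = 1"
  using lborel_prod_integrable[of "\<lambda>b::'a. std_normal_density"]
  by (simp_all add: gauss_prod[abs_def])

text \<open>Both the character and the density factor over the coordinates, so the integral is a
  product of characteristic functions of the one-dimensional standard normal law.\<close>

lemma fourier_gauss:
  "(\<integral>(x::'a::euclidean_space). exp (\<i> * complex_of_real (x \<bullet> \<xi>)) * complex_of_real (gauss x) \<partial>lborel)
    = complex_of_real (exp (- (norm \<xi>)\<^sup>2 / 2))"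
proof -
  let ?f = "\<lambda>b t. exp (\<i> * complex_of_real (t * (\<xi> \<bullet> b))) * complex_of_real (std_normal_density t)"
  have I: "integrable lborel (?f b)" for b :: 'a
  proof (rule Bochner_Integration.integrable_bound)
    show "integrable lborel std_normal_density" by (rule integrable_normal_density) simp
    show "AE x in lborel. cmod (?f b x) \<le> norm (std_normal_density x)"
      by (simp add: norm_mult)
  qed measurable
  have E: "(\<integral>t. ?f b t \<partial>lborel) = complex_of_real (exp (- (\<xi> \<bullet> b)\<^sup>2 / 2))" for b
  proof -
    have "char std_normal_distribution (\<xi> \<bullet> b) = (\<integral>t. std_normal_density t *\<^sub>R exp (\<i> * complex_of_real ((\<xi> \<bullet> b) * t)) \<partial>lborel)"
      unfolding char_def by (subst integral_density) auto
    then show ?thesis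
      by (simp add: char_std_normal_distribution scaleR_conv_of_real mult.commute)
  qed
  have "exp (\<i> * complex_of_real (x \<bullet> \<xi>)) * complex_of_real (gauss x) = (\<Prod>b\<in>Basis. ?f b (x \<bullet> b))" for x :: 'a
    unfolding gauss_prod prod.distrib by (simp add: exp_sum[symmetric] euclidean_inner[of x \<xi>] sum_distrib_left)
  then have "(\<integral>(x::'a). exp (\<i> * complex_of_real (x \<bullet> \<xi>)) * complex_of_real (gauss x) \<partial>lborel)
    = (\<Prod>b\<in>Basis. complex_of_real (exp (- (\<xi> \<bullet> b)\<^sup>2 / 2)))"
    using lborel_prod_integrable(2)[of ?f] I E by simp
  also have "\<dots> = complex_of_real (exp (- (norm \<xi>)\<^sup>2 / 2))"
    by (simp add: exp_sum[symmetric] sum_negf sum_divide_distrib[symmetric] power2_norm_eq_inner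
        euclidean_inner[of \<xi> \<xi>] flip: of_real_prod power2_eq_square)
  finally show ?thesis .
qed

section \<open>Fourier transform: inversion and differentiation\<close>

text \<open>The sign in the exponent is the opposite of the one in \<open>fourier\<close>, and there is no normalising factor.\<close>

definition ft :: "('a::euclidean_space \<Rightarrow> complex) \<Rightarrow> 'a \<Rightarrow> complex" where
  "ft f x = (\<integral>\<xi>. exp (\<i> * complex_of_real (x \<bullet> \<xi>)) * f \<xi> \<partial>lborel)"

lemma ft_integrand_integrable:
  assumes "integrable lborel f"
  shows "integrable lborel (\<lambda>\<xi>. exp (\<i> * complex_of_real (x \<bullet> \<xi>)) * f \<xi>)"
proof (rule Bochner_Integration.integrable_bound[OF assms])
  have [measurable]: "f \<in> borel_measurable borel" using assms by auto
  show "(\<lambda>\<xi>. exp (\<i> * complex_of_real (x \<bullet> \<xi>)) * f \<xi>) \<in> borel_measurable lborel" by measurable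
qed (simp add: norm_mult)

lemma norm_ft_le: "norm (ft f x) \<le> (\<integral>\<xi>. norm (f \<xi>) \<partial>lborel)"
proof -
  have "norm (ft f x) \<le> (\<integral>\<xi>. norm (exp (\<i> * complex_of_real (x \<bullet> \<xi>)) * f \<xi>) \<partial>lborel)"
    unfolding ft_def by (rule integral_norm_bound)
  then show ?thesis by (simp add: norm_mult)
qed

lemma ft_diff:
  assumes "integrable lborel f" "integrable lborel g"
  shows "ft (\<lambda>\<xi>. f \<xi> - g \<xi>) x = ft f x - ft g x"
  unfolding ft_def right_diff_distrib
  by (intro Bochner_Integration.integral_diff ft_integrand_integrable assms)

lemma ft_cmult: "ft (\<lambda>\<xi>. c * f \<xi>) x = c * ft f x"
proof -
  have "ft (\<lambda>\<xi>. c * f \<xi>) x = (\<integral>\<xi>. c * (exp (\<i> * complex_of_real (x \<bullet> \<xi>)) * f \<xi>) \<partial>lborel)"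
    unfolding ft_def by (intro arg_cong[where f="integral\<^sup>L lborel"]) (auto simp: mult_ac)
  then show ?thesis unfolding ft_def by simp
qed

lemma ft_shift: "ft (\<lambda>\<xi>. f (\<xi> + h)) x = exp (- \<i> * complex_of_real (x \<bullet> h)) * ft f x"
proof -
  let ?g = "\<lambda>\<xi>. exp (\<i> * complex_of_real (x \<bullet> (\<xi> - h))) * f \<xi>"
  have "ft (\<lambda>\<xi>. f (\<xi> + h)) x = (\<integral>\<xi>. ?g (h + 1 *\<^sub>R \<xi>) \<partial>lborel)"
    unfolding ft_def by (simp add: add.commute)
  also have "\<dots> = integral\<^sup>L lborel ?g"
    using integrable_lborel_affine(2)[of 1 ?g h] by simp
  also have "\<dots> = (\<integral>\<xi>. exp (- \<i> * complex_of_real (x \<bullet> h)) * (exp (\<i> * complex_of_real (x \<bullet> \<xi>)) * f \<xi>) \<partial>lborel)"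
    by (intro arg_cong[where f="integral\<^sup>L lborel"])
       (auto simp: inner_diff_right algebra_simps mult_exp_exp simp flip: mult.assoc)
  finally show ?thesis unfolding ft_def by simp
qed

lemma ft_modulate: "ft (\<lambda>\<xi>. exp (\<i> * complex_of_real (a \<bullet> \<xi>)) * f \<xi>) x = ft f (x + a)"
  unfolding ft_def
  by (intro arg_cong[where f="integral\<^sup>L lborel"] ext)
     (simp add: inner_add_left distrib_left exp_add mult_ac)

lemma ft_reflect: "ft (\<lambda>\<xi>. f (- \<xi>)) x = ft f (- x)"
proof -
  let ?g = "\<lambda>\<xi>. exp (\<i> * complex_of_real ((- x) \<bullet> \<xi>)) * f \<xi>"
  show ?thesis
    using integrable_lborel_affine(2)[of "-1" ?g 0] unfolding ft_def by simp
qed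

section \<open>Gaussian summation and Fourier inversion\<close>

lemma continuous_imp_bounded_converge_gauss:
  fixes f :: "'a::euclidean_space \<Rightarrow> complex"
  assumes [measurable]: "f \<in> borel_measurable borel" and B: "\<And>x. norm (f x) \<le> B"
    and cont: "isCont f a" and s: "s \<longlonglongrightarrow> 0"
  shows "(\<lambda>n. \<integral>z. f (a + s n *\<^sub>R z) * complex_of_real (gauss z) \<partial>lborel) \<longlonglongrightarrow> f a"
proof -
  have "(\<lambda>n. \<integral>z. f (a + s n *\<^sub>R z) * complex_of_real (gauss z) \<partial>lborel)
    \<longlonglongrightarrow> (\<integral>(z::'a). f a * complex_of_real (gauss z) \<partial>lborel)"
  proof (rule integral_dominated_convergence[where w="\<lambda>z. B * gauss z"])
    show "integrable lborel (\<lambda>z::'a. B * gauss z)" using integrable_gauss[where 'a='a] by simp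
    show "AE z in lborel. (\<lambda>n. f (a + s n *\<^sub>R z) * complex_of_real (gauss z)) \<longlonglongrightarrow> f a * complex_of_real (gauss z)"
    proof (rule AE_I2)
      fix z :: 'a
      have "(\<lambda>n. a + s n *\<^sub>R z) \<longlonglongrightarrow> a + 0 *\<^sub>R z" by (intro tendsto_intros s)
      then have "(\<lambda>n. f (a + s n *\<^sub>R z)) \<longlonglongrightarrow> f a"
        using cont by (auto intro: isCont_tendsto_compose)
      then show "(\<lambda>n. f (a + s n *\<^sub>R z) * complex_of_real (gauss z)) \<longlonglongrightarrow> f a * complex_of_real (gauss z)"
        by (intro tendsto_intros)
    qed
    show "AE z in lborel. norm (f (a + s n *\<^sub>R z) * complex_of_real (gauss z)) \<le> B * gauss z" for n
      using B by (auto simp: norm_mult intro!: mult_right_mono)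
  qed measurable
  also have "(\<integral>(z::'a). f a * complex_of_real (gauss z) \<partial>lborel) = f a"
    using integral_gauss[where 'a='a] by simp
  finally show ?thesis .
qed

text \<open>The constant arises in two halves: one factor \<open>sqrt (2 * pi) ^ DIM('a)\<close>
  turns the bare exponential into the density before the transform, a second one does so again
  afterwards. Their product is the constant of the inversion formula.\<close>

lemma gauss_scaled_ft:
  fixes \<xi> :: "'a::euclidean_space"
  assumes "0 < s"
  shows "(\<integral>x. exp (\<i> * complex_of_real (\<xi> \<bullet> x)) * complex_of_real (exp (- (norm (s *\<^sub>R x))\<^sup>2 / 2)) \<partial>lborel)
    = complex_of_real ((2 * pi) ^ DIM('a) / s ^ DIM('a) * gauss (\<xi> /\<^sub>R s))"
proof -
  let ?g = "\<lambda>x. exp (\<i> * complex_of_real (\<xi> \<bullet> x)) * complex_of_real (exp (- (norm (s *\<^sub>R x))\<^sup>2 / 2))"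
  let ?c = "sqrt (2 * pi) ^ DIM('a)"
  have c: "complex_of_real ?c \<noteq> 0" by simp
  have e: "complex_of_real (exp (- (norm x)\<^sup>2 / 2)) = complex_of_real ?c * complex_of_real (gauss x)" for x :: 'a
  proof -
    have "exp (- (norm x)\<^sup>2 / 2) = ?c * gauss x" by (simp add: gauss_def power_divide)
    then show ?thesis by (simp only: of_real_mult)
  qed
  have "?g (0 + (1 / s) *\<^sub>R x) = complex_of_real ?c * (exp (\<i> * complex_of_real (x \<bullet> (\<xi> /\<^sub>R s))) * complex_of_real (gauss x))" for x
  proof -
    have 1: "\<xi> \<bullet> (0 + (1 / s) *\<^sub>R x) = x \<bullet> (\<xi> /\<^sub>R s)" and 2: "s *\<^sub>R (0 + (1 / s) *\<^sub>R x) = x"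
      using assms by (simp_all add: inner_commute divide_inverse)
    show ?thesis unfolding 1 2 e by (simp only: mult_ac)
  qed
  then have "integral\<^sup>L lborel ?g = \<bar>1 / s\<bar> ^ DIM('a) *\<^sub>R
      (\<integral>x. complex_of_real ?c * (exp (\<i> * complex_of_real (x \<bullet> (\<xi> /\<^sub>R s))) * complex_of_real (gauss x)) \<partial>lborel)"
    using integrable_lborel_affine(2)[of "1 / s" ?g 0] assms by simp
  also have "\<dots> = \<bar>1 / s\<bar> ^ DIM('a) *\<^sub>R (complex_of_real ?c * complex_of_real (exp (- (norm (\<xi> /\<^sub>R s))\<^sup>2 / 2)))"
    by (simp only: integral_mult_right_zero fourier_gauss)
  also have "\<dots> = complex_of_real ((2 * pi) ^ DIM('a) / s ^ DIM('a) * gauss (\<xi> /\<^sub>R s))"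
  proof -
    have "?c * ?c = (sqrt (2 * pi) * sqrt (2 * pi)) ^ DIM('a)" by (simp only: power_mult_distrib)
    then have "?c * ?c = (2 * pi) ^ DIM('a)" by (simp only: real_sqrt_mult_self) simp
    moreover have "\<bar>1 / s\<bar> ^ DIM('a) = 1 / s ^ DIM('a)" using assms by (simp add: power_divide)
    moreover have "k * (c * (c * g)) = (c * c) * k * g" for k c g :: real by simp
    ultimately have "\<bar>1 / s\<bar> ^ DIM('a) * (?c * (?c * gauss (\<xi> /\<^sub>R s))) = (2 * pi) ^ DIM('a) * (1 / s ^ DIM('a)) * gauss (\<xi> /\<^sub>R s)"
      by metis
    then have "\<bar>1 / s\<bar> ^ DIM('a) * (?c * (?c * gauss (\<xi> /\<^sub>R s))) = (2 * pi) ^ DIM('a) / s ^ DIM('a) * gauss (\<xi> /\<^sub>R s)"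
      by simp
    then show ?thesis unfolding e by (simp only: scaleR_conv_of_real flip: of_real_mult)
  qed
  finally show ?thesis .
qed

text \<open>A Gaussian inserted in the outer integral makes the double integral absolutely
  convergent; Fubini turns it into a Gaussian average of \<open>f\<close> around -\<xi>, the
  reflection being due to the equal signs in the two exponents. As s tends to 0, integrability of
  \<open>ft f\<close> controls one side, continuity and boundedness of \<open>f\<close> the
  other.\<close>

theorem ft_inversion:
  fixes f :: "'a::euclidean_space \<Rightarrow> complex"
  assumes cont: "continuous_on UNIV f" and B: "\<And>x. norm (f x) \<le> B"
    and I: "integrable lborel f" and I': "integrable lborel (ft f)"
  shows "ft (ft f) \<xi> = complex_of_real ((2 * pi) ^ DIM('a)) * f (- \<xi>)"
proof -
  have [measurable]: "f \<in> borel_measurable borel" "ft f \<in> borel_measurable borel" using I I' by auto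
  define E where "E x = complex_of_real (exp (- (norm x)\<^sup>2 / 2))" for x :: 'a
  have [measurable]: "E \<in> borel_measurable borel" unfolding E_def[abs_def] by measurable
  have E_int: "integrable lborel (\<lambda>x::'a. E (s *\<^sub>R x))" if "0 < s" for s
  proof -
    have "integrable lborel E"
    proof -
      have "E = (\<lambda>x. complex_of_real (sqrt (2 * pi) ^ DIM('a) * gauss x))"
        by (simp add: E_def[abs_def] gauss_def power_divide)
      moreover have "integrable lborel (\<lambda>x::'a. sqrt (2 * pi) ^ DIM('a) * gauss x)"
        by (intro integrable_mult_right impI integrable_gauss)
      ultimately show ?thesis by (simp only: integrable_of_real)
    qed
    then show ?thesis using integrable_lborel_affine(1)[of s E 0] that by simp
  qed
  have key: "(\<integral>x. exp (\<i> * complex_of_real (\<xi> \<bullet> x)) * ft f x * E (s *\<^sub>R x) \<partial>lborel)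
      = complex_of_real ((2 * pi) ^ DIM('a)) * (\<integral>z. f (- \<xi> + s *\<^sub>R z) * complex_of_real (gauss z) \<partial>lborel)"
    if s: "0 < s" for s :: real
  proof -
    let ?F = "\<lambda>x \<eta>. exp (\<i> * complex_of_real (\<xi> \<bullet> x)) * (exp (\<i> * complex_of_real (x \<bullet> \<eta>)) * f \<eta>) * E (s *\<^sub>R x)"
    have "integrable (lborel \<Otimes>\<^sub>M lborel) (case_prod ?F)"
    proof (rule lborel_pair.Fubini_integrable)
      show "case_prod ?F \<in> borel_measurable (lborel \<Otimes>\<^sub>M lborel)" by measurable
      have "(\<integral>\<eta>. norm (case_prod ?F (x, \<eta>)) \<partial>lborel) = norm (E (s *\<^sub>R x)) * (\<integral>\<eta>. norm (f \<eta>) \<partial>lborel)" for x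
        by (simp add: norm_mult)
      then show "integrable lborel (\<lambda>x. \<integral>\<eta>. norm (case_prod ?F (x, \<eta>)) \<partial>lborel)"
        using E_int[OF s] by simp
      show "AE x in lborel. integrable lborel (\<lambda>\<eta>. case_prod ?F (x, \<eta>))"
        using ft_integrand_integrable[OF I] by auto
    qed
    from lborel_pair.Fubini_integral[OF this]
    have "(\<integral>x. exp (\<i> * complex_of_real (\<xi> \<bullet> x)) * ft f x * E (s *\<^sub>R x) \<partial>lborel)
       = (\<integral>\<eta>. (\<integral>x. ?F x \<eta> \<partial>lborel) \<partial>lborel)"
      by (simp add: ft_def)
    also have "\<dots> = (\<integral>\<eta>. f \<eta> * complex_of_real ((2 * pi) ^ DIM('a) / s ^ DIM('a) * gauss ((\<xi> + \<eta>) /\<^sub>R s)) \<partial>lborel)"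
    proof (intro arg_cong[where f="integral\<^sup>L lborel"] ext)
      fix \<eta>
      have "(\<integral>x. ?F x \<eta> \<partial>lborel) = (\<integral>x. f \<eta> * (exp (\<i> * complex_of_real ((\<xi> + \<eta>) \<bullet> x)) * E (s *\<^sub>R x)) \<partial>lborel)"
      proof (intro arg_cong[where f="integral\<^sup>L lborel"] ext)
        fix x
        have "exp (\<i> * complex_of_real ((\<xi> + \<eta>) \<bullet> x))
          = exp (\<i> * complex_of_real (\<xi> \<bullet> x)) * exp (\<i> * complex_of_real (x \<bullet> \<eta>))"
          by (simp add: inner_add_left distrib_left exp_add inner_commute[of \<eta>])
        then show "?F x \<eta> = f \<eta> * (exp (\<i> * complex_of_real ((\<xi> + \<eta>) \<bullet> x)) * E (s *\<^sub>R x))"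
          by (simp only: mult_ac)
      qed
      also have "\<dots> = f \<eta> * complex_of_real ((2 * pi) ^ DIM('a) / s ^ DIM('a) * gauss ((\<xi> + \<eta>) /\<^sub>R s))"
        unfolding integral_mult_right_zero E_def gauss_scaled_ft[OF s] ..
      finally show "(\<integral>x. ?F x \<eta> \<partial>lborel) = f \<eta> * complex_of_real ((2 * pi) ^ DIM('a) / s ^ DIM('a) * gauss ((\<xi> + \<eta>) /\<^sub>R s))" .
    qed
    \<comment> \<open>The substitution centred at -\<xi> with scale s produces the Jacobian that
      cancels the power of s in the transformed Gaussian.\<close>
    also have "\<dots> = s ^ DIM('a) *\<^sub>R (\<integral>z. f (- \<xi> + s *\<^sub>R z) *
        complex_of_real ((2 * pi) ^ DIM('a) / s ^ DIM('a) * gauss ((\<xi> + (- \<xi> + s *\<^sub>R z)) /\<^sub>R s)) \<partial>lborel)"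
      using s by (subst integrable_lborel_affine(2)[of s _ "-\<xi>"]) auto
    also have "\<dots> = s ^ DIM('a) *\<^sub>R (\<integral>z. complex_of_real ((2 * pi) ^ DIM('a) / s ^ DIM('a)) *
        (f (- \<xi> + s *\<^sub>R z) * complex_of_real (gauss z)) \<partial>lborel)"
      using s by (intro arg_cong[where f="\<lambda>f. s ^ DIM('a) *\<^sub>R integral\<^sup>L lborel f"] ext) simp
    also have "\<dots> = complex_of_real ((2 * pi) ^ DIM('a)) * (\<integral>z. f (- \<xi> + s *\<^sub>R z) * complex_of_real (gauss z) \<partial>lborel)"
      using s by (simp only: integral_mult_right_zero) (simp add: scaleR_conv_of_real)
    finally show ?thesis .
  qed
  define s where "s n = 1 / real (Suc n)" for n
  have s: "s \<longlonglongrightarrow> 0" "0 < s n" for n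
    unfolding s_def[abs_def] using LIMSEQ_inverse_real_of_nat by (auto simp: divide_inverse)
  have "(\<lambda>n. \<integral>x. exp (\<i> * complex_of_real (\<xi> \<bullet> x)) * ft f x * E (s n *\<^sub>R x) \<partial>lborel)
     \<longlonglongrightarrow> (\<integral>x. exp (\<i> * complex_of_real (\<xi> \<bullet> x)) * ft f x * E 0 \<partial>lborel)"
  proof (rule integral_dominated_convergence[where w="\<lambda>x. norm (ft f x)"])
    show "AE x in lborel. (\<lambda>n. exp (\<i> * complex_of_real (\<xi> \<bullet> x)) * ft f x * E (s n *\<^sub>R x))
       \<longlonglongrightarrow> exp (\<i> * complex_of_real (\<xi> \<bullet> x)) * ft f x * E 0"
    proof (rule AE_I2)
      fix x :: 'a
      have "(\<lambda>n. s n *\<^sub>R x) \<longlonglongrightarrow> 0 *\<^sub>R x" by (intro tendsto_intros s)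
      then have "(\<lambda>n. E (s n *\<^sub>R x)) \<longlonglongrightarrow> complex_of_real (exp (- (norm (0 *\<^sub>R x))\<^sup>2 / 2))"
        unfolding E_def by (intro tendsto_of_real tendsto_exp tendsto_divide tendsto_minus tendsto_power tendsto_norm tendsto_const) auto
      then have "(\<lambda>n. E (s n *\<^sub>R x)) \<longlonglongrightarrow> E 0" by (simp add: E_def)
      then show "(\<lambda>n. exp (\<i> * complex_of_real (\<xi> \<bullet> x)) * ft f x * E (s n *\<^sub>R x))
       \<longlonglongrightarrow> exp (\<i> * complex_of_real (\<xi> \<bullet> x)) * ft f x * E 0"
        by (intro tendsto_intros)
    qed
    show "AE x in lborel. norm (exp (\<i> * complex_of_real (\<xi> \<bullet> x)) * ft f x * E (s n *\<^sub>R x)) \<le> norm (ft f x)" for n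
      by (intro AE_I2) (simp add: norm_mult E_def mult_right_le_one_le)
  qed (use I' in auto)
  then have L: "(\<lambda>n. \<integral>x. exp (\<i> * complex_of_real (\<xi> \<bullet> x)) * ft f x * E (s n *\<^sub>R x) \<partial>lborel) \<longlonglongrightarrow> ft (ft f) \<xi>"
    by (simp add: ft_def[of "ft f"] E_def[of 0])
  have R: "(\<lambda>n. complex_of_real ((2 * pi) ^ DIM('a)) * (\<integral>z. f (- \<xi> + s n *\<^sub>R z) * complex_of_real (gauss z) \<partial>lborel))
     \<longlonglongrightarrow> complex_of_real ((2 * pi) ^ DIM('a)) * f (- \<xi>)"
    using cont by (intro tendsto_mult_left continuous_imp_bounded_converge_gauss[OF _ B _ s(1)])
      (auto simp: continuous_on_eq_continuous_at)
  show ?thesis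
    by (rule LIMSEQ_unique[OF L[unfolded key[OF s(2)]] R])
qed

text \<open>The exact finite-difference identity \<open>f (\<xi> + t e) - f \<xi> = \<integral>\<^sub>0\<^sup>t \<partial>\<^sub>e f (\<xi> + s e) ds\<close> is transformed
  rather than the derivative itself, so no limit of difference quotients has to be taken; one
  singular point of \<open>\<partial>\<^sub>e f\<close> is harmless.\<close>

lemma ft_pderiv:
  fixes f g :: "'a::euclidean_space \<Rightarrow> complex"
  assumes cont: "continuous_on UNIV f" and e: "e \<noteq> 0"
    and d: "\<And>\<xi>. \<xi> \<noteq> 0 \<Longrightarrow> f differentiable (at \<xi>)"
    and g: "\<And>\<xi>. \<xi> \<noteq> 0 \<Longrightarrow> g \<xi> = frechet_derivative f (at \<xi>) e"
    and If: "integrable lborel f" and Ig: "integrable lborel g"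
  shows "ft g x = - \<i> * complex_of_real (x \<bullet> e) * ft f x"
proof -
  have [measurable]: "g \<in> borel_measurable borel" "f \<in> borel_measurable borel" using Ig If by auto
  \<comment> \<open>This length makes \<open>exp (- \<i> * t * (x \<bullet> e))\<close> equal to -1,
    so the factor in front of \<open>ft f x\<close> becomes -2 and can be divided out. If x is
    orthogonal to e, both that factor and the claimed right-hand side vanish, and any positive t
    will do.\<close>
  define t where "t = (if x \<bullet> e = 0 then 1 else pi / \<bar>x \<bullet> e\<bar>)"
  have t: "0 < t" by (auto simp: t_def)
  define G where "G s \<xi> = indicator {0..t} s *\<^sub>R g (\<xi> + s *\<^sub>R e)" for s :: real and \<xi>
  have shift: "integrable lborel (\<lambda>\<xi>. g (\<xi> + s *\<^sub>R e))"
      "(\<integral>\<xi>. norm (g (\<xi> + s *\<^sub>R e)) \<partial>lborel) = (\<integral>\<xi>. norm (g \<xi>) \<partial>lborel)" for s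
    using integrable_lborel_affine(1)[of 1 g "s *\<^sub>R e"] integrable_lborel_affine(2)[of 1 "\<lambda>x. norm (g x)" "s *\<^sub>R e"] Ig
    by (simp_all add: add.commute)
  have It: "integrable lborel (\<lambda>s. indicator {0..t} s :: real)"
    using t by (intro integrable_real_indicator) auto
  have IG: "integrable (lborel \<Otimes>\<^sub>M lborel) (case_prod G)"
  proof (rule lborel_pair.Fubini_integrable)
    show "case_prod G \<in> borel_measurable (lborel \<Otimes>\<^sub>M lborel)" unfolding G_def by measurable
    show "integrable lborel (\<lambda>s. \<integral>\<xi>. norm (case_prod G (s, \<xi>)) \<partial>lborel)"
      using It by (simp add: G_def shift)
    show "AE s in lborel. integrable lborel (\<lambda>\<xi>. case_prod G (s, \<xi>))"
      using shift by (auto simp: G_def)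
  qed
  let ?H = "\<lambda>s \<xi>. exp (\<i> * complex_of_real (x \<bullet> \<xi>)) * G s \<xi>"
  have IH: "integrable (lborel \<Otimes>\<^sub>M lborel) (case_prod ?H)"
    by (rule Bochner_Integration.integrable_bound[OF IG])
       (use borel_measurable_integrable[OF IG] in \<open>auto simp: norm_mult split_def\<close>)
  have "AE \<xi> in lborel. integrable lborel (\<lambda>s. G s \<xi>)"
    using lborel_pair.AE_integrable_fst'[OF lborel_pair.integrable_product_swap[OF IG]] by simp
  then have ae: "AE \<xi> in lborel. (\<integral>s. G s \<xi> \<partial>lborel) = f (\<xi> + t *\<^sub>R e) - f \<xi>"
  proof (rule AE_mp, intro AE_I2 impI)
    fix \<xi> assume *: "integrable lborel (\<lambda>s. G s \<xi>)"
    then have si: "set_integrable lborel {0..t} (\<lambda>s. g (\<xi> + s *\<^sub>R e))"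
      by (simp add: set_integrable_def G_def)
    \<comment> \<open>A line in direction e meets the origin for at most one s, and the fundamental
      theorem tolerates a finite exceptional set where the function is merely continuous.\<close>
    let ?S = "{s. \<xi> + s *\<^sub>R e = 0}"
    have "((\<lambda>s. g (\<xi> + s *\<^sub>R e)) has_integral (f (\<xi> + t *\<^sub>R e) - f (\<xi> + 0 *\<^sub>R e))) {0..t}"
    proof (rule fundamental_theorem_of_calculus_strong)
      show "finite ?S"
      proof (rule finite_subset)
        show "?S \<subseteq> {- (\<xi> \<bullet> e) / (e \<bullet> e)}"
        proof
          fix s assume "s \<in> ?S"
          then have "(\<xi> + s *\<^sub>R e) \<bullet> e = 0" by simp
          then show "s \<in> {- (\<xi> \<bullet> e) / (e \<bullet> e)}" using e by (simp add: inner_add_left field_simps)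
        qed
      qed simp
      show "continuous_on {0..t} (\<lambda>s. f (\<xi> + s *\<^sub>R e))"
        by (rule continuous_on_compose2[OF cont]) (auto intro!: continuous_intros)
      fix s assume "s \<in> {0..t} - ?S"
      then have nz: "\<xi> + s *\<^sub>R e \<noteq> 0" by simp
      have D: "(f has_derivative frechet_derivative f (at (\<xi> + s *\<^sub>R e))) (at (\<xi> + s *\<^sub>R e))"
        using d[OF nz] by (simp add: frechet_derivative_works)
      have "((\<lambda>s. f (\<xi> + s *\<^sub>R e)) has_derivative (\<lambda>r. frechet_derivative f (at (\<xi> + s *\<^sub>R e)) (r *\<^sub>R e))) (at s)"
        by (rule has_derivative_compose[of "\<lambda>s. \<xi> + s *\<^sub>R e", OF _ D]) (auto intro!: derivative_eq_intros)
      then show "((\<lambda>s. f (\<xi> + s *\<^sub>R e)) has_vector_derivative g (\<xi> + s *\<^sub>R e)) (at s)"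
        unfolding has_vector_derivative_def g[OF nz]
        using linear_cmul[OF has_derivative_linear[OF D]] by simp
    qed (use t in simp)
    with set_borel_integral_eq_integral[OF si] show "(\<integral>s. G s \<xi> \<partial>lborel) = f (\<xi> + t *\<^sub>R e) - f \<xi>"
      by (simp add: G_def set_lebesgue_integral_def integral_unique)
  qed
  have "(\<integral>\<xi>. (\<integral>s. ?H s \<xi> \<partial>lborel) \<partial>lborel) = (\<integral>s. (\<integral>\<xi>. ?H s \<xi> \<partial>lborel) \<partial>lborel)"
    by (rule lborel_pair.Fubini_integral[OF IH])
  also have "(\<integral>\<xi>. (\<integral>s. ?H s \<xi> \<partial>lborel) \<partial>lborel) = ft (\<lambda>\<xi>. f (\<xi> + t *\<^sub>R e) - f \<xi>) x"
    unfolding ft_def integral_mult_right_zero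
    by (rule integral_cong_AE) (use ae IG in \<open>auto intro: AE_mp\<close>)
  also have "\<dots> = (exp (- \<i> * complex_of_real (x \<bullet> (t *\<^sub>R e))) - 1) * ft f x"
  proof -
    have "integrable lborel (\<lambda>\<xi>. f (\<xi> + t *\<^sub>R e))"
      using integrable_lborel_affine(1)[of 1 f "t *\<^sub>R e"] If by (simp add: add.commute)
    then show ?thesis by (simp add: ft_diff If ft_shift left_diff_distrib)
  qed
  also have "(\<integral>s. (\<integral>\<xi>. ?H s \<xi> \<partial>lborel) \<partial>lborel)
    = (\<integral>s. indicator {0..t} s *\<^sub>R (exp (- \<i> * complex_of_real (x \<bullet> (s *\<^sub>R e))) * ft g x) \<partial>lborel)"
  proof (intro arg_cong[where f="integral\<^sup>L lborel"] ext)
    fix s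
    have "(\<integral>\<xi>. ?H s \<xi> \<partial>lborel) = (\<integral>\<xi>. indicator {0..t} s *\<^sub>R (exp (\<i> * complex_of_real (x \<bullet> \<xi>)) * g (\<xi> + s *\<^sub>R e)) \<partial>lborel)"
      by (simp add: G_def)
    also have "\<dots> = indicator {0..t} s *\<^sub>R ft (\<lambda>\<xi>. g (\<xi> + s *\<^sub>R e)) x"
      by (simp only: integral_scaleR_right ft_def)
    finally show "(\<integral>\<xi>. ?H s \<xi> \<partial>lborel) = indicator {0..t} s *\<^sub>R (exp (- \<i> * complex_of_real (x \<bullet> (s *\<^sub>R e))) * ft g x)"
      by (simp only: ft_shift)
  qed
  also have "\<dots> = (\<integral>s. indicator {0..t} s *\<^sub>R exp (- \<i> * complex_of_real (x \<bullet> e) * complex_of_real s) \<partial>lborel) * ft g x"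
  proof -
    have "(indicator {0..t} s :: real) *\<^sub>R (exp (- \<i> * complex_of_real (x \<bullet> (s *\<^sub>R e))) * ft g x)
      = (indicator {0..t} s *\<^sub>R exp (- \<i> * complex_of_real (x \<bullet> e) * complex_of_real s)) * ft g x" for s
      by (simp add: mult_ac)
    then show ?thesis by (simp only: integral_mult_left_zero)
  qed
  finally have main: "(exp (- \<i> * complex_of_real (x \<bullet> (t *\<^sub>R e))) - 1) * ft f x
    = (\<integral>s. indicator {0..t} s *\<^sub>R exp (- \<i> * complex_of_real (x \<bullet> e) * complex_of_real s) \<partial>lborel) * ft g x" .
  show ?thesis
  proof (cases "x \<bullet> e = 0")
    case True
    have "(\<integral>s. indicator {0..t} s *\<^sub>R (1::complex) \<partial>lborel) = complex_of_real t"
    proof -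
      have "(\<integral>s. indicator {0..t} s *\<^sub>R (1::complex) \<partial>lborel) = (\<integral>s. indicator {0..t} s \<partial>lborel) *\<^sub>R 1"
        by (intro integral_scaleR_left impI It)
      then show ?thesis using t by (simp add: scaleR_conv_of_real)
    qed
    with main True t show ?thesis by simp
  next
    case False
    let ?a = "x \<bullet> e" and ?k = "- \<i> * complex_of_real (x \<bullet> e)"
    have k: "?k \<noteq> 0" using False by simp
    have ex: "exp (?k * complex_of_real t) = -1"
    proof (cases "0 < ?a")
      case True
      then have "?k * complex_of_real t = - (\<i> * pi)" by (simp add: t_def)
      then show ?thesis by (simp only: exp_minus) (simp add: exp_pi_i')
    next
      case False
      with \<open>?a \<noteq> 0\<close> have "?k * complex_of_real t = \<i> * pi" by (simp add: t_def field_simps)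
      then show ?thesis by (simp add: exp_pi_i')
    qed
    have D: "((\<lambda>s. exp (?k * complex_of_real s) / ?k) has_vector_derivative exp (?k * complex_of_real s)) (at s within S)" for s S
    proof -
      have "((\<lambda>z. exp (?k * z) / ?k) has_field_derivative exp (?k * complex_of_real s)) (at (complex_of_real s))"
        using k by (auto intro!: derivative_eq_intros)
      from has_vector_derivative_real_field[OF this] show ?thesis
        by (simp add: o_def has_vector_derivative_at_within)
    qed
    have "((\<lambda>s. exp (?k * complex_of_real s)) has_integral
        (exp (?k * complex_of_real t) / ?k - exp (?k * complex_of_real 0) / ?k)) {0..t}"
      by (rule fundamental_theorem_of_calculus) (use t D in auto)
    then have "integral {0..t} (\<lambda>s. exp (?k * complex_of_real s)) = -1 / ?k - 1 / ?k"
      unfolding ex by (intro integral_unique) simp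
    moreover have "-1 / ?k - 1 / ?k = -2 / ?k" by (simp add: diff_divide_distrib[symmetric] del: minus_mult_minus)
    moreover have "set_integrable lborel {0..t} (\<lambda>s. exp (?k * complex_of_real s))"
      by (rule borel_integrable_atLeastAtMost') (intro continuous_intros)
    ultimately have "(\<integral>s. indicator {0..t} s *\<^sub>R exp (?k * complex_of_real s) \<partial>lborel) = -2 / ?k"
      using set_borel_integral_eq_integral(2)[of "{0..t}" "\<lambda>s. exp (?k * complex_of_real s)"]
      by (simp only: set_lebesgue_integral_def)
    moreover have "exp (- \<i> * complex_of_real (x \<bullet> (t *\<^sub>R e))) = -1"
      using ex by (simp add: mult_ac)
    ultimately have "(-2) * ft f x = (-2 / ?k) * ft g x" using main by simp
    moreover have "G = k * F" if "(-2) * F = (-2 / k) * G" "k \<noteq> 0" for k F G :: complex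
      using that by (simp add: field_simps)
    ultimately show ?thesis using k by blast
  qed
qed

section \<open>Kernel estimates by finite differences\<close>

primrec forward_diff :: "'a::euclidean_space \<Rightarrow> nat \<Rightarrow> ('a \<Rightarrow> complex) \<Rightarrow> 'a \<Rightarrow> complex" where
  "forward_diff h 0 f = f"
| "forward_diff h (Suc n) f = (\<lambda>\<xi>. forward_diff h n f (\<xi> + h) - forward_diff h n f \<xi>)"

lemma integrable_translate:
  fixes f :: "'a::euclidean_space \<Rightarrow> 'b::{banach, second_countable_topology}"
  shows "integrable lborel (\<lambda>\<xi>. f (\<xi> + h)) \<longleftrightarrow> integrable lborel f"
    and "(\<integral>\<xi>. f (\<xi> + h) \<partial>lborel) = integral\<^sup>L lborel f"
  using integrable_lborel_affine[of 1 f h] by (simp_all add: add.commute)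

lemma forward_diff_integrable: "integrable lborel f \<Longrightarrow> integrable lborel (forward_diff h n f)"
  by (induction n) (auto simp: integrable_translate(1))

lemma ft_forward_diff:
  assumes "integrable lborel f"
  shows "ft (forward_diff h n f) x = (exp (- \<i> * complex_of_real (x \<bullet> h)) - 1) ^ n * ft f x"
proof (induction n)
  case (Suc n)
  show ?case
    using Suc forward_diff_integrable[OF assms, of h n]
    by (simp add: ft_diff integrable_translate(1) ft_shift algebra_simps)
qed simp

text \<open>Each difference is a sum of two translates: the mass at most doubles and the ball grows
  by the length of h.\<close>

lemma forward_diff_inner_integral:
  fixes f :: "'a::euclidean_space \<Rightarrow> complex"
  assumes f: "integrable lborel f"
  shows "(\<integral>\<xi>. indicator {\<xi>. norm \<xi> \<le> r} \<xi> * norm (forward_diff h n f \<xi>) \<partial>lborel)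
    \<le> 2 ^ n * (\<integral>\<xi>. indicator {\<xi>. norm \<xi> \<le> r + real n * norm h} \<xi> * norm (f \<xi>) \<partial>lborel)"
proof (induction n arbitrary: r)
  case 0
  show ?case by simp
next
  case (Suc n)
  let ?F = "forward_diff h n f"
  have I: "integrable lborel (\<lambda>\<xi>. indicator {\<xi>. norm \<xi> \<le> r} \<xi> * norm (g \<xi>))"
    if "integrable lborel g" for r and g :: "'a \<Rightarrow> complex"
  proof (rule Bochner_Integration.integrable_bound[OF integrable_norm[OF that]])
    have [measurable]: "g \<in> borel_measurable borel" using that by auto
    show "(\<lambda>\<xi>. indicator {\<xi>. norm \<xi> \<le> r} \<xi> * norm (g \<xi>)) \<in> borel_measurable lborel" by measurable
  qed (auto simp: indicator_def)
  note F = forward_diff_integrable[OF f, of h n]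
  let ?J = "\<lambda>r g. (\<integral>\<xi>. indicator {\<xi>. norm \<xi> \<le> r} \<xi> * norm (g \<xi> :: complex) \<partial>lborel)"
  have mono: "?J r g \<le> ?J r' g" if "r \<le> r'" "integrable lborel g" for r r' and g :: "'a \<Rightarrow> complex"
    using that by (intro integral_mono I) (auto simp: indicator_def)
  have "?J r (forward_diff h (Suc n) f) \<le>
    (\<integral>\<xi>. indicator {\<xi>. norm \<xi> \<le> r + norm h} (\<xi> + h) * norm (?F (\<xi> + h)) + indicator {\<xi>. norm \<xi> \<le> r} \<xi> * norm (?F \<xi>) \<partial>lborel)"
  proof (rule integral_mono)
    show "integrable lborel (\<lambda>\<xi>. indicator {\<xi>. norm \<xi> \<le> r} \<xi> * norm (forward_diff h (Suc n) f \<xi>))"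
      by (rule I[OF forward_diff_integrable[OF f]])
    show "integrable lborel (\<lambda>\<xi>. indicator {\<xi>. norm \<xi> \<le> r + norm h} (\<xi> + h) * norm (?F (\<xi> + h)) + indicator {\<xi>. norm \<xi> \<le> r} \<xi> * norm (?F \<xi>))"
      using I[OF F, of r] integrable_translate(1)[of "\<lambda>\<xi>. indicator {\<xi>. norm \<xi> \<le> r + norm h} \<xi> * norm (?F \<xi>)" h] I[OF F, of "r + norm h"]
      by (intro Bochner_Integration.integrable_add) auto
    fix \<xi> :: 'a
    show "indicator {\<xi>. norm \<xi> \<le> r} \<xi> * norm (forward_diff h (Suc n) f \<xi>)
      \<le> indicator {\<xi>. norm \<xi> \<le> r + norm h} (\<xi> + h) * norm (?F (\<xi> + h)) + indicator {\<xi>. norm \<xi> \<le> r} \<xi> * norm (?F \<xi>)"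
      using norm_triangle_ineq[of \<xi> h] norm_triangle_ineq4[of "?F (\<xi> + h)" "?F \<xi>"] by (auto simp: indicator_def)
  qed
  also have "\<dots> = ?J (r + norm h) ?F + ?J r ?F"
    using I[OF F, of r] integrable_translate[of "\<lambda>\<xi>. indicator {\<xi>. norm \<xi> \<le> r + norm h} \<xi> * norm (?F \<xi>)" h] I[OF F, of "r + norm h"]
    by (subst Bochner_Integration.integral_add) auto
  also have "\<dots> \<le> ?J (r + norm h) ?F + ?J (r + norm h) ?F"
    using mono[OF _ F, of r "r + norm h"] by simp
  also have "\<dots> \<le> 2 * (2 ^ n * ?J (r + norm h + real n * norm h) f)"
    using Suc.IH[of "r + norm h"] by simp
  finally show ?case by (simp add: algebra_simps)
qed

lemma forward_diff_has_derivative: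
  assumes "\<And>j. j \<le> n \<Longrightarrow> f differentiable (at (\<xi> + real j *\<^sub>R h))"
  shows "(forward_diff h n f has_derivative (\<lambda>v. forward_diff h n (\<lambda>\<eta>. frechet_derivative f (at \<eta>) v) \<xi>)) (at \<xi>)"
  using assms
proof (induction n arbitrary: \<xi>)
  case 0
  from 0[of 0] show ?case by (simp add: frechet_derivative_works)
next
  case (Suc n)
  have 1: "(forward_diff h n f has_derivative (\<lambda>v. forward_diff h n (\<lambda>\<eta>. frechet_derivative f (at \<eta>) v) \<xi>)) (at \<xi>)"
    using Suc.prems by (intro Suc.IH) auto
  have 2: "(forward_diff h n f has_derivative (\<lambda>v. forward_diff h n (\<lambda>\<eta>. frechet_derivative f (at \<eta>) v) (\<xi> + h))) (at (\<xi> + h))"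
  proof (rule Suc.IH)
    fix j assume "j \<le> n"
    then show "f differentiable (at (\<xi> + h + real j *\<^sub>R h))"
      using Suc.prems[of "Suc j"] by (simp add: algebra_simps)
  qed
  have "((\<lambda>\<eta>. forward_diff h n f (\<eta> + h)) has_derivative (\<lambda>v. forward_diff h n (\<lambda>\<eta>. frechet_derivative f (at \<eta>) v) (\<xi> + h))) (at \<xi>)"
    by (rule has_derivative_compose[of "\<lambda>\<eta>. \<eta> + h", OF _ 2]) (auto intro!: derivative_eq_intros)
  with 1 show ?case by (auto intro: has_derivative_diff)
qed

text \<open>Mean value inequality iterated along the ray in direction e: every difference is traded
  for one factor |t| and one derivative, evaluated on the segment of n steps. The induction replaces
  \<open>f\<close> by its derivative in direction e.\<close>

lemma forward_diff_bound:
  assumes "\<And>j s. j < n \<Longrightarrow> 0 \<le> s \<Longrightarrow> s \<le> real n \<Longrightarrow>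
      iter_pderiv (replicate j e) f differentiable (at (\<xi> + (s * t) *\<^sub>R e))"
    and "\<And>s. 0 \<le> s \<Longrightarrow> s \<le> real n \<Longrightarrow> norm (iter_pderiv (replicate n e) f (\<xi> + (s * t) *\<^sub>R e)) \<le> B"
  shows "norm (forward_diff (t *\<^sub>R e) n f \<xi>) \<le> \<bar>t\<bar> ^ n * B"
  using assms
proof (induction n arbitrary: f \<xi>)
  case 0
  from 0(2)[of 0] show ?case by simp
next
  case (Suc n)
  define g where "g = iter_pderiv [e] f"
  have g: "iter_pderiv (replicate j e) g = iter_pderiv (replicate (Suc j) e) f" for j
    unfolding g_def iter_pderiv_append[symmetric] by (simp only: replicate_append_same replicate_Suc)
  \<comment> \<open>Its increment from s = 0 to s = 1 is the difference of order n + 1, and its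
    derivative in s is t times the n-th difference of the partial derivative of f.\<close>
  let ?\<phi> = "\<lambda>s. forward_diff (t *\<^sub>R e) n f (\<xi> + (s * t) *\<^sub>R e)"
  have d: "f differentiable (at (\<xi> + (s * t) *\<^sub>R e))" if "0 \<le> s" "s \<le> real (Suc n)" for s
    using Suc.prems(1)[of 0 s] that by simp
  have hom: "forward_diff h n (\<lambda>\<eta>. frechet_derivative f (at \<eta>) (r *\<^sub>R e)) \<eta> = r *\<^sub>R forward_diff h n (\<lambda>\<eta>. frechet_derivative f (at \<eta>) e) \<eta>"
    if "\<And>j. j \<le> n \<Longrightarrow> f differentiable (at (\<eta> + real j *\<^sub>R h))" for r h n \<eta>
    using that
  proof (induction n arbitrary: \<eta>)
    case 0
    from 0[of 0] show ?case
      using linear_cmul[OF linear_frechet_derivative[of f "at \<eta>"]] by simp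
  next
    case (Suc n)
    have "f differentiable (at (\<eta> + h + real j *\<^sub>R h))" if "j \<le> n" for j
      using Suc.prems[of "Suc j"] that by (simp add: algebra_simps)
    then show ?case using Suc by (simp add: scaleR_diff_right)
  qed
  have B: "norm (forward_diff (t *\<^sub>R e) n g (\<xi> + (s * t) *\<^sub>R e)) \<le> \<bar>t\<bar> ^ n * B" if s: "0 \<le> s" "s \<le> 1" for s
  proof (rule Suc.IH)
    fix j s' assume j: "j < n" "0 \<le> s'" "s' \<le> real n"
    show "iter_pderiv (replicate j e) g differentiable (at (\<xi> + (s * t) *\<^sub>R e + (s' * t) *\<^sub>R e))"
      using Suc.prems(1)[of "Suc j" "s + s'"] j s unfolding g
      by (simp add: scaleR_add_left distrib_right add.assoc)
  next
    fix s' assume "0 \<le> s'" "s' \<le> real n"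
    then show "norm (iter_pderiv (replicate n e) g (\<xi> + (s * t) *\<^sub>R e + (s' * t) *\<^sub>R e)) \<le> B"
      using Suc.prems(2)[of "s + s'"] s unfolding g
      by (simp add: scaleR_add_left distrib_right add.assoc)
  qed
  have "norm (?\<phi> 1 - ?\<phi> 0) \<le> (\<bar>t\<bar> * (\<bar>t\<bar> ^ n * B)) * norm (1 - 0 :: real)"
  proof (rule differentiable_bound[of "{0..1}"])
    fix s :: real assume s: "s \<in> {0..1}"
    let ?c = "t *\<^sub>R forward_diff (t *\<^sub>R e) n g (\<xi> + (s * t) *\<^sub>R e)"
    have dj: "f differentiable (at (\<xi> + (s * t) *\<^sub>R e + real j *\<^sub>R t *\<^sub>R e))" if "j \<le> n" for j
      using d[of "s + real j"] s that by (simp add: scaleR_add_left distrib_right add.assoc)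
    have "(?\<phi> has_derivative (\<lambda>r. forward_diff (t *\<^sub>R e) n (\<lambda>\<eta>. frechet_derivative f (at \<eta>) ((r * t) *\<^sub>R e)) (\<xi> + (s * t) *\<^sub>R e))) (at s)"
      by (rule has_derivative_compose[of "\<lambda>s. \<xi> + (s * t) *\<^sub>R e", OF _ forward_diff_has_derivative[OF dj]])
         (auto intro!: derivative_eq_intros)
    then show "(?\<phi> has_derivative (\<lambda>r. r *\<^sub>R ?c)) (at s within {0..1})"
      using hom[OF dj] by (simp add: has_derivative_at_withinI g_def)
    show "onorm (\<lambda>r. r *\<^sub>R ?c) \<le> \<bar>t\<bar> * (\<bar>t\<bar> ^ n * B)"
    proof (rule onorm_le)
      fix r :: real
      have "\<bar>r\<bar> * \<bar>t\<bar> * norm (forward_diff (t *\<^sub>R e) n g (\<xi> + (s * t) *\<^sub>R e)) \<le> \<bar>r\<bar> * \<bar>t\<bar> * (\<bar>t\<bar> ^ n * B)"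
        using B[of s] s by (intro mult_left_mono) auto
      then show "norm (r *\<^sub>R ?c) \<le> \<bar>t\<bar> * (\<bar>t\<bar> ^ n * B) * norm r" by (simp add: abs_mult mult_ac)
    qed
  qed auto
  then show ?case by simp
qed

text \<open>Thanks to this, powers of |x| are gained from repeated derivatives in a single basis
  direction, and mixed derivatives never have to be transformed.\<close>

lemma exists_large_coordinate:
  fixes x :: "'a::euclidean_space"
  obtains e where "e \<in> Basis" "norm x \<le> real DIM('a) * \<bar>x \<bullet> e\<bar>"
proof -
  have fin: "finite ((\<lambda>b. \<bar>x \<bullet> b\<bar>) ` Basis)" and ne: "(\<lambda>b. \<bar>x \<bullet> b\<bar>) ` Basis \<noteq> {}" by auto
  obtain e where e: "e \<in> Basis" "Max ((\<lambda>b. \<bar>x \<bullet> b\<bar>) ` Basis) = \<bar>x \<bullet> e\<bar>"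
    using Max_in[OF fin ne] unfolding image_iff by blast
  have "norm x \<le> (\<Sum>b\<in>Basis. \<bar>x \<bullet> b\<bar>)" by (rule norm_le_l1)
  also have "\<dots> \<le> (\<Sum>b\<in>(Basis::'a set). \<bar>x \<bullet> e\<bar>)"
    using Max_ge[OF fin] e by (intro sum_mono) auto
  finally have "norm x \<le> real DIM('a) * \<bar>x \<bullet> e\<bar>" by simp
  with e show ?thesis using that by blast
qed

text \<open>The differencing step \<open>h\<close> is chosen so that \<open>exp (- \<i> x\<bullet>h) = -1\<close>: then \<open>\<bar>h\<bar> \<sim> 1 / \<bar>x\<bar>\<close> and the
  transform of the \<open>N\<close>-th difference is \<open>(-2)\<^sup>N\<close> times that of \<open>f\<close>.  No cutoff functions are needed:
  the difference is estimated trivially near the origin and by the mean value theorem elsewhere.\<close>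

theorem ft_kernel_bound:
  fixes a :: real
  assumes a: "0 \<le> a" "a < 1"
  obtains C where "0 \<le> C"
    "\<And>(f :: 'a::euclidean_space \<Rightarrow> complex) A x. integrable lborel f \<Longrightarrow>
      (\<And>\<xi>. \<xi> \<noteq> 0 \<Longrightarrow> norm (f \<xi>) \<le> A * norm \<xi> powr (-a)) \<Longrightarrow>
      (\<And>e j \<xi>. e \<in> Basis \<Longrightarrow> j \<le> DIM('a) \<Longrightarrow> \<xi> \<noteq> 0 \<Longrightarrow> iter_pderiv (replicate j e) f differentiable (at \<xi>)) \<Longrightarrow>
      (\<And>e \<xi>. e \<in> Basis \<Longrightarrow> \<xi> \<noteq> 0 \<Longrightarrow>
        norm (iter_pderiv (replicate (Suc DIM('a)) e) f \<xi>) \<le> A * norm \<xi> powr (- a - real (Suc DIM('a)))) \<Longrightarrow>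
      x \<noteq> 0 \<Longrightarrow> norm (ft f x) \<le> C * A * norm x powr (a - real DIM('a))"
proof -
  define d where "d = real DIM('a)"
  \<comment> \<open>The part of the difference far from the origin is bounded by |\<xi>|^(-a - N),
    which is integrable at infinity since a + N > d.\<close>
  define N where "N = Suc DIM('a)"
  have d1: "1 \<le> d" by (simp add: d_def Suc_le_eq)
  have N0: "0 < real N" by (simp add: N_def)
  have da: "0 < d - a" using a d1 by simp
  have Nd: "real N = d + 1" by (simp add: N_def d_def)
  define I where "I = (\<integral>(x::'a). indicator {x. norm x \<le> 1} x * norm x powr (-a) \<partial>lborel)"
  define J where "J = (\<integral>(x::'a). indicator {x. 1 \<le> norm x} x * norm x powr (-(a + real N)) \<partial>lborel)"
  have IJ: "0 \<le> I" "0 \<le> J" unfolding I_def J_def by (auto intro!: integral_nonneg_AE)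
  \<comment> \<open>First summand: the ball of radius 2 N \<rho> grows by N shifts of length \<rho>,
    hence 3 N, and the N differences cost 2^N. Second summand: outside that ball every point of the
    segment stays at distance at least |\<xi>| / 2 from the origin, which costs 2^(a + N).\<close>
  define C0 where "C0 = 2 ^ N * (3 * real N) powr (d - a) * I
      + 2 powr (a + real N) * (2 * real N) powr (d - a - real N) * J"
  have C0: "0 \<le> C0" using IJ by (auto simp: C0_def)
  define C where "C = C0 * (pi * d) powr (d - a)"
  have "norm (ft f x) \<le> C * A * norm x powr (a - d)"
    if f: "integrable lborel f"
      and fA: "\<And>\<xi>. \<xi> \<noteq> 0 \<Longrightarrow> norm (f \<xi>) \<le> A * norm \<xi> powr (-a)"
      and df: "\<And>e j \<xi>. e \<in> Basis \<Longrightarrow> j \<le> DIM('a) \<Longrightarrow> \<xi> \<noteq> 0 \<Longrightarrow> iter_pderiv (replicate j e) f differentiable (at \<xi>)"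
      and DA: "\<And>e \<xi>. e \<in> Basis \<Longrightarrow> \<xi> \<noteq> 0 \<Longrightarrow> norm (iter_pderiv (replicate N e) f \<xi>) \<le> A * norm \<xi> powr (- a - real N)"
      and x: "x \<noteq> 0"
    for f :: "'a \<Rightarrow> complex" and A x
  proof -
    have [measurable]: "f \<in> borel_measurable borel" using f by auto
    obtain e where e: "e \<in> Basis" "norm x \<le> d * \<bar>x \<bullet> e\<bar>"
      using exists_large_coordinate[of x] unfolding d_def by blast
    have xe: "x \<bullet> e \<noteq> 0" using e x by auto
    have A: "0 \<le> A"
      using order_trans[OF norm_ge_zero fA[of e]] e(1) by (simp add: nonzero_Basis)
    define t where "t = pi / (x \<bullet> e)"
    define \<rho> where "\<rho> = \<bar>t\<bar>"
    have \<rho>: "0 < \<rho>" using xe by (simp add: \<rho>_def t_def)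
    have \<rho>le: "\<rho> \<le> pi * d / norm x"
    proof -
      have "\<rho> = pi / \<bar>x \<bullet> e\<bar>" by (simp add: \<rho>_def t_def)
      also have "\<dots> \<le> pi * d / norm x" using e(2) xe x by (simp add: field_simps)
      finally show ?thesis .
    qed
    let ?h = "t *\<^sub>R e"
    have nh: "norm ?h = \<rho>" using e(1) by (simp add: \<rho>_def)
    let ?F = "forward_diff ?h N f"
    have IF: "integrable lborel ?F" by (rule forward_diff_integrable[OF f])
    have "exp (- \<i> * complex_of_real (x \<bullet> ?h)) = -1"
    proof -
      have "x \<bullet> ?h = pi" using xe by (simp add: t_def)
      then show ?thesis by (simp add: exp_minus exp_pi_i')
    qed
    then have "norm (ft ?F x) = 2 ^ N * norm (ft f x)"
      unfolding ft_forward_diff[OF f] by (simp add: norm_mult norm_power)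
    then have "norm (ft f x) \<le> norm (ft ?F x)"
      using mult_right_mono[of 1 "2 ^ N :: real" "norm (ft f x)"] by simp
    also have "\<dots> \<le> (\<integral>\<xi>. norm (?F \<xi>) \<partial>lborel)" by (rule norm_ft_le)
    also have "\<dots> \<le> (\<integral>\<xi>. indicator {\<xi>. norm \<xi> \<le> 2 * real N * \<rho>} \<xi> * norm (?F \<xi>)
      + A * \<rho> ^ N * 2 powr (a + real N) * (indicator {\<xi>. 2 * real N * \<rho> \<le> norm \<xi>} \<xi> * norm \<xi> powr (-(a + real N))) \<partial>lborel)"
      (is "_ \<le> (\<integral>\<xi>. ?P \<xi> + ?K * ?Q \<xi> \<partial>lborel)")
    proof (rule integral_mono)
      show "integrable lborel (\<lambda>\<xi>. norm (?F \<xi>))" using IF by simp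
      have IP: "integrable lborel ?P"
      proof (rule Bochner_Integration.integrable_bound[OF integrable_norm[OF IF]])
        have [measurable]: "?F \<in> borel_measurable borel" using IF by auto
        show "?P \<in> borel_measurable lborel" by measurable
      qed (auto simp: indicator_def)
      have IQ: "integrable lborel ?Q"
        using N0 \<rho> a by (intro integral_norm_powr_outer(1)) (auto simp: Nd d_def)
      show "integrable lborel (\<lambda>\<xi>. ?P \<xi> + ?K * ?Q \<xi>)"
        by (intro Bochner_Integration.integrable_add integrable_mult_right impI IP IQ)
      fix \<xi> :: 'a
      show "norm (?F \<xi>) \<le> ?P \<xi> + ?K * ?Q \<xi>"
      proof (cases "norm \<xi> \<le> 2 * real N * \<rho>")
        case True
        moreover have "0 \<le> ?K * ?Q \<xi>" using A \<rho> by (intro mult_nonneg_nonneg) auto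
        ultimately show ?thesis by simp
      next
        case False
        have far: "norm \<xi> / 2 \<le> norm (\<xi> + (s * t) *\<^sub>R e)" if "0 \<le> s" "s \<le> real N" for s
        proof -
          have "norm \<xi> \<le> norm (\<xi> + (s * t) *\<^sub>R e) + norm ((s * t) *\<^sub>R e)"
            using norm_triangle_ineq4[of "\<xi> + (s * t) *\<^sub>R e" "(s * t) *\<^sub>R e"] by simp
          also have "norm ((s * t) *\<^sub>R e) = s * \<rho>" using e(1) that by (simp add: \<rho>_def abs_mult)
          also have "s * \<rho> \<le> real N * \<rho>" using that \<rho> by (intro mult_right_mono) auto
          finally show ?thesis using False by simp
        qed
        have "0 < norm \<xi>" using False N0 \<rho> by (auto intro: order.strict_trans1[rotated])
        have nz: "\<xi> + (s * t) *\<^sub>R e \<noteq> 0" if "0 \<le> s" "s \<le> real N" for s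
          using far[OF that] \<open>0 < norm \<xi>\<close> by auto
        have "norm (?F \<xi>) \<le> \<bar>t\<bar> ^ N * (A * (norm \<xi> / 2) powr (- a - real N))"
        proof (rule forward_diff_bound)
          fix s assume s: "0 \<le> s" "s \<le> real N"
          have "norm (iter_pderiv (replicate N e) f (\<xi> + (s * t) *\<^sub>R e))
             \<le> A * norm (\<xi> + (s * t) *\<^sub>R e) powr (- a - real N)"
            by (rule DA[OF e(1) nz[OF s]])
          also have "\<dots> \<le> A * (norm \<xi> / 2) powr (- a - real N)"
            using far[OF s] \<open>0 < norm \<xi>\<close> A a N0 by (intro mult_left_mono powr_mono2') auto
          finally show "norm (iter_pderiv (replicate N e) f (\<xi> + (s * t) *\<^sub>R e)) \<le> A * (norm \<xi> / 2) powr (- a - real N)" .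
        qed (use df e(1) nz in \<open>auto simp: N_def\<close>)
        also have "(norm \<xi> / 2) powr (- a - real N) = 2 powr (a + real N) * norm \<xi> powr (-(a + real N))"
        proof -
          have "(norm \<xi> / 2) powr (- a - real N) = norm \<xi> powr (- a - real N) / 2 powr (- a - real N)"
            by (simp add: powr_divide)
          also have "\<dots> = 2 powr (a + real N) * norm \<xi> powr (-(a + real N))"
            using powr_minus_divide[of 2 "a + real N"] by (simp add: algebra_simps)
          finally show ?thesis .
        qed
        finally show ?thesis using False by (simp add: \<rho>_def mult_ac)
      qed
    qed
    also have "\<dots> = (\<integral>\<xi>. ?P \<xi> \<partial>lborel) + ?K * (\<integral>\<xi>. ?Q \<xi> \<partial>lborel)"
    proof -
      have IP: "integrable lborel ?P"
      proof (rule Bochner_Integration.integrable_bound[OF integrable_norm[OF IF]])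
        have [measurable]: "?F \<in> borel_measurable borel" using IF by auto
        show "?P \<in> borel_measurable lborel" by measurable
      qed (auto simp: indicator_def)
      have IQ: "integrable lborel ?Q"
        using N0 \<rho> a by (intro integral_norm_powr_outer(1)) (auto simp: Nd d_def)
      show ?thesis
        by (subst Bochner_Integration.integral_add[OF IP integrable_mult_right[OF IQ]]) simp
    qed
    also have "(\<integral>\<xi>. ?P \<xi> \<partial>lborel) \<le> 2 ^ N * (A * ((3 * real N * \<rho>) powr (d - a) * I))"
    proof -
      have "(\<integral>\<xi>. ?P \<xi> \<partial>lborel) \<le> 2 ^ N * (\<integral>\<xi>. indicator {\<xi>. norm \<xi> \<le> 2 * real N * \<rho> + real N * norm ?h} \<xi> * norm (f \<xi>) \<partial>lborel)"
        by (rule forward_diff_inner_integral[OF f])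
      also have "2 * real N * \<rho> + real N * norm ?h = 3 * real N * \<rho>" unfolding nh by (simp add: algebra_simps)
      also have "(\<integral>\<xi>. indicator {\<xi>. norm \<xi> \<le> 3 * real N * \<rho>} \<xi> * norm (f \<xi>) \<partial>lborel)
        \<le> (\<integral>(\<xi>::'a). A * (indicator {\<xi>. norm \<xi> \<le> 3 * real N * \<rho>} \<xi> * norm \<xi> powr (-a)) \<partial>lborel)"
      proof (rule integral_mono_AE)
        show "integrable lborel (\<lambda>\<xi>. indicator {\<xi>. norm \<xi> \<le> 3 * real N * \<rho>} \<xi> * norm (f \<xi>))"
          by (rule Bochner_Integration.integrable_bound[OF integrable_norm[OF f]]) (measurable, auto simp: indicator_def)
        show "integrable lborel (\<lambda>\<xi>::'a. A * (indicator {\<xi>. norm \<xi> \<le> 3 * real N * \<rho>} \<xi> * norm \<xi> powr (-a)))"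
          using a d1 \<rho> N0 by (intro integrable_mult_right impI integral_norm_powr_inner(1)) (auto simp flip: d_def)
        have "AE \<xi>::'a in lborel. \<xi> \<noteq> 0" by (rule AE_lborel_singleton)
        then show "AE \<xi>::'a in lborel. indicator {\<xi>. norm \<xi> \<le> 3 * real N * \<rho>} \<xi> * norm (f \<xi>)
            \<le> A * (indicator {\<xi>. norm \<xi> \<le> 3 * real N * \<rho>} \<xi> * norm \<xi> powr (-a))"
          by (rule AE_mp, intro AE_I2) (auto simp: indicator_def fA)
      qed
      also have "\<dots> = A * ((3 * real N * \<rho>) powr (d - a) * I)"
        using integral_norm_powr_inner(2)[of a "3 * real N * \<rho>", where 'a='a] a d1 \<rho> N0
        unfolding I_def integral_mult_right_zero by (simp flip: d_def)
      finally show ?thesis by simp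
    qed
    also have "(\<integral>\<xi>. ?Q \<xi> \<partial>lborel) = (2 * real N * \<rho>) powr (d - (a + real N)) * J"
      using integral_norm_powr_outer(2)[of "a + real N" "2 * real N * \<rho>", where 'a='a] a \<rho> N0
      unfolding J_def d_def by (simp add: Nd[unfolded d_def])
    also have "2 ^ N * (A * ((3 * real N * \<rho>) powr (d - a) * I)) + ?K * ((2 * real N * \<rho>) powr (d - (a + real N)) * J)
      = C0 * A * \<rho> powr (d - a)"
    proof -
      have "(3 * real N * \<rho>) powr (d - a) = (3 * real N) powr (d - a) * \<rho> powr (d - a)"
        by (rule powr_mult)
      moreover have "(2 * real N * \<rho>) powr (d - (a + real N)) = (2 * real N) powr (d - a - real N) * \<rho> powr (d - a - real N)"
        using \<rho> N0 powr_mult[of "2 * real N" \<rho> "d - a - real N"] by (simp add: diff_diff_eq)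
      moreover have "\<rho> ^ N * \<rho> powr (d - a - real N) = \<rho> powr (d - a)"
        using \<rho> by (simp add: powr_realpow[symmetric] powr_add[symmetric])
      ultimately show ?thesis unfolding C0_def by (simp add: algebra_simps)
    qed
    also have "C0 * A * \<rho> powr (d - a) \<le> C0 * A * (pi * d / norm x) powr (d - a)"
      using \<rho>le \<rho> da C0 A by (intro mult_left_mono powr_mono2) auto
    also have "(pi * d / norm x) powr (d - a) = (pi * d) powr (d - a) * norm x powr (a - d)"
      using d1 x by (simp add: powr_divide powr_diff powr_minus field_simps)
    finally show ?thesis by (simp add: C_def mult_ac)
  qed
  moreover have "0 \<le> C" using C0 by (simp add: C_def)
  ultimately show ?thesis using that[of C] unfolding N_def d_def by blast
qed

section \<open>Symbol weights\<close>

definition bounded_by :: "'a set \<Rightarrow> 's set \<Rightarrow> (nat \<Rightarrow> 'a \<Rightarrow> real) \<Rightarrow> nat \<Rightarrow> ('s \<Rightarrow> 'a \<Rightarrow> complex) \<Rightarrow> bool" where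
  "bounded_by S T b j f \<longleftrightarrow> (\<exists>C. \<forall>t\<in>T. \<forall>\<xi>\<in>S. norm (f t \<xi>) \<le> C * b j \<xi>)"

lemma bndI: "(\<And>t \<xi>. t \<in> T \<Longrightarrow> \<xi> \<in> S \<Longrightarrow> norm (f t \<xi>) \<le> C * b j \<xi>) \<Longrightarrow> bounded_by S T b j f"
  unfolding bounded_by_def by blast

lemma bndE_nonneg:
  assumes "bounded_by S T b j f" "\<And>\<xi>. \<xi> \<in> S \<Longrightarrow> 0 \<le> b j \<xi>"
  obtains C where "0 \<le> C" "\<And>t \<xi>. t \<in> T \<Longrightarrow> \<xi> \<in> S \<Longrightarrow> norm (f t \<xi>) \<le> C * b j \<xi>"
proof -
  obtain C where C: "\<And>t \<xi>. t \<in> T \<Longrightarrow> \<xi> \<in> S \<Longrightarrow> norm (f t \<xi>) \<le> C * b j \<xi>"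
    using assms(1) unfolding bounded_by_def by blast
  show ?thesis
  proof (rule that[of "\<bar>C\<bar>"])
    fix t \<xi> assume "t \<in> T" "\<xi> \<in> S"
    then have "norm (f t \<xi>) \<le> C * b j \<xi>" by (rule C)
    also have "\<dots> \<le> \<bar>C\<bar> * b j \<xi>" using assms(2)[OF \<open>\<xi> \<in> S\<close>] by (intro mult_right_mono) auto
    finally show "norm (f t \<xi>) \<le> \<bar>C\<bar> * b j \<xi>" .
  qed auto
qed

lemma bounded_by_local: "local_family S T (bounded_by S T b)"
  unfolding local_family_def families_eq_on_def bounded_by_def by metis

lemma bounded_by_add: "add_closed (bounded_by S T b)"
  unfolding add_closed_def
proof (intro allI impI)
  fix j f g assume "bounded_by S T b j f" "bounded_by S T b j g"
  then obtain C D where C: "\<forall>t\<in>T. \<forall>\<xi>\<in>S. norm (f t \<xi>) \<le> C * b j \<xi>" "\<forall>t\<in>T. \<forall>\<xi>\<in>S. norm (g t \<xi>) \<le> D * b j \<xi>"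
    unfolding bounded_by_def by blast
  show "bounded_by S T b j (\<lambda>t \<xi>. f t \<xi> + g t \<xi>)"
  proof (rule bndI)
    fix t \<xi> assume "t \<in> T" "\<xi> \<in> S"
    then show "norm (f t \<xi> + g t \<xi>) \<le> (C + D) * b j \<xi>"
      using C norm_triangle_ineq[of "f t \<xi>" "g t \<xi>"] by (fastforce simp: distrib_right)
  qed
qed

lemma bounded_by_Suc: "bounded_by S T b (Suc j) = bounded_by S T (\<lambda>j. b (Suc j)) j"
  by (simp add: bounded_by_def fun_eq_iff)

lemma bounded_by_mult:
  assumes "bounded_by S T b i f" "bounded_by S T b' j g"
    and b: "\<And>\<xi>. \<xi> \<in> S \<Longrightarrow> 0 \<le> b i \<xi>" "\<And>\<xi>. \<xi> \<in> S \<Longrightarrow> 0 \<le> b' j \<xi>"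
    and c: "\<And>\<xi>. \<xi> \<in> S \<Longrightarrow> b i \<xi> * b' j \<xi> \<le> K * c l \<xi>"
  shows "bounded_by S T c l (\<lambda>t \<xi>. f t \<xi> * g t \<xi>)"
proof -
  obtain C where C: "0 \<le> C" "\<And>t \<xi>. t \<in> T \<Longrightarrow> \<xi> \<in> S \<Longrightarrow> norm (f t \<xi>) \<le> C * b i \<xi>"
    using bndE_nonneg[OF assms(1) b(1)] by blast
  obtain D where D: "0 \<le> D" "\<And>t \<xi>. t \<in> T \<Longrightarrow> \<xi> \<in> S \<Longrightarrow> norm (g t \<xi>) \<le> D * b' j \<xi>"
    using bndE_nonneg[OF assms(2) b(2)] by blast
  show ?thesis
  proof (rule bndI)
    fix t \<xi> assume t: "t \<in> T" "\<xi> \<in> S"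
    have "norm (f t \<xi> * g t \<xi>) \<le> (C * b i \<xi>) * (D * b' j \<xi>)"
      unfolding norm_mult using C D t b by (intro mult_mono) auto
    also have "\<dots> = (C * D) * (b i \<xi> * b' j \<xi>)" by simp
    also have "\<dots> \<le> (C * D) * (K * c l \<xi>)" using C D c[OF t(2)] by (intro mult_left_mono) auto
    finally show "norm (f t \<xi> * g t \<xi>) \<le> (C * D * K) * c l \<xi>" by simp
  qed
qed

lemma symbol_class_bounded_by_mult:
  assumes "open S" "symbol_class S T n (bounded_by S T b) f" "symbol_class S T n (bounded_by S T b') g"
    and "\<And>j \<xi>. \<xi> \<in> S \<Longrightarrow> 0 \<le> b j \<xi>" "\<And>j \<xi>. \<xi> \<in> S \<Longrightarrow> 0 \<le> b' j \<xi>"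
    and "\<And>i j \<xi>. \<xi> \<in> S \<Longrightarrow> b i \<xi> * b' j \<xi> \<le> K * c (i + j) \<xi>"
  shows "symbol_class S T n (bounded_by S T c) (\<lambda>t \<xi>. f t \<xi> * g t \<xi>)"
  by (rule symbol_class_mult[OF assms(1) bounded_by_local bounded_by_add _ assms(2,3)], rule bounded_by_mult[where K=K]) (use assms in auto)

lemma symbol_class_subset: "symbol_class S T n Q f \<Longrightarrow> S' \<subseteq> S \<Longrightarrow> T' \<subseteq> T \<Longrightarrow> symbol_class S' T' n Q f"
proof (induction n arbitrary: Q f)
  case (Suc n)
  show ?case unfolding symbol_class.simps
    using Suc.prems(1) Suc.IH[OF _ Suc.prems(2,3)] subsetD[OF Suc.prems(2)] subsetD[OF Suc.prems(3)]
    unfolding symbol_class.simps by blast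
qed simp

lemma symbol_class_bounded_by_subset:
  assumes "symbol_class S T n (bounded_by S T b) f" "S' \<subseteq> S" "T' \<subseteq> T"
  shows "symbol_class S' T' n (bounded_by S' T' b) f"
  by (rule symbol_class_mono[OF _ symbol_class_subset[OF assms]]) (use assms(2,3) in \<open>unfold bounded_by_def, blast\<close>)

lemma symbol_class_bounded_by_weaken:
  assumes "symbol_class S T n (bounded_by S T b) f" "\<And>j \<xi>. \<xi> \<in> S \<Longrightarrow> 0 \<le> b j \<xi>"
    "\<And>j \<xi>. j \<le> n \<Longrightarrow> \<xi> \<in> S \<Longrightarrow> b j \<xi> \<le> K j * c j \<xi>"
  shows "symbol_class S T n (bounded_by S T c) f"
proof (rule symbol_class_mono[OF _ assms(1)])
  fix j g assume j: "j \<le> n" and "bounded_by S T b j g"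
  then obtain C where C: "0 \<le> C" "\<And>t \<xi>. t \<in> T \<Longrightarrow> \<xi> \<in> S \<Longrightarrow> norm (g t \<xi>) \<le> C * b j \<xi>"
    using bndE_nonneg assms(2) by metis
  show "bounded_by S T c j g"
  proof (rule bndI)
    fix t \<xi> assume t: "t \<in> T" "\<xi> \<in> S"
    have "norm (g t \<xi>) \<le> C * b j \<xi>" by (rule C(2)[OF t])
    also have "\<dots> \<le> C * (K j * c j \<xi>)" using C(1) assms(3)[OF j t(2)] by (rule mult_left_mono[rotated])
    finally show "norm (g t \<xi>) \<le> (C * K j) * c j \<xi>" by simp
  qed
qed

section \<open>Elementary symbols: constants, linear functions, powers of the norm\<close>

lemma partial_family_const: "partial_family v (\<lambda>t \<xi>. c t) = (\<lambda>t \<xi>. 0)"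
  by (simp add: partial_family_def fun_eq_iff)

lemma symbol_class_zero:
  assumes "\<And>j. Q j (\<lambda>t \<xi>. 0)"
  shows "symbol_class S T n Q (\<lambda>t \<xi>. 0)"
  using assms by (induction n arbitrary: Q) (auto simp: partial_family_const)

lemma symbol_class_const:
  assumes "Q 0 (\<lambda>t \<xi>. c t)" "\<And>j. Q j (\<lambda>t \<xi>. 0)"
  shows "symbol_class S T n Q (\<lambda>t \<xi>. c t)"
  using assms by (cases n) (auto simp: partial_family_const intro!: symbol_class_zero)

lemma partial_family_linear: "partial_family w (\<lambda>t \<xi>. c t * complex_of_real (\<xi> \<bullet> v)) = (\<lambda>t \<xi>. c t * complex_of_real (w \<bullet> v))"
  and differentiable_linear: "(\<lambda>\<xi>. k * complex_of_real (\<xi> \<bullet> v)) differentiable (at \<xi>)"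
proof -
  have *: "((\<lambda>\<xi>. k * complex_of_real (\<xi> \<bullet> v)) has_derivative (\<lambda>h. k * complex_of_real (h \<bullet> v))) (at \<xi>)" for k \<xi>
    by (auto intro!: derivative_eq_intros)
  show "partial_family w (\<lambda>t \<xi>. c t * complex_of_real (\<xi> \<bullet> v)) = (\<lambda>t \<xi>. c t * complex_of_real (w \<bullet> v))"
    unfolding partial_family_def fun_eq_iff using frechet_derivative_at[OF *] by metis
  show "(\<lambda>\<xi>. k * complex_of_real (\<xi> \<bullet> v)) differentiable (at \<xi>)" using * by (auto simp: differentiable_def)
qed

lemma symbol_class_linear:
  assumes "Q 0 (\<lambda>t \<xi>. c t * complex_of_real (\<xi> \<bullet> v))"
    "\<And>w. w \<in> Basis \<Longrightarrow> Q 1 (\<lambda>t \<xi>. c t * complex_of_real (w \<bullet> v))" "\<And>j. Q j (\<lambda>t \<xi>. 0)"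
  shows "symbol_class S T n Q (\<lambda>t \<xi>. c t * complex_of_real (\<xi> \<bullet> v))"
proof (cases n)
  case (Suc k)
  show ?thesis unfolding Suc symbol_class.simps partial_family_linear
    using assms differentiable_linear by (intro conjI ballI symbol_class_const) simp_all
qed (use assms in simp)

text \<open>Every derivative costs one power of |\<xi>|, at the origin as well as at infinity, as
  for homogeneous functions of degree \<open>\<mu>\<close>. The factor \<open>w\<close> records
  extra decay or flatness that differentiation leaves intact.\<close>

definition power_weight :: "('a::euclidean_space \<Rightarrow> real) \<Rightarrow> real \<Rightarrow> nat \<Rightarrow> 'a \<Rightarrow> real" where
  "power_weight w \<mu> j \<xi> = w \<xi> * norm \<xi> powr (\<mu> - real j)"

lemma power_weight_Suc: "power_weight w \<mu> (Suc j) = power_weight w (\<mu> - 1) j"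
  by (simp add: power_weight_def fun_eq_iff algebra_simps)

abbreviation punctured :: "'a::euclidean_space set" where "punctured \<equiv> - {0}"

lemma bounded_by_power_weight_Suc: "(\<lambda>j. bounded_by S T (power_weight w \<mu>) (Suc j)) = bounded_by S T (power_weight w (\<mu> - 1))"
  by (simp add: fun_eq_iff bounded_by_def power_weight_Suc)

lemma power_weight_mult: "\<xi> \<noteq> 0 \<Longrightarrow> power_weight w \<mu> i \<xi> * power_weight w' \<nu> j \<xi> = power_weight (\<lambda>\<xi>. w \<xi> * w' \<xi>) (\<mu> + \<nu>) (i + j) \<xi>"
proof -
  assume "\<xi> \<noteq> 0"
  have "norm \<xi> powr (\<mu> - real i) * norm \<xi> powr (\<nu> - real j) = norm \<xi> powr (\<mu> + \<nu> - real (i + j))"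
    unfolding powr_add[symmetric] by (simp add: algebra_simps)
  then show ?thesis by (simp add: power_weight_def mult_ac)
qed

lemma symbol_class_power_weight_mult:
  assumes "symbol_class punctured T n (bounded_by punctured T (power_weight w \<mu>)) f" "symbol_class punctured T n (bounded_by punctured T (power_weight w' \<nu>)) g"
    "\<And>\<xi>. 0 \<le> w \<xi>" "\<And>\<xi>. 0 \<le> w' \<xi>"
  shows "symbol_class punctured T n (bounded_by punctured T (power_weight (\<lambda>\<xi>. w \<xi> * w' \<xi>) (\<mu> + \<nu>))) (\<lambda>t \<xi>. f t \<xi> * g t \<xi>)"
  by (rule symbol_class_bounded_by_mult[OF _ assms(1,2), where K=1]) (auto simp: assms power_weight_mult, auto simp: power_weight_def assms)

lemma symbol_class_power_weight_const:
  "symbol_class punctured T n (bounded_by punctured T (power_weight (\<lambda>_. 1) 0)) (\<lambda>t \<xi>. c)"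
proof (rule symbol_class_const)
  show "bounded_by punctured T (power_weight (\<lambda>_. 1) 0) 0 (\<lambda>t \<xi>. c)" by (rule bndI[where C="norm c"]) (auto simp: power_weight_def)
qed (auto simp: bounded_by_def power_weight_def intro!: exI[of _ 0])

lemma symbol_class_power_weight_linear:
  "symbol_class punctured T n (bounded_by punctured T (power_weight (\<lambda>_. 1) 1)) (\<lambda>t \<xi>. complex_of_real (\<xi> \<bullet> v))"
proof -
  have "symbol_class punctured T n (bounded_by punctured T (power_weight (\<lambda>_. 1) 1)) (\<lambda>t \<xi>. (\<lambda>_. 1) t * complex_of_real (\<xi> \<bullet> v))"
  proof (rule symbol_class_linear)
    show "bounded_by punctured T (power_weight (\<lambda>_. 1) 1) 0 (\<lambda>t \<xi>. 1 * complex_of_real (\<xi> \<bullet> v))"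
      by (rule bndI[where C="norm v"]) (auto simp: power_weight_def Cauchy_Schwarz_ineq2 mult.commute)
    show "bounded_by punctured T (power_weight (\<lambda>_. 1) 1) 1 (\<lambda>t \<xi>. 1 * complex_of_real (w \<bullet> v))" for w
      by (rule bndI[where C="\<bar>w \<bullet> v\<bar>"]) (auto simp: power_weight_def)
  qed (auto simp: bounded_by_def power_weight_def intro!: exI[of _ 0])
  then show ?thesis by simp
qed

lemma symbol_class_power_weight_normsq:
  "symbol_class (punctured :: 'a::euclidean_space set) T n (bounded_by punctured T (power_weight (\<lambda>_. 1) 2)) (\<lambda>t \<xi>. complex_of_real (\<xi> \<bullet> \<xi>))"
proof -
  have "symbol_class (punctured :: 'a set) T n (bounded_by punctured T (power_weight (\<lambda>_. 1) 2)) (\<lambda>t \<xi>. \<Sum>b\<in>Basis. complex_of_real (\<xi> \<bullet> b) * complex_of_real (\<xi> \<bullet> b))"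
  proof (rule symbol_class_sum[OF _ bounded_by_local bounded_by_add])
    fix b :: 'a
    show "symbol_class (punctured :: 'a set) T n (bounded_by punctured T (power_weight (\<lambda>_. 1) 2)) (\<lambda>t \<xi>. complex_of_real (\<xi> \<bullet> b) * complex_of_real (\<xi> \<bullet> b))"
      using symbol_class_power_weight_mult[OF symbol_class_power_weight_linear symbol_class_power_weight_linear, of T n b b] by simp
  qed (auto intro!: symbol_class_zero simp: bounded_by_def power_weight_def intro!: exI[of _ 0])
  then show ?thesis by (subst euclidean_inner) simp
qed

lemma symbol_class_power_weight_inverse_normsq:
  "symbol_class punctured T n (bounded_by punctured T (power_weight (\<lambda>_. 1) (-2))) (\<lambda>t \<xi>. inverse (complex_of_real (\<xi> \<bullet> \<xi>)))"
proof (rule symbol_class_inverse[OF _ bounded_by_local bounded_by_add bounded_by_local bounded_by_add _ _ _ _ symbol_class_power_weight_normsq])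
  let ?V = "\<lambda>\<mu>. bounded_by punctured T (power_weight (\<lambda>_. 1) \<mu>)"
  show "?V (-4) (i + j) (\<lambda>t \<xi>. f t \<xi> * g t \<xi>)" if "?V (-2) i f" "?V (-2) j g" for i j f g
    by (rule bounded_by_mult[OF that, where K=1]) (auto simp: power_weight_mult, auto simp: power_weight_def)
  show "?V (-2) (Suc (i + j)) (\<lambda>t \<xi>. - (f t \<xi> * g t \<xi>))" if "?V (-4) i f" "?V 2 (Suc j) g" for i j f g
  proof -
    have "?V (-2) (Suc (i + j)) (\<lambda>t \<xi>. f t \<xi> * g t \<xi>)"
      by (rule bounded_by_mult[OF that, where K=1]) (auto simp: power_weight_mult, auto simp: power_weight_def)
    then show ?thesis by (simp add: bounded_by_def)
  qed
  show "?V (-2) 0 (\<lambda>t \<xi>. inverse (complex_of_real (\<xi> \<bullet> \<xi>)))"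
    by (rule bndI[where C=1])
       (auto simp: power_weight_def norm_inverse powr_minus powr_realpow simp flip: power2_norm_eq_inner of_real_power powr_numeral)
qed auto

lemma symbol_class_power_weight_logderiv:
  "symbol_class punctured T n (bounded_by punctured T (power_weight (\<lambda>_. 1) (-1))) (\<lambda>t \<xi>. complex_of_real (\<xi> \<bullet> v) * inverse (complex_of_real (\<xi> \<bullet> \<xi>)))"
  using symbol_class_power_weight_mult[OF symbol_class_power_weight_linear symbol_class_power_weight_inverse_normsq, of T n v] by simp

text \<open>The derivative hypothesis says that y behaves like a radial function of degree c. Then
  differentiating exp(-y) y^k gives a combination of exp(-y) y^k and exp(-y) y^(k+1), times the
  symbol (\<xi> \<bullet> v) / |\<xi>|^2 of degree -1; the family over all k is closed under
  differentiation, which is why k is generalised in the induction. Degree 2 covers the Gaussian,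
  degree -2 the cutoff that is flat at the origin.\<close>

lemma symbol_class_exp_family:
  fixes y :: "'s \<Rightarrow> 'a::euclidean_space \<Rightarrow> real"
  assumes y: "\<And>t \<xi>. t \<in> T \<Longrightarrow> \<xi> \<noteq> 0 \<Longrightarrow>
      (y t has_derivative (\<lambda>v. c * y t \<xi> * (\<xi> \<bullet> v) / (\<xi> \<bullet> \<xi>))) (at \<xi>)"
    and pos: "\<And>t \<xi>. 0 \<le> y t \<xi>" and w: "\<And>\<xi>. 0 \<le> w \<xi>"
    and bd: "\<And>k. \<exists>C. \<forall>t\<in>T. \<forall>\<xi>. \<xi> \<noteq> 0 \<longrightarrow> exp (- y t \<xi>) * y t \<xi> ^ k \<le> C * w \<xi>"
  shows "symbol_class punctured T n (bounded_by punctured T (power_weight w 0)) (\<lambda>t \<xi>. complex_of_real (exp (- y t \<xi>) * y t \<xi> ^ k))"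
proof (induction n arbitrary: k)
  let ?f = "\<lambda>k t \<xi>. complex_of_real (exp (- y t \<xi>) * y t \<xi> ^ k)"
  have base: "bounded_by punctured T (power_weight w 0) 0 (?f k)" for k
  proof -
    obtain C where "\<forall>t\<in>T. \<forall>\<xi>. \<xi> \<noteq> 0 \<longrightarrow> exp (- y t \<xi>) * y t \<xi> ^ k \<le> C * w \<xi>" using bd by blast
    then show ?thesis by (intro bndI[where C=C]) (auto simp: power_weight_def pos norm_mult norm_power)
  qed
  {
    case 0
    then show ?case using base by simp
  next
    case (Suc n)
    have D: "(?f k t has_derivative (\<lambda>v. complex_of_real
        ((real k * (exp (- y t \<xi>) * y t \<xi> ^ k) - exp (- y t \<xi>) * y t \<xi> ^ Suc k) * (c * (\<xi> \<bullet> v) / (\<xi> \<bullet> \<xi>))))) (at \<xi>)"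
      if "t \<in> T" "\<xi> \<noteq> 0" for t \<xi>
    proof -
      have "((\<lambda>\<xi>. exp (- y t \<xi>) * y t \<xi> ^ k) has_derivative
        (\<lambda>v. exp (- y t \<xi>) * (of_nat k * (c * y t \<xi> * (\<xi> \<bullet> v) / (\<xi> \<bullet> \<xi>)) * y t \<xi> ^ (k - 1)) +
          exp (- y t \<xi>) * (- (c * y t \<xi> * (\<xi> \<bullet> v) / (\<xi> \<bullet> \<xi>))) * y t \<xi> ^ k)) (at \<xi>)"
        using y[OF that] by (auto intro!: derivative_eq_intros)
      moreover have "exp (- y t \<xi>) * (of_nat k * (c * y t \<xi> * (\<xi> \<bullet> v) / (\<xi> \<bullet> \<xi>)) * y t \<xi> ^ (k - 1)) +
          exp (- y t \<xi>) * (- (c * y t \<xi> * (\<xi> \<bullet> v) / (\<xi> \<bullet> \<xi>))) * y t \<xi> ^ k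
        = (real k * (exp (- y t \<xi>) * y t \<xi> ^ k) - exp (- y t \<xi>) * y t \<xi> ^ Suc k) * (c * (\<xi> \<bullet> v) / (\<xi> \<bullet> \<xi>))" for v
        by (cases k) (simp_all add: algebra_simps add_divide_distrib diff_divide_distrib)
      ultimately have "((\<lambda>\<xi>. exp (- y t \<xi>) * y t \<xi> ^ k) has_derivative
        (\<lambda>v. (real k * (exp (- y t \<xi>) * y t \<xi> ^ k) - exp (- y t \<xi>) * y t \<xi> ^ Suc k) * (c * (\<xi> \<bullet> v) / (\<xi> \<bullet> \<xi>)))) (at \<xi>)"
        by (simp only:)
      then show ?thesis by (rule has_derivative_of_real)
    qed
    have "symbol_class punctured T n (\<lambda>j. bounded_by punctured T (power_weight w 0) (Suc j)) (partial_family v (?f k))" for v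
      unfolding bounded_by_power_weight_Suc
    proof (rule symbol_class_cong[OF _ bounded_by_local])
      let ?g = "\<lambda>t \<xi>. (complex_of_real (real k * c) * ?f k t \<xi> + complex_of_real (- c) * ?f (Suc k) t \<xi>)"
      have "symbol_class punctured T n (bounded_by punctured T (power_weight w 0)) ?g"
        using symbol_class_power_weight_mult[OF symbol_class_power_weight_const[of T n "complex_of_real (real k * c)"] Suc[of k]]
          symbol_class_power_weight_mult[OF symbol_class_power_weight_const[of T n "complex_of_real (- c)"] Suc[of "Suc k"]] w
        by (intro symbol_class_add[OF _ bounded_by_local bounded_by_add]) auto
      from symbol_class_power_weight_mult[OF this symbol_class_power_weight_logderiv[of T n v]]
      show "symbol_class punctured T n (bounded_by punctured T (power_weight w (0 - 1))) (\<lambda>t \<xi>. ?g t \<xi> * (complex_of_real (\<xi> \<bullet> v) * inverse (complex_of_real (\<xi> \<bullet> \<xi>))))"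
        using w by simp
      show "families_eq_on punctured T (\<lambda>t \<xi>. ?g t \<xi> * (complex_of_real (\<xi> \<bullet> v) * inverse (complex_of_real (\<xi> \<bullet> \<xi>)))) (partial_family v (?f k))"
        unfolding families_eq_on_def partial_family_def
      proof (intro ballI)
        fix t and \<xi> :: 'a assume t: "t \<in> T" and "\<xi> \<in> punctured"
        then have \<xi>: "\<xi> \<noteq> 0" by simp
        have alg: "complex_of_real ((r * A - B) * (c * x / q))
          = (complex_of_real (r * c) * complex_of_real A + complex_of_real (- c) * complex_of_real B) * (complex_of_real x * inverse (complex_of_real q))"
          for r A B x q :: real
        proof -
          have "(r * A - B) * (c * x / q) = (r * c * A + (- c) * B) * (x * inverse q)"
            by (simp add: divide_inverse algebra_simps)
          then show ?thesis by (simp only: of_real_mult of_real_add of_real_inverse)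
        qed
        show "?g t \<xi> * (complex_of_real (\<xi> \<bullet> v) * inverse (complex_of_real (\<xi> \<bullet> \<xi>))) = frechet_derivative (?f k t) (at \<xi>) v"
          unfolding fun_cong[OF frechet_derivative_at[OF D[OF t \<xi>]], symmetric] alg ..
      qed
    qed auto
    moreover have "?f k t differentiable (at \<xi>)" if "t \<in> T" "\<xi> \<noteq> 0" for t \<xi>
      using D[OF that] by (auto simp: differentiable_def)
    ultimately show ?case using base by auto
  }
qed

lemma exp_minus_power_le: "0 \<le> y \<Longrightarrow> exp (- y) * y ^ k \<le> fact k" for y :: real
proof -
  assume y: "0 \<le> y"
  have S: "(\<lambda>i. y ^ i /\<^sub>R fact i) sums exp y" by (rule exp_converges)
  have "y ^ k /\<^sub>R fact k = (\<Sum>i\<in>{k}. y ^ i /\<^sub>R fact i)" by simp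
  also have "\<dots> \<le> (\<Sum>i. y ^ i /\<^sub>R fact i)"
    using y by (intro sum_le_suminf sums_summable[OF S]) auto
  also have "\<dots> = exp y" using S by (rule sums_unique[symmetric])
  finally show ?thesis by (simp add: exp_minus field_simps)
qed

text \<open>Trades L spare powers for decay in y: large y means large |\<xi>| for the Gaussian and
  small |\<xi>| for the flat cutoff, so the same inequality yields decay at infinity and vanishing
  at the origin.\<close>

lemma exp_minus_power_le': "0 < y \<Longrightarrow> exp (- y) * y ^ k \<le> fact (k + L) * inverse (y ^ L)" for y :: real
  using exp_minus_power_le[of y "k + L"] by (simp add: power_add field_simps)

section \<open>Cutoff functions and homogeneous functions\<close>

definition gauss_cutoff :: "real \<Rightarrow> 'a::euclidean_space \<Rightarrow> complex" where
  "gauss_cutoff s \<xi> = complex_of_real (exp (- (s\<^sup>2 * (\<xi> \<bullet> \<xi>) / 2)))"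

text \<open>The value at the origin has to be set by hand: division by zero would make it \<open>1\<close>.\<close>

definition flat_cutoff :: "real \<Rightarrow> 'a::euclidean_space \<Rightarrow> complex" where
  "flat_cutoff s \<xi> = (if \<xi> = 0 then 0 else complex_of_real (exp (- (s\<^sup>2 / (\<xi> \<bullet> \<xi>)))))"

lemma norm_gauss_cutoff_le: "norm (gauss_cutoff s \<xi>) \<le> 1" and norm_flat_cutoff_le: "norm (flat_cutoff s \<xi>) \<le> 1"
  by (auto simp: gauss_cutoff_def flat_cutoff_def)

lemma symbol_class_gauss_cutoff_weight:
  fixes w :: "'a::euclidean_space \<Rightarrow> real"
  assumes "\<And>\<xi>. 0 \<le> w \<xi>"
    and "\<And>k. \<exists>C. \<forall>s\<in>T. \<forall>\<xi>. \<xi> \<noteq> 0 \<longrightarrow> exp (- (s\<^sup>2 * (\<xi> \<bullet> \<xi>) / 2)) * (s\<^sup>2 * (\<xi> \<bullet> \<xi>) / 2) ^ k \<le> C * w \<xi>"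
  shows "symbol_class punctured T n (bounded_by punctured T (power_weight w 0)) (gauss_cutoff :: real \<Rightarrow> 'a \<Rightarrow> complex)"
proof -
  have "symbol_class punctured T n (bounded_by punctured T (power_weight w 0))
    (\<lambda>s \<xi>. complex_of_real (exp (- (s\<^sup>2 * (\<xi> \<bullet> \<xi>) / 2)) * (s\<^sup>2 * (\<xi> \<bullet> \<xi>) / 2) ^ 0))"
  proof (rule symbol_class_exp_family[where c=2])
    fix s :: real and \<xi> :: 'a assume "\<xi> \<noteq> 0"
    then show "((\<lambda>\<xi>. s\<^sup>2 * (\<xi> \<bullet> \<xi>) / 2) has_derivative (\<lambda>v. 2 * (s\<^sup>2 * (\<xi> \<bullet> \<xi>) / 2) * (\<xi> \<bullet> v) / (\<xi> \<bullet> \<xi>))) (at \<xi>)"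
      by (auto intro!: derivative_eq_intros simp: inner_commute)
  qed (use assms in auto)
  then show ?thesis by (simp add: gauss_cutoff_def[abs_def])
qed

lemma symbol_class_flat_cutoff_weight:
  fixes w :: "'a::euclidean_space \<Rightarrow> real"
  assumes "\<And>\<xi>. 0 \<le> w \<xi>"
    and "\<And>k. \<exists>C. \<forall>s\<in>T. \<forall>\<xi>. \<xi> \<noteq> 0 \<longrightarrow> exp (- (s\<^sup>2 / (\<xi> \<bullet> \<xi>))) * (s\<^sup>2 / (\<xi> \<bullet> \<xi>)) ^ k \<le> C * w \<xi>"
  shows "symbol_class punctured T n (bounded_by punctured T (power_weight w 0)) (flat_cutoff :: real \<Rightarrow> 'a \<Rightarrow> complex)"
proof (rule symbol_class_cong[OF _ bounded_by_local])
  show "symbol_class punctured T n (bounded_by punctured T (power_weight w 0))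
    (\<lambda>s \<xi>. complex_of_real (exp (- (s\<^sup>2 / (\<xi> \<bullet> \<xi>))) * (s\<^sup>2 / (\<xi> \<bullet> \<xi>)) ^ 0))"
  proof (rule symbol_class_exp_family[where c="-2"])
    fix s :: real and \<xi> :: 'a assume "\<xi> \<noteq> 0"
    then show "((\<lambda>\<xi>. s\<^sup>2 / (\<xi> \<bullet> \<xi>)) has_derivative (\<lambda>v. (-2) * (s\<^sup>2 / (\<xi> \<bullet> \<xi>)) * (\<xi> \<bullet> v) / (\<xi> \<bullet> \<xi>))) (at \<xi>)"
      by (auto intro!: derivative_eq_intros simp: inner_commute fun_eq_iff field_simps power2_eq_square)
  qed (use assms in auto)
  show "families_eq_on punctured T (\<lambda>s \<xi>. complex_of_real (exp (- (s\<^sup>2 / (\<xi> \<bullet> \<xi>))) * (s\<^sup>2 / (\<xi> \<bullet> \<xi>)) ^ 0)) flat_cutoff"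
    by (auto simp: families_eq_on_def flat_cutoff_def)
qed auto

text \<open>Uniform in s because s enters only through y = s^2 |\<xi>|^2 / 2, and exp(-y) y^k is at
  most k! for every y \<ge> 0.\<close>

lemma symbol_class_gauss_cutoff: "symbol_class punctured T n (bounded_by punctured T (power_weight (\<lambda>_. 1) 0)) (gauss_cutoff :: real \<Rightarrow> 'a::euclidean_space \<Rightarrow> complex)"
proof (rule symbol_class_gauss_cutoff_weight)
  fix k
  show "\<exists>C. \<forall>s\<in>T. \<forall>\<xi>::'a. \<xi> \<noteq> 0 \<longrightarrow> exp (- (s\<^sup>2 * (\<xi> \<bullet> \<xi>) / 2)) * (s\<^sup>2 * (\<xi> \<bullet> \<xi>) / 2) ^ k \<le> C * 1"
    by (rule exI[of _ "fact k"]) (use exp_minus_power_le in simp)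
qed auto

lemma symbol_class_flat_cutoff: "symbol_class punctured T n (bounded_by punctured T (power_weight (\<lambda>_. 1) 0)) (flat_cutoff :: real \<Rightarrow> 'a::euclidean_space \<Rightarrow> complex)"
proof (rule symbol_class_flat_cutoff_weight)
  fix k
  show "\<exists>C. \<forall>s\<in>T. \<forall>\<xi>::'a. \<xi> \<noteq> 0 \<longrightarrow> exp (- (s\<^sup>2 / (\<xi> \<bullet> \<xi>))) * (s\<^sup>2 / (\<xi> \<bullet> \<xi>)) ^ k \<le> C * 1"
    by (rule exI[of _ "fact k"]) (use exp_minus_power_le in simp)
qed auto

text \<open>Arbitrary decay is available only for a fixed nonzero s: the constant contains a
  negative power of s^2. It serves for qualitative facts such as integrability and membership in the
  Schwartz space; the flat cutoff is treated likewise at the origin.\<close>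

lemma symbol_class_gauss_cutoff_decay:
  assumes "s \<noteq> 0"
  shows "symbol_class punctured {s} n (bounded_by punctured {s} (power_weight (\<lambda>\<xi>. inverse ((\<xi> \<bullet> \<xi>) ^ L)) 0)) (gauss_cutoff :: real \<Rightarrow> 'a::euclidean_space \<Rightarrow> complex)"
proof (rule symbol_class_gauss_cutoff_weight)
  fix k
  show "\<exists>C. \<forall>s\<in>{s}. \<forall>\<xi>::'a. \<xi> \<noteq> 0 \<longrightarrow> exp (- (s\<^sup>2 * (\<xi> \<bullet> \<xi>) / 2)) * (s\<^sup>2 * (\<xi> \<bullet> \<xi>) / 2) ^ k \<le> C * inverse ((\<xi> \<bullet> \<xi>) ^ L)"
  proof (rule exI[of _ "fact (k + L) * inverse ((s\<^sup>2 / 2) ^ L)"], intro ballI allI impI)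
    fix s' and \<xi> :: 'a assume *: "s' \<in> {s}" "\<xi> \<noteq> 0"
    have "exp (- (s\<^sup>2 / 2 * (\<xi> \<bullet> \<xi>))) * (s\<^sup>2 / 2 * (\<xi> \<bullet> \<xi>)) ^ k \<le> fact (k + L) * inverse ((s\<^sup>2 / 2 * (\<xi> \<bullet> \<xi>)) ^ L)"
      using assms * by (intro exp_minus_power_le') auto
    then show "exp (- (s'\<^sup>2 * (\<xi> \<bullet> \<xi>) / 2)) * (s'\<^sup>2 * (\<xi> \<bullet> \<xi>) / 2) ^ k \<le> fact (k + L) * inverse ((s\<^sup>2 / 2) ^ L) * inverse ((\<xi> \<bullet> \<xi>) ^ L)"
      using * by (simp only: power_mult_distrib inverse_mult_distrib) (simp add: field_simps)
  qed
qed auto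

lemma symbol_class_flat_cutoff_flat:
  assumes "s \<noteq> 0"
  shows "symbol_class punctured {s} n (bounded_by punctured {s} (power_weight (\<lambda>\<xi>. (\<xi> \<bullet> \<xi>) ^ L) 0)) (flat_cutoff :: real \<Rightarrow> 'a::euclidean_space \<Rightarrow> complex)"
proof (rule symbol_class_flat_cutoff_weight)
  fix k
  show "\<exists>C. \<forall>s\<in>{s}. \<forall>\<xi>::'a. \<xi> \<noteq> 0 \<longrightarrow> exp (- (s\<^sup>2 / (\<xi> \<bullet> \<xi>))) * (s\<^sup>2 / (\<xi> \<bullet> \<xi>)) ^ k \<le> C * (\<xi> \<bullet> \<xi>) ^ L"
  proof (rule exI[of _ "fact (k + L) * inverse ((s\<^sup>2) ^ L)"], intro ballI allI impI)
    fix s' and \<xi> :: 'a assume *: "s' \<in> {s}" "\<xi> \<noteq> 0"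
    have "exp (- (s\<^sup>2 / (\<xi> \<bullet> \<xi>))) * (s\<^sup>2 / (\<xi> \<bullet> \<xi>)) ^ k \<le> fact (k + L) * inverse ((s\<^sup>2 / (\<xi> \<bullet> \<xi>)) ^ L)"
      using assms * by (intro exp_minus_power_le') auto
    note that = this
    show "exp (- (s'\<^sup>2 / (\<xi> \<bullet> \<xi>))) * (s'\<^sup>2 / (\<xi> \<bullet> \<xi>)) ^ k \<le> fact (k + L) * inverse ((s\<^sup>2) ^ L) * (\<xi> \<bullet> \<xi>) ^ L"
    proof -
      have "inverse ((s\<^sup>2 / (\<xi> \<bullet> \<xi>)) ^ L) = inverse ((s\<^sup>2) ^ L) * (\<xi> \<bullet> \<xi>) ^ L"
        by (simp add: power_divide) (simp add: divide_inverse)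
      with that show ?thesis using * by (simp only: mult.assoc) simp
    qed
  qed
qed auto

lemma gauss_cutoff_has_derivative:
  "(gauss_cutoff s has_derivative (\<lambda>v. complex_of_real (- (s\<^sup>2)) * complex_of_real (\<xi> \<bullet> v) * gauss_cutoff s \<xi>)) (at \<xi>)"
proof -
  have "((\<lambda>\<xi>. exp (- (s\<^sup>2 * (\<xi> \<bullet> \<xi>) / 2))) has_derivative (\<lambda>v. (- s\<^sup>2) * (\<xi> \<bullet> v) * exp (- (s\<^sup>2 * (\<xi> \<bullet> \<xi>) / 2)))) (at \<xi>)"
    by (auto intro!: derivative_eq_intros simp: inner_commute)
  from has_derivative_of_real[OF this] show ?thesis
    unfolding gauss_cutoff_def[abs_def] by simp
qed

text \<open>Needed near the origin, where the order 0 estimate would allow spurious singularities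
  |\<xi>|^(-j). Each derivative brings the factor -s^2 (\<xi> \<bullet> v), of size at most 1 +
  |\<xi>| as long as |s| \<le> 1; this is the reason for the parameter range.\<close>

lemma symbol_class_gauss_cutoff_smooth:
  "symbol_class UNIV {-1..1} n (bounded_by UNIV {-1..1} (\<lambda>j \<xi>. (1 + norm \<xi>) ^ j)) (gauss_cutoff :: real \<Rightarrow> 'a::euclidean_space \<Rightarrow> complex)"
proof (induction n)
  case 0
  show ?case by (auto intro!: bndI[where C=1] norm_gauss_cutoff_le)
next
  case (Suc n)
  let ?W = "\<lambda>j \<xi>. (1 + norm (\<xi>::'a)) ^ Suc j"
  have "symbol_class UNIV {-1..1} n (\<lambda>j. bounded_by UNIV {-1..1} (\<lambda>j \<xi>. (1 + norm \<xi>) ^ j) (Suc j)) (partial_family v (gauss_cutoff :: real \<Rightarrow> 'a \<Rightarrow> complex))" if v: "v \<in> Basis" for v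
    unfolding bounded_by_Suc
  proof (rule symbol_class_cong[OF _ bounded_by_local])
    have "symbol_class UNIV {-1..1} n (bounded_by UNIV {-1..1} ?W) (\<lambda>s \<xi>. complex_of_real (- (s\<^sup>2)) * complex_of_real (\<xi> \<bullet> v))"
    proof (rule symbol_class_linear)
      show "bounded_by UNIV {-1..1} ?W 0 (\<lambda>s \<xi>. complex_of_real (- s\<^sup>2) * complex_of_real (\<xi> \<bullet> v))"
      proof (rule bndI[where C=1])
        fix s :: real and \<xi> :: 'a assume "s \<in> {-1..1}"
        then have "s\<^sup>2 \<le> 1" by (simp add: abs_square_le_1 abs_le_iff)
        then have "s\<^sup>2 * \<bar>\<xi> \<bullet> v\<bar> \<le> 1 * norm \<xi>"
          using Basis_le_norm[OF v, of \<xi>] by (intro mult_mono) auto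
        then show "norm (complex_of_real (- s\<^sup>2) * complex_of_real (\<xi> \<bullet> v)) \<le> 1 * (1 + norm \<xi>) ^ Suc 0"
          by (simp add: norm_mult norm_power)
      qed
      show "bounded_by UNIV {-1..1} ?W 1 (\<lambda>s \<xi>. complex_of_real (- s\<^sup>2) * complex_of_real (w \<bullet> v))" if "w \<in> Basis" for w
      proof (rule bndI[where C=1])
        fix s :: real and \<xi> :: 'a assume "s \<in> {-1..1}"
        then have "s\<^sup>2 \<le> 1" by (simp add: abs_square_le_1 abs_le_iff)
        then have "s\<^sup>2 * \<bar>w \<bullet> v\<bar> \<le> 1 * 1"
          using v that by (intro mult_mono) (auto simp: inner_Basis)
        moreover have "1 \<le> (1 + norm \<xi>) ^ Suc (Suc 0)" by (rule one_le_power) simp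
        ultimately have "s\<^sup>2 * \<bar>w \<bullet> v\<bar> \<le> (1 + norm \<xi>) ^ Suc (Suc 0)" by linarith
        then show "norm (complex_of_real (- s\<^sup>2) * complex_of_real (w \<bullet> v)) \<le> 1 * (1 + norm \<xi>) ^ Suc 1"
          by (simp add: norm_mult norm_power del: power_Suc)
      qed
    qed (auto simp: bounded_by_def intro!: exI[of _ 0])
    from symbol_class_bounded_by_mult[OF open_UNIV this Suc, of 1 ?W]
    show "symbol_class UNIV {-1..1} n (bounded_by UNIV {-1..1} ?W) (\<lambda>s \<xi>. complex_of_real (- (s\<^sup>2)) * complex_of_real (\<xi> \<bullet> v) * gauss_cutoff s \<xi>)"
      by (simp add: power_add)
    show "families_eq_on UNIV {-1..1} (\<lambda>s \<xi>. complex_of_real (- (s\<^sup>2)) * complex_of_real (\<xi> \<bullet> v) * gauss_cutoff s \<xi>) (partial_family v gauss_cutoff)"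
      unfolding families_eq_on_def partial_family_def
      using fun_cong[OF frechet_derivative_at[OF gauss_cutoff_has_derivative], where x=v] by metis
  qed auto
  moreover have "bounded_by UNIV {-1..1} (\<lambda>j \<xi>. (1 + norm \<xi>) ^ j) 0 (gauss_cutoff :: real \<Rightarrow> 'a \<Rightarrow> complex)"
    by (auto intro!: bndI[where C=1] norm_gauss_cutoff_le)
  moreover have "gauss_cutoff s differentiable (at \<xi>)" for s and \<xi> :: 'a using gauss_cutoff_has_derivative by (auto simp: differentiable_def)
  ultimately show ?case by auto
qed

text \<open>The free scalar k absorbs the factor \<i> (a \<bullet> v) produced by each
  derivative.\<close>

lemma symbol_class_character:
  "symbol_class S (T :: 's set) n (bounded_by S T (\<lambda>_ _. 1)) (\<lambda>t \<xi>. k * exp (\<i> * complex_of_real (a \<bullet> (\<xi> :: 'a::euclidean_space))))"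
proof (induction n arbitrary: k)
  case 0
  show ?case by (auto intro!: bndI[where C="norm k"] simp: norm_mult)
next
  case (Suc n)
  have D: "((\<lambda>\<xi>. k * exp (\<i> * complex_of_real (a \<bullet> \<xi>))) has_derivative
      (\<lambda>v. (k * \<i> * complex_of_real (a \<bullet> v)) * exp (\<i> * complex_of_real (a \<bullet> \<xi>)))) (at \<xi>)" for \<xi>
  proof -
    have 1: "((\<lambda>\<xi>. \<i> * complex_of_real (a \<bullet> \<xi>)) has_derivative (\<lambda>v. \<i> * complex_of_real (a \<bullet> v))) (at \<xi>)"
      by (auto intro!: derivative_eq_intros)
    have 2: "(exp has_derivative (*) (exp (\<i> * complex_of_real (a \<bullet> \<xi>)))) (at (\<i> * complex_of_real (a \<bullet> \<xi>)))"
      using DERIV_exp unfolding has_field_derivative_def .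
    show ?thesis
      using has_derivative_mult_right[OF has_derivative_compose[OF 1 2], of k] by (simp add: mult_ac)
  qed
  have "partial_family v (\<lambda>(t::'s) \<xi>. k * exp (\<i> * complex_of_real (a \<bullet> \<xi>)))
      = (\<lambda>t \<xi>. (k * \<i> * complex_of_real (a \<bullet> v)) * exp (\<i> * complex_of_real (a \<bullet> \<xi>)))" for v
    unfolding partial_family_def fun_eq_iff using fun_cong[OF frechet_derivative_at[OF D], where x=v] by metis
  then have "symbol_class S T n (\<lambda>j. bounded_by S T (\<lambda>_ _. 1) (Suc j)) (partial_family v (\<lambda>t \<xi>. k * exp (\<i> * complex_of_real (a \<bullet> \<xi>))))" for v
    unfolding bounded_by_Suc using Suc by simp
  moreover have "bounded_by S T (\<lambda>_ _. 1) 0 (\<lambda>t \<xi>. k * exp (\<i> * complex_of_real (a \<bullet> \<xi>)))"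
    by (auto intro!: bndI[where C="norm k"] simp: norm_mult)
  ultimately show ?case using D unfolding symbol_class.simps differentiable_def by blast
qed

text \<open>Differentiate \<xi> \<mapsto> f (t \<xi>) in two ways, by the chain rule and through
  homogeneity; uniqueness of the derivative lowers the degree by one.\<close>

lemma homogeneous_frechet_derivative:
  fixes f :: "'a::euclidean_space \<Rightarrow> complex"
  assumes hom: "\<And>t \<xi>. 0 < t \<Longrightarrow> \<xi> \<noteq> 0 \<Longrightarrow> f (t *\<^sub>R \<xi>) = complex_of_real (t powr \<mu>) * f \<xi>"
    and d: "\<And>\<xi>. \<xi> \<noteq> 0 \<Longrightarrow> f differentiable (at \<xi>)" and t: "0 < t" and \<xi>: "\<xi> \<noteq> 0"
  shows "frechet_derivative f (at (t *\<^sub>R \<xi>)) v = complex_of_real (t powr (\<mu> - 1)) * frechet_derivative f (at \<xi>) v"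
proof -
  have 1: "(f has_derivative frechet_derivative f (at \<xi>)) (at \<xi>)"
    and 2: "(f has_derivative frechet_derivative f (at (t *\<^sub>R \<xi>))) (at (t *\<^sub>R \<xi>))"
    using d \<xi> t by (simp_all add: frechet_derivative_works)
  have "((\<lambda>\<xi>. f (t *\<^sub>R \<xi>)) has_derivative (\<lambda>v. frechet_derivative f (at (t *\<^sub>R \<xi>)) (t *\<^sub>R v))) (at \<xi>)"
    by (rule has_derivative_compose[of "\<lambda>\<xi>. t *\<^sub>R \<xi>", OF _ 2]) (auto intro!: derivative_eq_intros)
  moreover have "((\<lambda>\<xi>. f (t *\<^sub>R \<xi>)) has_derivative (\<lambda>v. complex_of_real (t powr \<mu>) * frechet_derivative f (at \<xi>) v)) (at \<xi>)"
  proof (rule has_derivative_transform_within_open)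
    show "((\<lambda>\<xi>. complex_of_real (t powr \<mu>) * f \<xi>) has_derivative (\<lambda>v. complex_of_real (t powr \<mu>) * frechet_derivative f (at \<xi>) v)) (at \<xi>)"
      by (intro has_derivative_mult_right 1)
    show "open (- {0::'a})" "\<xi> \<in> - {0}" using \<xi> by auto
    show "complex_of_real (t powr \<mu>) * f x = f (t *\<^sub>R x)" if "x \<in> - {0}" for x
      using hom[OF t, of x] that by simp
  qed
  ultimately have "frechet_derivative f (at (t *\<^sub>R \<xi>)) (t *\<^sub>R v) = complex_of_real (t powr \<mu>) * frechet_derivative f (at \<xi>) v"
    using has_derivative_unique by metis
  then have "t *\<^sub>R frechet_derivative f (at (t *\<^sub>R \<xi>)) v = complex_of_real (t powr \<mu>) * frechet_derivative f (at \<xi>) v"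
    using linear_cmul[OF has_derivative_linear[OF 2]] by simp
  moreover have "t powr \<mu> = t * t powr (\<mu> - 1)" using t by (simp add: powr_diff)
  ultimately have "t *\<^sub>R frechet_derivative f (at (t *\<^sub>R \<xi>)) v = t *\<^sub>R (complex_of_real (t powr (\<mu> - 1)) * frechet_derivative f (at \<xi>) v)"
    by (simp add: scaleR_conv_of_real)
  then show ?thesis using t by simp
qed

lemma smooth_on_differentiable:
  assumes "smooth_on S f" "open S" "set vs \<subseteq> Basis" "\<xi> \<in> S"
  shows "iter_pderiv vs f differentiable (at \<xi>)"
proof -
  have "iter_pderiv vs f differentiable (at \<xi> within S)"
    using assms unfolding smooth_on_def differentiable_on_def by blast
  then show ?thesis using assms at_within_open by metis
qed

lemma homogeneous_iter_pderiv:
  assumes "smooth_on (UNIV - {0}) f" "pos_homogeneous \<mu> f" "0 < t" "\<xi> \<noteq> 0" "set vs \<subseteq> Basis"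
  shows "iter_pderiv vs f (t *\<^sub>R \<xi>) = complex_of_real (t powr (\<mu> - real (length vs))) * iter_pderiv vs f \<xi>"
  using assms(3-5)
proof (induction vs arbitrary: t \<xi>)
  case Nil
  then show ?case using assms(2) by (simp add: pos_homogeneous_def)
next
  case (Cons v vs)
  have "iter_pderiv (v # vs) f (t *\<^sub>R \<xi>) = complex_of_real (t powr (\<mu> - real (length vs) - 1)) * iter_pderiv (v # vs) f \<xi>"
    unfolding iter_pderiv.simps
  proof (rule homogeneous_frechet_derivative)
    show "iter_pderiv vs f (t *\<^sub>R \<xi>) = complex_of_real (t powr (\<mu> - real (length vs))) * iter_pderiv vs f \<xi>"
      if "0 < t" "\<xi> \<noteq> 0" for t \<xi> using Cons that by simp
    show "iter_pderiv vs f differentiable (at \<xi>)" if "\<xi> \<noteq> 0" for \<xi>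
      using smooth_on_differentiable[OF assms(1) open_delete[OF open_UNIV]] Cons.prems that by simp
  qed (use Cons.prems in auto)
  then show ?case by (simp add: algebra_simps)
qed

text \<open>A continuous derivative is bounded on the compact unit sphere, and homogeneity carries
  that bound along rays.\<close>

lemma homogeneous_bound:
  fixes f :: "'a::euclidean_space \<Rightarrow> complex"
  assumes "smooth_on (UNIV - {0}) f" "pos_homogeneous \<mu> f" "set vs \<subseteq> Basis"
  obtains C where "0 \<le> C" "\<And>\<xi>. \<xi> \<noteq> 0 \<Longrightarrow> norm (iter_pderiv vs f \<xi>) \<le> C * norm \<xi> powr (\<mu> - real (length vs))"
proof -
  have "iter_pderiv vs f differentiable (at \<xi>)" if "\<xi> \<noteq> 0" for \<xi>
    using smooth_on_differentiable[OF assms(1) open_delete[OF open_UNIV] assms(3)] that by simp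
  then have "isCont (iter_pderiv vs f) \<xi>" if "\<xi> \<noteq> 0" for \<xi>
    using that by (intro differentiable_imp_continuous_within) blast
  moreover have "\<xi> \<noteq> 0" if "\<xi> \<in> sphere 0 1" for \<xi> :: 'a using that by auto
  ultimately have "continuous_on (sphere 0 1) (iter_pderiv vs f)"
    by (intro continuous_at_imp_continuous_on ballI) blast
  then have "bounded (iter_pderiv vs f ` sphere 0 1)"
    by (intro compact_imp_bounded compact_continuous_image) auto
  then obtain C where C: "0 < C" "\<And>\<xi>. \<xi> \<in> sphere 0 1 \<Longrightarrow> norm (iter_pderiv vs f \<xi>) \<le> C"
    unfolding bounded_pos by auto
  have "norm (iter_pderiv vs f \<xi>) \<le> C * norm \<xi> powr (\<mu> - real (length vs))" if "\<xi> \<noteq> 0" for \<xi>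
  proof -
    let ?u = "\<xi> /\<^sub>R norm \<xi>"
    have "iter_pderiv vs f (norm \<xi> *\<^sub>R ?u) = complex_of_real (norm \<xi> powr (\<mu> - real (length vs))) * iter_pderiv vs f ?u"
      by (rule homogeneous_iter_pderiv[OF assms(1,2) _ _ assms(3)]) (use that in auto)
    then have "norm (iter_pderiv vs f \<xi>) = norm \<xi> powr (\<mu> - real (length vs)) * norm (iter_pderiv vs f ?u)"
      using that by (simp add: norm_mult)
    also have "\<dots> \<le> norm \<xi> powr (\<mu> - real (length vs)) * C"
      using C(2)[of ?u] that by (intro mult_left_mono) auto
    finally show ?thesis by (simp add: mult.commute)
  qed
  then show ?thesis using that[of C] C(1) by simp
qed

section \<open>Elliptic symbols with a limited singularity at the origin\<close>

text \<open>
  The exponent \<open>min 0 (m - j)\<close> is subadditive in \<open>j\<close>, so the class is stable under products and reciprocals; a factor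
  smooth at the origin costs nothing.
\<close>

definition mixed_weight :: "real \<Rightarrow> real \<Rightarrow> nat \<Rightarrow> 'a::euclidean_space \<Rightarrow> real" where
  "mixed_weight m s j \<xi> = (if norm \<xi> \<le> 1 then norm \<xi> powr min 0 (m - real j) else norm \<xi> powr (s - real j))"

text \<open>In dimension one, integrating by parts across the origin needs the derivatives of order less than \<open>m\<close> to be
  continuous there.\<close>

definition limit_at_0 :: "nat \<Rightarrow> 's set \<Rightarrow> nat \<Rightarrow> ('s \<Rightarrow> 'a::euclidean_space \<Rightarrow> complex) \<Rightarrow> bool" where
  "limit_at_0 k T j f \<longleftrightarrow> (j < k \<longrightarrow> (\<forall>t\<in>T. \<exists>L. (f t \<longlongrightarrow> L) (at 0)))"

definition mixed_class :: "real \<Rightarrow> nat \<Rightarrow> real \<Rightarrow> 's set \<Rightarrow> nat \<Rightarrow> ('s \<Rightarrow> 'a::euclidean_space \<Rightarrow> complex) \<Rightarrow> bool" where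
  "mixed_class m k s T j f \<longleftrightarrow> bounded_by punctured T (mixed_weight m s) j f \<and> limit_at_0 k T j f"

lemma mixed_weight_nonneg [simp]: "0 \<le> mixed_weight m s j \<xi>"
  by (simp add: mixed_weight_def)

lemma mixed_weight_mult:
  assumes "0 \<le> m" "\<xi> \<noteq> 0"
  shows "mixed_weight m s i \<xi> * mixed_weight m s' j \<xi> \<le> mixed_weight m (s + s') (i + j) \<xi>"
proof (cases "norm \<xi> \<le> 1")
  case True
  then show ?thesis using assms
    by (auto simp: mixed_weight_def powr_add[symmetric] intro!: powr_mono')
next
  case False
  then show ?thesis using assms
    by (auto simp: mixed_weight_def powr_add[symmetric] algebra_simps)
qed

lemma mixed_class_local: "local_family (punctured :: 'a::euclidean_space set) (T :: 's set) (mixed_class m k s T)"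
  unfolding local_family_def
proof (intro allI impI)
  fix j and f g :: "'s \<Rightarrow> 'a \<Rightarrow> complex"
  assume f: "mixed_class m k s T j f" and eq: "families_eq_on punctured T f g"
  have "bounded_by punctured T (mixed_weight m s) j g"
    using bounded_by_local[of punctured T "mixed_weight m s"] f eq unfolding local_family_def mixed_class_def by blast
  moreover have "(g t \<longlongrightarrow> L) (at 0)" if "t \<in> T" "(f t \<longlongrightarrow> L) (at 0)" for t L
  proof (rule Lim_transform_eventually[OF that(2)])
    show "\<forall>\<^sub>F x in at 0. f t x = g t x"
      using eq that(1) unfolding families_eq_on_def by (auto simp: eventually_at_filter intro: always_eventually)
  qed
  ultimately show "mixed_class m k s T j g" using f unfolding mixed_class_def limit_at_0_def by blast
qed

lemma mixed_class_add: "add_closed (mixed_class m k s (T :: 's set) :: nat \<Rightarrow> ('s \<Rightarrow> 'a::euclidean_space \<Rightarrow> complex) \<Rightarrow> bool)"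
  unfolding add_closed_def
proof (intro allI impI)
  fix j and f g :: "'s \<Rightarrow> 'a \<Rightarrow> complex"
  assume f: "mixed_class m k s T j f" "mixed_class m k s T j g"
  have "bounded_by punctured T (mixed_weight m s) j (\<lambda>t \<xi>. f t \<xi> + g t \<xi>)"
    using bounded_by_add[of punctured T "mixed_weight m s"] f unfolding add_closed_def mixed_class_def by blast
  then show "mixed_class m k s T j (\<lambda>t \<xi>. f t \<xi> + g t \<xi>)"
    using f unfolding mixed_class_def limit_at_0_def by (blast intro: tendsto_add)
qed

lemma mixed_class_mult:
  assumes "0 \<le> m" "mixed_class m k s T i f" "mixed_class m k s' T j g"
  shows "mixed_class m k (s + s') T (i + j) (\<lambda>t \<xi>. f t \<xi> * g t \<xi>)"
proof -
  have "bounded_by punctured T (mixed_weight m (s + s')) (i + j) (\<lambda>t \<xi>. f t \<xi> * g t \<xi>)"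
    using assms by (intro bounded_by_mult[where K=1 and b="mixed_weight m s" and b'="mixed_weight m s'"]) (auto simp: mixed_class_def intro: mixed_weight_mult)
  moreover have "limit_at_0 k T (i + j) (\<lambda>t \<xi>. f t \<xi> * g t \<xi>)"
    unfolding limit_at_0_def
  proof (intro impI ballI)
    fix t assume "i + j < k" "t \<in> T"
    then obtain L L' where "(f t \<longlongrightarrow> L) (at 0)" "(g t \<longlongrightarrow> L') (at 0)"
      using assms(2,3) unfolding mixed_class_def limit_at_0_def by (meson add_lessD1 le_add2 le_less_trans)
    then show "\<exists>L. ((\<lambda>\<xi>. f t \<xi> * g t \<xi>) \<longlongrightarrow> L) (at 0)" by (blast intro: tendsto_mult)
  qed
  ultimately show ?thesis by (simp add: mixed_class_def)
qed

lemma mixed_class_uminus: "mixed_class m k s T j f \<Longrightarrow> mixed_class m k s T j (\<lambda>t \<xi>. - f t \<xi>)"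
  unfolding mixed_class_def limit_at_0_def bounded_by_def by (simp, blast intro: tendsto_minus)

lemma symbol_class_mixed_class_mult:
  assumes "0 \<le> m" "symbol_class punctured T n (mixed_class m k s T) f" "symbol_class punctured T n (mixed_class m k s' T) g"
  shows "symbol_class punctured T n (mixed_class m k (s + s') T) (\<lambda>t \<xi>. f t \<xi> * g t \<xi>)"
  by (rule symbol_class_mult[OF _ mixed_class_local mixed_class_add mixed_class_mult assms(2,3)]) (use assms(1) in auto)

text \<open>Inside the unit ball the weight is at least 1, its exponent being at most 0, so
  boundedness of the continuous derivatives there is enough, whatever the degree of the
  term.\<close>

lemma mixed_class_iter_pderiv_smooth:
  fixes f :: "'a::euclidean_space \<Rightarrow> complex"
  assumes f: "smooth_on UNIV f" and vs: "set vs \<subseteq> Basis"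
    and far: "\<And>\<xi>. 1 < norm \<xi> \<Longrightarrow> norm (iter_pderiv vs f \<xi>) \<le> C * norm \<xi> powr (s - real (length vs))"
  shows "mixed_class m k s T (length vs) (\<lambda>_. iter_pderiv vs f)"
proof -
  have c: "isCont (iter_pderiv vs f) \<xi>" for \<xi>
    using smooth_on_differentiable[OF f open_UNIV vs] by (intro differentiable_imp_continuous_within) simp
  then have "continuous_on (cball 0 1) (iter_pderiv vs f)"
    by (intro continuous_at_imp_continuous_on ballI)
  then have "bounded (iter_pderiv vs f ` cball 0 1)"
    by (intro compact_imp_bounded compact_continuous_image) auto
  then obtain B where B: "0 < B" "\<And>\<xi>. norm \<xi> \<le> 1 \<Longrightarrow> norm (iter_pderiv vs f \<xi>) \<le> B"
    unfolding bounded_pos by (auto simp: mem_cball dist_norm)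
  have "bounded_by punctured T (mixed_weight m s) (length vs) (\<lambda>_. iter_pderiv vs f)"
  proof (rule bndI[where C="max B C"])
    fix \<xi> :: 'a assume "\<xi> \<in> punctured"
    then have \<xi>: "\<xi> \<noteq> 0" by simp
    show "norm (iter_pderiv vs f \<xi>) \<le> max B C * mixed_weight m s (length vs) \<xi>"
    proof (cases "norm \<xi> \<le> 1")
      case True
      have "1 = norm \<xi> powr 0" using \<xi> by simp
      also have "\<dots> \<le> norm \<xi> powr min 0 (m - real (length vs))" using True by (intro powr_mono') auto
      finally have "B * 1 \<le> max B C * norm \<xi> powr min 0 (m - real (length vs))"
        using B(1) by (intro mult_mono) auto
      then show ?thesis using B(2)[OF True] True by (simp add: mixed_weight_def)
    next
      case False
      have "norm (iter_pderiv vs f \<xi>) \<le> C * norm \<xi> powr (s - real (length vs))" using far False by simp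
      also have "\<dots> \<le> max B C * norm \<xi> powr (s - real (length vs))" by (intro mult_right_mono) auto
      finally show ?thesis using False by (simp add: mixed_weight_def)
    qed
  qed
  moreover have "limit_at_0 k T (length vs) (\<lambda>_. iter_pderiv vs f)"
    unfolding limit_at_0_def using c isContD by blast
  ultimately show ?thesis by (simp add: mixed_class_def)
qed

text \<open>Two earlier estimates are glued along the unit sphere: the smooth one inside, since the
  order 0 bound is singular at the origin, and the order 0 one outside, since the smooth bound grows
  at infinity.\<close>

lemma symbol_class_mixed_class_gauss_cutoff:
  assumes "0 \<le> m"
  shows "symbol_class punctured {-1..1} n (mixed_class m k 0 {-1..1}) (gauss_cutoff :: real \<Rightarrow> 'a::euclidean_space \<Rightarrow> complex)"
proof (rule iter_pderiv_symbol_class)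
  fix vs :: "'a list" assume vs: "set vs \<subseteq> Basis" "length vs \<le> n"
  let ?j = "length vs"
  have "bounded_by UNIV {-1..1} (\<lambda>j \<xi>. (1 + norm \<xi>) ^ j) ?j (\<lambda>s. iter_pderiv vs (gauss_cutoff s :: 'a \<Rightarrow> complex))"
    using symbol_class_iter_pderiv[OF symbol_class_gauss_cutoff_smooth vs] by blast
  then obtain C1 where C1: "0 \<le> C1" "\<And>s \<xi>. s \<in> {-1..1} \<Longrightarrow> norm (iter_pderiv vs (gauss_cutoff s :: 'a \<Rightarrow> complex) \<xi>) \<le> C1 * (1 + norm \<xi>) ^ ?j"
    by (rule bndE_nonneg) auto
  have "bounded_by punctured {-1..1} (power_weight (\<lambda>_. 1) 0) ?j (\<lambda>s. iter_pderiv vs (gauss_cutoff s :: 'a \<Rightarrow> complex))"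
    using symbol_class_iter_pderiv[OF symbol_class_gauss_cutoff vs] by blast
  then obtain C2 where C2: "0 \<le> C2" "\<And>s \<xi>. s \<in> {-1..1} \<Longrightarrow> \<xi> \<in> punctured \<Longrightarrow> norm (iter_pderiv vs (gauss_cutoff s :: 'a \<Rightarrow> complex) \<xi>) \<le> C2 * power_weight (\<lambda>_. 1) 0 ?j \<xi>"
    by (rule bndE_nonneg) (auto simp: power_weight_def)
  have "bounded_by punctured {-1..1} (mixed_weight m 0) ?j (\<lambda>s. iter_pderiv vs (gauss_cutoff s :: 'a \<Rightarrow> complex))"
  proof (rule bndI[where C="max (C1 * 2 ^ ?j) C2"])
    fix s :: real and \<xi> :: 'a assume s: "s \<in> {-1..1}" and "\<xi> \<in> punctured"
    then have \<xi>: "\<xi> \<noteq> 0" by simp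
    show "norm (iter_pderiv vs (gauss_cutoff s) \<xi>) \<le> max (C1 * 2 ^ ?j) C2 * mixed_weight m 0 ?j \<xi>"
    proof (cases "norm \<xi> \<le> 1")
      case True
      have "1 = norm \<xi> powr 0" using \<xi> by simp
      also have "\<dots> \<le> norm \<xi> powr min 0 (m - real ?j)" using True by (intro powr_mono') auto
      finally have 1: "(C1 * 2 ^ ?j) * 1 \<le> max (C1 * 2 ^ ?j) C2 * norm \<xi> powr min 0 (m - real ?j)"
        using C1(1) by (intro mult_mono) (auto simp: le_max_iff_disj)
      have "norm (iter_pderiv vs (gauss_cutoff s) \<xi>) \<le> C1 * (1 + norm \<xi>) ^ ?j" by (rule C1(2)[OF s])
      also have "\<dots> \<le> C1 * 2 ^ ?j" using True C1(1) by (intro mult_left_mono power_mono) auto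
      finally show ?thesis using 1 True by (simp add: mixed_weight_def)
    next
      case False
      have "norm (iter_pderiv vs (gauss_cutoff s) \<xi>) \<le> C2 * norm \<xi> powr (0 - real ?j)"
        using C2(2)[OF s] \<xi> by (simp add: power_weight_def)
      also have "\<dots> \<le> max (C1 * 2 ^ ?j) C2 * norm \<xi> powr (0 - real ?j)" by (intro mult_right_mono) auto
      finally show ?thesis using False by (simp add: mixed_weight_def)
    qed
  qed
  moreover have "limit_at_0 k {-1..1} ?j (\<lambda>s. iter_pderiv vs (gauss_cutoff s :: 'a \<Rightarrow> complex))"
    unfolding limit_at_0_def
  proof (intro impI ballI)
    fix s :: real assume s: "s \<in> {-1..1}"
    have "iter_pderiv vs (gauss_cutoff s :: 'a \<Rightarrow> complex) differentiable (at 0)"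
      using symbol_class_iter_pderiv[OF symbol_class_gauss_cutoff_smooth vs(1), of "Suc n"] vs(2) s by simp
    then show "\<exists>L. (iter_pderiv vs (gauss_cutoff s :: 'a \<Rightarrow> complex) \<longlongrightarrow> L) (at 0)"
      using differentiable_imp_continuous_within isContD by blast
  qed
  ultimately show "mixed_class m k 0 {-1..1} ?j (\<lambda>s. iter_pderiv vs (gauss_cutoff s :: 'a \<Rightarrow> complex))" by (simp add: mixed_class_def)
next
  fix vs :: "'a list" and s :: real and \<xi> :: 'a assume "set vs \<subseteq> Basis" "length vs < n" "s \<in> {-1..1}"
  then show "iter_pderiv vs (gauss_cutoff s) differentiable (at \<xi>)"
    using symbol_class_iter_pderiv[OF symbol_class_gauss_cutoff_smooth, of vs n] by simp
qed

text \<open>\<open>M\<close> enters as an upper bound for all degrees and \<open>m\<close> as a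
  lower bound for the degrees of the terms that are not smooth at the origin; these two facts fix
  the weights at infinity and at the origin.\<close>

locale elliptic_symbol =
  fixes p :: "'a::euclidean_space \<Rightarrow> complex" and p0 :: complex
    and P :: "nat \<Rightarrow> 'a \<Rightarrow> complex" and ms :: "nat \<Rightarrow> real" and h :: nat and m M c0 :: real
  assumes p_eq: "\<And>\<xi>. p \<xi> = p0 + (\<Sum>j=1..h. P j \<xi>)"
    and ms_le: "\<And>j. j \<in> {1..h} \<Longrightarrow> ms j \<le> M"
    and P_smooth: "\<And>j. j \<in> {1..h} \<Longrightarrow> smooth_on (UNIV - {0}) (P j)"
    and P_hom: "\<And>j. j \<in> {1..h} \<Longrightarrow> pos_homogeneous (ms j) (P j)"
    and c0_pos: "0 < c0"
    and elliptic: "\<And>\<xi>. norm (p \<xi>) \<ge> c0 * japanese_bracket \<xi> powr M"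
    and m_pos: "0 < m" and m_le_M: "m \<le> M"
    and m_le: "\<And>j. j \<in> {1..h} \<Longrightarrow> \<not> smooth_on UNIV (P j) \<Longrightarrow> m \<le> ms j"
begin

text \<open>The number of integrations by parts across the singularity; afterwards the symbol is still of order
  \<open>m - k > -1\<close>, hence locally integrable.\<close>

definition k :: nat where "k = nat \<lceil>m\<rceil>"

lemma k_less: "j < k \<Longrightarrow> real j < m" and k_ge: "m \<le> real k" and k_le: "real k < m + 1" and k_pos: "0 < k"
  unfolding k_def using m_pos by linarith+

lemma p_nonzero: "p \<xi> \<noteq> 0"
  using elliptic[of \<xi>] c0_pos by (metis japanese_bracket_pos mult_pos_pos norm_zero not_le powr_gt_zero less_irrefl)

lemma mixed_class_iter_pderiv_P:
  assumes j: "j \<in> {1..h}" and vs: "set vs \<subseteq> Basis"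
  shows "mixed_class m k M T (length vs) (\<lambda>_. iter_pderiv vs (P j))"
proof -
  obtain C where C: "0 \<le> C" "\<And>\<xi>. \<xi> \<noteq> 0 \<Longrightarrow> norm (iter_pderiv vs (P j) \<xi>) \<le> C * norm \<xi> powr (ms j - real (length vs))"
    by (rule homogeneous_bound[OF P_smooth[OF j] P_hom[OF j] vs]) blast
  have far: "norm (iter_pderiv vs (P j) \<xi>) \<le> C * norm \<xi> powr (M - real (length vs))" if "1 < norm \<xi>" for \<xi>
  proof -
    have "norm (iter_pderiv vs (P j) \<xi>) \<le> C * norm \<xi> powr (ms j - real (length vs))" using C(2)[of \<xi>] that by force
    also have "\<dots> \<le> C * norm \<xi> powr (M - real (length vs))"
      using ms_le[OF j] that C(1) by (intro mult_left_mono powr_mono) auto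
    finally show ?thesis .
  qed
  show ?thesis
  proof (cases "smooth_on UNIV (P j)")
    case True
    then show ?thesis using mixed_class_iter_pderiv_smooth vs far by blast
  next
    case False
    note mj = m_le[OF j False]
    have "bounded_by punctured T (mixed_weight m M) (length vs) (\<lambda>_. iter_pderiv vs (P j))"
    proof (rule bndI[where C=C])
      fix \<xi> :: 'a assume "\<xi> \<in> punctured"
      then have \<xi>: "\<xi> \<noteq> 0" by simp
      show "norm (iter_pderiv vs (P j) \<xi>) \<le> C * mixed_weight m M (length vs) \<xi>"
      proof (cases "norm \<xi> \<le> 1")
        case True
        have "norm (iter_pderiv vs (P j) \<xi>) \<le> C * norm \<xi> powr (ms j - real (length vs))" by (rule C(2)[OF \<xi>])
        also have "\<dots> \<le> C * norm \<xi> powr min 0 (m - real (length vs))"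
          using True mj C(1) by (intro mult_left_mono powr_mono') auto
        finally show ?thesis using True by (simp add: mixed_weight_def)
      qed (use far in \<open>simp add: mixed_weight_def\<close>)
    qed
    moreover have "limit_at_0 k T (length vs) (\<lambda>_. iter_pderiv vs (P j))"
      unfolding limit_at_0_def
    proof (intro impI ballI exI)
      assume "length vs < k"
      \<comment> \<open>Derivatives of order below k are homogeneous of positive degree, so they
        tend to 0 at the origin.\<close>
      then have pos: "0 < ms j - real (length vs)" using k_less mj by fastforce
      have "((\<lambda>\<xi>::'a. C * norm \<xi> powr (ms j - real (length vs))) \<longlongrightarrow> C * 0) (at 0)"
        using pos by (intro tendsto_mult tendsto_const tendsto_zero_powrI[OF _ tendsto_const] tendsto_norm_zero tendsto_ident_at) auto
      then have z: "((\<lambda>\<xi>::'a. C * norm \<xi> powr (ms j - real (length vs))) \<longlongrightarrow> 0) (at 0)" by simp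
      show "(iter_pderiv vs (P j) \<longlongrightarrow> 0) (at 0)"
        by (rule Lim_null_comparison[OF _ z]) (use C(2) in \<open>auto simp: eventually_at_filter\<close>)
    qed
    ultimately show ?thesis by (simp add: mixed_class_def)
  qed
qed

lemma symbol_class_p: "symbol_class punctured T n (mixed_class m k M T) (\<lambda>_. p)"
proof (rule symbol_class_cong[OF _ mixed_class_local])
  have z: "mixed_class m k M T j (\<lambda>t \<xi>. 0)" for j
    unfolding mixed_class_def limit_at_0_def by (auto simp: bounded_by_def intro!: exI[of _ 0])
  have 0: "symbol_class punctured T n (mixed_class m k M T) (\<lambda>_ (_::'a). p0)"
  proof (rule symbol_class_const)
    \<comment> \<open>A constant counts as a symbol of order M because M is positive: the
      undifferentiated weight is at least 1 everywhere off the origin, and derivatives of a constant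
      vanish.\<close>
    have "0 < M" using m_pos m_le_M by simp
    then have "1 \<le> mixed_weight m M 0 \<xi>" if "\<xi> \<noteq> 0" for \<xi> :: 'a
      using m_pos that ge_one_powr_ge_zero[of "norm \<xi>" M] by (auto simp: mixed_weight_def)
    then have "bounded_by punctured T (mixed_weight m M) 0 (\<lambda>_ (_::'a). p0)"
      by (intro bndI[where C="norm p0"]) (simp add: mult_le_cancel_left1)
    then show "mixed_class m k M T 0 (\<lambda>_ (_::'a). p0)" unfolding mixed_class_def limit_at_0_def by auto
  qed (rule z)
  have "symbol_class punctured T n (mixed_class m k M T) (\<lambda>_ \<xi>. \<Sum>j=1..h. P j \<xi>)"
  proof (rule symbol_class_sum[OF _ mixed_class_local mixed_class_add symbol_class_zero])
    fix j assume j: "j \<in> {1..h}"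
    show "symbol_class punctured T n (mixed_class m k M T) (\<lambda>_. P j)"
      using mixed_class_iter_pderiv_P[OF j] smooth_on_differentiable[OF P_smooth[OF j] open_delete[OF open_UNIV]]
      by (intro iter_pderiv_symbol_class) auto
  qed (use z in auto)
  then show "symbol_class punctured T n (mixed_class m k M T) (\<lambda>_ \<xi>. p0 + (\<Sum>j=1..h. P j \<xi>))"
    by (intro symbol_class_add[OF _ mixed_class_local mixed_class_add 0]) auto
qed (auto simp: families_eq_on_def p_eq)

lemma inverse_p_bound: "norm (inverse (p \<xi>)) \<le> inverse c0 * japanese_bracket \<xi> powr (- M)"
proof -
  have "inverse (norm (p \<xi>)) \<le> inverse (c0 * japanese_bracket \<xi> powr M)"
    using elliptic[of \<xi>] c0_pos by (intro le_imp_inverse_le) (auto intro!: mult_pos_pos simp: less_imp_neq[OF japanese_bracket_pos, symmetric])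
  then show ?thesis by (simp add: norm_inverse powr_minus)
qed

text \<open>The rule for reciprocals with orders -M for 1/p, -2M for its square and M for
  \<open>p\<close>. Ellipticity provides the undifferentiated bound, and it also provides the limit
  at the origin.\<close>

lemma symbol_class_q: "symbol_class punctured T n (mixed_class m k (- M) T) (\<lambda>_ \<xi>. inverse (p \<xi>))"
proof (rule symbol_class_inverse[OF _ mixed_class_local mixed_class_add mixed_class_local mixed_class_add _ _ _ _ symbol_class_p])
  show "mixed_class m k (- 2 * M) T (i + j) (\<lambda>t \<xi>. f t \<xi> * g t \<xi>)"
    if "mixed_class m k (- M) T i f" "mixed_class m k (- M) T j g" for i j f g
    using mixed_class_mult[OF _ that] m_pos by simp
  show "mixed_class m k (- M) T (Suc (i + j)) (\<lambda>t \<xi>. - (f t \<xi> * g t \<xi>))"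
    if "mixed_class m k (- 2 * M) T i f" "mixed_class m k M T (Suc j) g" for i j f g
    using mixed_class_uminus[OF mixed_class_mult[OF _ that]] m_pos by simp
  show "mixed_class m k (- M) T 0 (\<lambda>t \<xi>. inverse (p \<xi>))"
    unfolding mixed_class_def limit_at_0_def
  proof (intro conjI impI ballI)
    show "bounded_by punctured T (mixed_weight m (- M)) 0 (\<lambda>t \<xi>. inverse (p \<xi>))"
    proof (rule bndI[where C="inverse c0"])
      fix \<xi> :: 'a assume "\<xi> \<in> punctured"
      then have \<xi>: "\<xi> \<noteq> 0" by simp
      have "japanese_bracket \<xi> powr (- M) \<le> mixed_weight m (- M) 0 \<xi>"
      proof (cases "norm \<xi> \<le> 1")
        case True
        then show ?thesis using m_pos m_le_M \<xi> japanese_bracket_ge_1[of \<xi>] powr_mono2'[of "-M" 1 "japanese_bracket \<xi>"]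
          by (simp add: mixed_weight_def)
      next
        case False
        then show ?thesis using m_pos m_le_M \<xi> norm_le_japanese_bracket[of \<xi>] powr_mono2'[of "-M" "norm \<xi>" "japanese_bracket \<xi>"]
          by (simp add: mixed_weight_def)
      qed
      then have "inverse c0 * japanese_bracket \<xi> powr (- M) \<le> inverse c0 * mixed_weight m (- M) 0 \<xi>"
        using c0_pos by (intro mult_left_mono) auto
      then show "norm (inverse (p \<xi>)) \<le> inverse c0 * mixed_weight m (- M) 0 \<xi>"
        using inverse_p_bound[of \<xi>] by linarith
    qed
    fix t assume "t \<in> T"
    then obtain L where L: "(p \<longlongrightarrow> L) (at 0)"
      using symbol_class_base[OF symbol_class_p[of T 0]] k_pos unfolding mixed_class_def limit_at_0_def by blast
    \<comment> \<open>The lower bound passes to the limit L of \<open>p\<close> at the origin, so L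
      is nonzero and 1/p converges there too.\<close>
    have "c0 \<le> norm (p \<xi>)" for \<xi>
    proof -
      have "1 \<le> japanese_bracket \<xi> powr M"
        using japanese_bracket_ge_1[of \<xi>] m_pos m_le_M by (intro ge_one_powr_ge_zero) auto
      then have "c0 * 1 \<le> c0 * japanese_bracket \<xi> powr M" using c0_pos by (intro mult_left_mono) auto
      then show ?thesis using elliptic[of \<xi>] by simp
    qed
    then have "c0 \<le> norm L"
      by (intro tendsto_lowerbound[OF tendsto_norm[OF L]]) (auto simp: trivial_limit_at)
    then have "L \<noteq> 0" using c0_pos by auto
    then show "\<exists>L. ((\<lambda>\<xi>. inverse (p \<xi>)) \<longlongrightarrow> L) (at 0)"
      using tendsto_inverse[OF L] by blast
  qed
qed (auto simp: p_nonzero)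

end

section \<open>Schwartz functions\<close>

lemma symbol_class_bounded_by_reparam:
  assumes "\<sigma> ` T' \<subseteq> T"
  shows "symbol_class S T n (bounded_by S T b) f \<Longrightarrow> symbol_class S T' n (bounded_by S T' b) (\<lambda>t. f (\<sigma> t))"
proof (induction n arbitrary: b f)
  case 0
  then show ?case using assms unfolding bounded_by_def by (auto simp: image_subset_iff)
next
  case (Suc n)
  have "partial_family v (\<lambda>t. f (\<sigma> t)) = (\<lambda>t. partial_family v f (\<sigma> t))" for v
    by (simp add: partial_family_def fun_eq_iff)
  moreover have "bounded_by S T' b 0 (\<lambda>t. f (\<sigma> t))"
    using Suc.prems assms unfolding bounded_by_def by (auto simp: image_subset_iff)
  ultimately show ?case using Suc.prems Suc.IH[of "\<lambda>j. b (Suc j)"] assms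
    by (auto simp: bounded_by_Suc image_subset_iff)
qed

lemma abs_japanese_bracket [simp]: "\<bar>japanese_bracket x\<bar> = japanese_bracket x"
  and japanese_bracket_nonneg [simp]: "0 \<le> japanese_bracket x"
  using japanese_bracket_pos[of x] by (simp_all add: less_imp_le)

text \<open>Constant in \<open>j\<close>, as all derivatives of a Schwartz function decay alike; the
  index and the one-point parameter type are there so that the graded calculus, in particular its
  product rule, applies to Schwartz functions.\<close>

definition rapid :: "nat \<Rightarrow> (unit \<Rightarrow> 'a::euclidean_space \<Rightarrow> complex) \<Rightarrow> bool" where
  "rapid j f \<longleftrightarrow> (\<forall>k. bounded_by UNIV UNIV (\<lambda>_ \<xi>. inverse (japanese_bracket \<xi> ^ k)) j f)"

lemma rapid_local: "local_family UNIV UNIV rapid"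
  using bounded_by_local unfolding local_family_def rapid_def by blast

lemma rapid_add: "add_closed rapid"
  using bounded_by_add unfolding add_closed_def rapid_def by blast

lemma rapid_iff_bounded:
  "rapid j (\<lambda>_. f) \<longleftrightarrow> (\<forall>k. bounded (range (\<lambda>x. complex_of_real (japanese_bracket x ^ k) * f x)))"
proof -
  have "norm (f x) \<le> C * inverse (japanese_bracket x ^ k) \<longleftrightarrow> norm (complex_of_real (japanese_bracket x ^ k) * f x) \<le> C" for k C x
    using japanese_bracket_pos[of x] by (simp add: norm_mult norm_power field_simps)
  then show ?thesis unfolding rapid_def bounded_by_def bounded_iff by auto
qed

lemma schwartz_iff_symbol_class: "schwartz f \<longleftrightarrow> (\<forall>n. symbol_class UNIV UNIV n rapid (\<lambda>_. f))"
proof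
  assume f: "schwartz f"
  show "\<forall>n. symbol_class UNIV UNIV n rapid (\<lambda>_. f)"
  proof
    fix n show "symbol_class UNIV UNIV n rapid (\<lambda>_. f)"
      using f smooth_on_differentiable[of UNIV f]
      by (intro iter_pderiv_symbol_class) (auto simp: schwartz_def rapid_iff_bounded)
  qed
next
  assume f: "\<forall>n. symbol_class UNIV UNIV n rapid (\<lambda>_. f)"
  have "rapid (length vs) (\<lambda>_. iter_pderiv vs f) \<and> (\<forall>\<xi>. iter_pderiv vs f differentiable (at \<xi>))" if "set vs \<subseteq> Basis" for vs
    using symbol_class_iter_pderiv[OF f[rule_format, of "Suc (length vs)"] that] by simp
  then show "schwartz f"
    unfolding schwartz_def smooth_on_def differentiable_on_def rapid_iff_bounded by auto
qed

lemma schwartz_iter_pderiv: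
  assumes "schwartz f" "set vs \<subseteq> Basis"
  shows "schwartz (iter_pderiv vs f)"
proof -
  have "symbol_class UNIV UNIV n (\<lambda>j. rapid (j + length vs)) (\<lambda>_. iter_pderiv vs f)" for n
    using assms by (intro symbol_class_iter_pderiv_symbol_class) (auto simp: schwartz_iff_symbol_class)
  moreover have "rapid (j + l) = (rapid j :: (unit \<Rightarrow> 'a \<Rightarrow> complex) \<Rightarrow> bool)" for j l
    by (simp add: rapid_def bounded_by_def fun_eq_iff)
  ultimately show ?thesis unfolding schwartz_iff_symbol_class by simp
qed

lemma schwartz_mult_coord:
  assumes "schwartz f"
  shows "schwartz (\<lambda>\<xi>. c * complex_of_real (\<xi> \<bullet> v) * f \<xi>)"
  unfolding schwartz_iff_symbol_class
proof
  fix n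
  let ?g = "bounded_by UNIV UNIV (\<lambda>_ \<xi>. japanese_bracket \<xi>) :: nat \<Rightarrow> (unit \<Rightarrow> 'a \<Rightarrow> complex) \<Rightarrow> bool"
  have 1: "symbol_class UNIV UNIV n ?g (\<lambda>(_::unit) \<xi>. c * complex_of_real (\<xi> \<bullet> v))"
  proof (rule symbol_class_linear[of ?g "\<lambda>_. c"])
    show "?g 0 (\<lambda>(_::unit) \<xi>. c * complex_of_real (\<xi> \<bullet> v))"
    proof (rule bndI[where C="norm c * norm v"])
      fix \<xi> :: 'a
      have "\<bar>\<xi> \<bullet> v\<bar> \<le> norm v * japanese_bracket \<xi>"
        using Cauchy_Schwarz_ineq2[of \<xi> v] mult_left_mono[OF norm_le_japanese_bracket[of \<xi>], of "norm v"]
        by (simp add: mult.commute)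
      then show "norm (c * complex_of_real (\<xi> \<bullet> v)) \<le> norm c * norm v * japanese_bracket \<xi>"
        using mult_left_mono[of _ _ "norm c"] by (simp add: norm_mult mult.assoc)
    qed
    show "?g 1 (\<lambda>(_::unit) \<xi>. c * complex_of_real (w \<bullet> v))" for w
    proof (rule bndI[where C="norm (c * complex_of_real (w \<bullet> v))"])
      fix \<xi> :: 'a
      show "norm (c * complex_of_real (w \<bullet> v)) \<le> norm (c * complex_of_real (w \<bullet> v)) * japanese_bracket \<xi>"
        using mult_left_mono[OF japanese_bracket_ge_1[of \<xi>], of "norm (c * complex_of_real (w \<bullet> v))"] by simp
    qed
  qed (auto simp: bounded_by_def intro!: exI[of _ 0])
  show "symbol_class UNIV UNIV n rapid (\<lambda>_ \<xi>. c * complex_of_real (\<xi> \<bullet> v) * f \<xi>)"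
  proof (rule symbol_class_mult[OF open_UNIV rapid_local rapid_add _ 1])
    show "symbol_class UNIV UNIV n rapid (\<lambda>_. f)" using assms by (simp add: schwartz_iff_symbol_class)
    fix i j and f g :: "unit \<Rightarrow> 'a \<Rightarrow> complex" assume f: "?g i f" and g: "rapid j g"
    show "rapid (i + j) (\<lambda>t \<xi>. f t \<xi> * g t \<xi>)"
      unfolding rapid_def
    proof
      fix k
      show "bounded_by UNIV UNIV (\<lambda>_ \<xi>. inverse (japanese_bracket \<xi> ^ k)) (i + j) (\<lambda>t \<xi>. f t \<xi> * g t \<xi>)"
        by (rule bounded_by_mult[OF f g[unfolded rapid_def, rule_format, of "Suc k"], where K=1])
           (auto simp: less_imp_le less_imp_neq[OF japanese_bracket_pos, symmetric])
    qed
  qed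
qed

lemma schwartz_differentiable: "schwartz f \<Longrightarrow> f differentiable (at \<xi>)"
  using smooth_on_differentiable[of UNIV f "[]"] by (simp add: schwartz_def)

lemma schwartz_continuous: "schwartz f \<Longrightarrow> continuous_on S f"
  using schwartz_differentiable by (meson continuous_at_imp_continuous_on differentiable_imp_continuous_within)

lemma schwartz_decay:
  assumes "schwartz f"
  obtains C where "0 \<le> C" "\<And>\<xi>. norm (f \<xi>) \<le> C * inverse (japanese_bracket \<xi> ^ k)"
proof -
  have "rapid 0 (\<lambda>_. f)" using assms symbol_class_base unfolding schwartz_iff_symbol_class by blast
  then have "bounded_by UNIV UNIV (\<lambda>_ \<xi>. inverse (japanese_bracket \<xi> ^ k)) 0 (\<lambda>_::unit. f)"
    by (simp add: rapid_def)
  then obtain C where "0 \<le> C" "\<And>t \<xi>. t \<in> (UNIV :: unit set) \<Longrightarrow> \<xi> \<in> UNIV \<Longrightarrow> norm (f \<xi>) \<le> C * inverse (japanese_bracket \<xi> ^ k)"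
    by (rule bndE_nonneg) auto
  then show ?thesis using that[of C] by blast
qed

lemma schwartz_integrable_power:
  assumes "schwartz f"
  shows "integrable lborel (\<lambda>\<xi>. norm \<xi> ^ k * norm (f \<xi>))"
proof -
  let ?N = "DIM('a) + 1"
  obtain C where C: "0 \<le> C" "\<And>\<xi>. norm (f \<xi>) \<le> C * inverse (japanese_bracket \<xi> ^ (k + ?N))"
    using schwartz_decay[OF assms] by blast
  have [measurable]: "f \<in> borel_measurable borel"
    using schwartz_continuous[OF assms] by (rule borel_measurable_continuous_onI)
  have "integrable lborel (\<lambda>\<xi>::'a. C * japanese_bracket \<xi> powr (- real ?N))"
    by (intro integrable_mult_right impI integrable_japanese_bracket_powr) simp
  then show ?thesis
  proof (rule Bochner_Integration.integrable_bound)
    have "norm \<xi> ^ k * norm (f \<xi>) \<le> C * japanese_bracket \<xi> powr (- real ?N)" for \<xi>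
    proof -
      have "norm \<xi> ^ k * norm (f \<xi>) \<le> japanese_bracket \<xi> ^ k * (C * inverse (japanese_bracket \<xi> ^ (k + ?N)))"
        using C norm_le_japanese_bracket[of \<xi>] by (intro mult_mono power_mono) auto
      also have "\<dots> = C * inverse (japanese_bracket \<xi> ^ ?N)"
        using japanese_bracket_pos[of \<xi>] by (simp add: power_add field_simps)
      also have "\<dots> = C * japanese_bracket \<xi> powr (- real ?N)"
        by (simp add: powr_minus powr_realpow[OF japanese_bracket_pos] del: power_Suc of_nat_add of_nat_Suc)
      finally show ?thesis .
    qed
    then show "AE \<xi> in lborel. norm (norm \<xi> ^ k * norm (f \<xi>)) \<le> norm (C * japanese_bracket \<xi> powr (- real ?N))"
      using C(1) by (auto simp: abs_mult)
  qed measurable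
qed

lemma schwartz_integrable: "schwartz f \<Longrightarrow> integrable lborel f"
  using schwartz_integrable_power[of f 0] borel_measurable_continuous_onI[OF schwartz_continuous[of f UNIV]]
  by (simp add: integrable_norm_iff)

section \<open>The Fourier transform on the Schwartz space\<close>

lemma cmod_iexp_remainder: "norm (exp (\<i> * complex_of_real t) - 1 - \<i> * complex_of_real t) \<le> t\<^sup>2 / 2"
  using iexp_approx1[of t 1] by (simp add: power2_eq_square diff_diff_eq)

text \<open>The second-order remainder of the exponential is bounded by (\<xi> \<bullet> h)^2 / 2,
  so a finite second moment of \<open>f\<close> gives an error of size |h|^2 directly, without a
  limit under the integral sign.\<close>

lemma ft_has_derivative:
  fixes f :: "'a::euclidean_space \<Rightarrow> complex"
  assumes [measurable]: "f \<in> borel_measurable borel"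
    and I: "\<And>k. k \<le> 2 \<Longrightarrow> integrable lborel (\<lambda>\<xi>. norm \<xi> ^ k * norm (f \<xi>))"
  shows "(ft f has_derivative (\<lambda>h. ft (\<lambda>\<xi>. \<i> * complex_of_real (\<xi> \<bullet> h) * f \<xi>) x)) (at x)"
  unfolding has_derivative_at
proof
  have If: "integrable lborel f" using I[of 0] by (simp add: integrable_norm_iff)
  have I1: "integrable lborel (\<lambda>\<xi>. \<i> * complex_of_real (\<xi> \<bullet> h) * f \<xi>)" for h
  proof (rule Bochner_Integration.integrable_bound)
    show "integrable lborel (\<lambda>\<xi>. norm h * (norm \<xi> ^ 1 * norm (f \<xi>)))"
      using I[of 1] by (intro integrable_mult_right) auto
    show "AE \<xi> in lborel. norm (\<i> * complex_of_real (\<xi> \<bullet> h) * f \<xi>) \<le> norm (norm h * (norm \<xi> ^ 1 * norm (f \<xi>)))"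
    proof (rule AE_I2)
      fix \<xi>
      have "\<bar>\<xi> \<bullet> h\<bar> * norm (f \<xi>) \<le> (norm \<xi> * norm h) * norm (f \<xi>)"
        by (intro mult_right_mono Cauchy_Schwarz_ineq2) auto
      then show "norm (\<i> * complex_of_real (\<xi> \<bullet> h) * f \<xi>) \<le> norm (norm h * (norm \<xi> ^ 1 * norm (f \<xi>)))"
        by (simp add: norm_mult mult_ac)
    qed
  qed measurable
  let ?D = "\<lambda>h. ft (\<lambda>\<xi>. \<i> * complex_of_real (\<xi> \<bullet> h) * f \<xi>) x"
  show "bounded_linear ?D"
  proof (rule bounded_linear_intro[where K="\<integral>\<xi>. norm \<xi> ^ 1 * norm (f \<xi>) \<partial>lborel"])
    fix h h'
    show "?D (h + h') = ?D h + ?D h'"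
      using Bochner_Integration.integral_add[OF ft_integrand_integrable[OF I1[of h], of x] ft_integrand_integrable[OF I1[of h'], of x]]
      unfolding ft_def by (simp add: inner_add_right algebra_simps)
  next
    fix r h
    have "(\<lambda>\<xi>. \<i> * complex_of_real (\<xi> \<bullet> (r *\<^sub>R h)) * f \<xi>) = (\<lambda>\<xi>. complex_of_real r * (\<i> * complex_of_real (\<xi> \<bullet> h) * f \<xi>))"
      by (simp add: fun_eq_iff mult_ac)
    then show "?D (r *\<^sub>R h) = r *\<^sub>R ?D h"
      by (simp only: ft_cmult scaleR_conv_of_real)
  next
    fix h
    have "norm (?D h) \<le> (\<integral>\<xi>. norm (\<i> * complex_of_real (\<xi> \<bullet> h) * f \<xi>) \<partial>lborel)" by (rule norm_ft_le)
    also have "\<dots> \<le> (\<integral>\<xi>. norm \<xi> ^ 1 * norm (f \<xi>) * norm h \<partial>lborel)"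
    proof (rule integral_mono)
      show "integrable lborel (\<lambda>\<xi>. norm (\<i> * complex_of_real (\<xi> \<bullet> h) * f \<xi>))" by (intro integrable_norm I1)
      show "integrable lborel (\<lambda>\<xi>. norm \<xi> ^ 1 * norm (f \<xi>) * norm h)" using I[of 1] by (intro integrable_mult_left) auto
      fix \<xi>
      have "\<bar>\<xi> \<bullet> h\<bar> * norm (f \<xi>) \<le> (norm \<xi> * norm h) * norm (f \<xi>)"
        by (intro mult_right_mono Cauchy_Schwarz_ineq2) auto
      then show "norm (\<i> * complex_of_real (\<xi> \<bullet> h) * f \<xi>) \<le> norm \<xi> ^ 1 * norm (f \<xi>) * norm h"
        by (simp add: norm_mult mult_ac)
    qed
    finally show "norm (?D h) \<le> norm h * (\<integral>\<xi>. norm \<xi> ^ 1 * norm (f \<xi>) \<partial>lborel)"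
      by (simp add: mult.commute)
  qed
  define K where "K = (\<integral>\<xi>. norm \<xi> ^ 2 * norm (f \<xi>) \<partial>lborel)"
  have rem: "norm (ft f (x + h) - ft f x - ?D h) \<le> K * (norm h)\<^sup>2" for h
  proof -
    let ?E = "\<lambda>\<xi>. exp (\<i> * complex_of_real (\<xi> \<bullet> h)) - 1 - \<i> * complex_of_real (\<xi> \<bullet> h)"
    have bd: "norm (exp (\<i> * complex_of_real (x \<bullet> \<xi>)) * (?E \<xi> * f \<xi>)) \<le> (norm \<xi> ^ 2 * norm (f \<xi>)) * (norm h)\<^sup>2" for \<xi>
    proof -
      have "norm (?E \<xi>) \<le> (\<xi> \<bullet> h)\<^sup>2 / 2" by (rule cmod_iexp_remainder)
      also have "\<dots> \<le> (\<xi> \<bullet> h)\<^sup>2" by simp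
      also have "\<dots> \<le> (norm \<xi> * norm h)\<^sup>2"
        using Cauchy_Schwarz_ineq2[of \<xi> h] by (metis abs_ge_zero power2_abs power_mono)
      finally have "norm (?E \<xi>) * norm (f \<xi>) \<le> (norm \<xi> * norm h)\<^sup>2 * norm (f \<xi>)"
        by (intro mult_right_mono) auto
      then show ?thesis by (simp add: norm_mult power_mult_distrib mult_ac)
    qed
    have I2: "integrable lborel (\<lambda>\<xi>. (norm \<xi> ^ 2 * norm (f \<xi>)) * (norm h)\<^sup>2)"
      using I[of 2] by (intro integrable_mult_left) auto
    have "ft f (x + h) - ft f x - ?D h = (\<integral>\<xi>. exp (\<i> * complex_of_real ((x + h) \<bullet> \<xi>)) * f \<xi> - exp (\<i> * complex_of_real (x \<bullet> \<xi>)) * f \<xi>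
        - exp (\<i> * complex_of_real (x \<bullet> \<xi>)) * (\<i> * complex_of_real (\<xi> \<bullet> h) * f \<xi>) \<partial>lborel)"
      unfolding ft_def using ft_integrand_integrable[OF If] ft_integrand_integrable[OF I1]
      by (subst Bochner_Integration.integral_diff Bochner_Integration.integrable_diff | simp)+
    also have "\<dots> = (\<integral>\<xi>. exp (\<i> * complex_of_real (x \<bullet> \<xi>)) * (?E \<xi> * f \<xi>) \<partial>lborel)"
      by (intro arg_cong[where f="integral\<^sup>L lborel"] ext)
         (simp add: inner_add_left inner_commute[of h] distrib_left exp_add algebra_simps)
    finally have eq: "ft f (x + h) - ft f x - ?D h = (\<integral>\<xi>. exp (\<i> * complex_of_real (x \<bullet> \<xi>)) * (?E \<xi> * f \<xi>) \<partial>lborel)" .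
    have "norm (ft f (x + h) - ft f x - ?D h) \<le> (\<integral>\<xi>. norm (exp (\<i> * complex_of_real (x \<bullet> \<xi>)) * (?E \<xi> * f \<xi>)) \<partial>lborel)"
      unfolding eq by (rule integral_norm_bound)
    also have "\<dots> \<le> (\<integral>\<xi>. (norm \<xi> ^ 2 * norm (f \<xi>)) * (norm h)\<^sup>2 \<partial>lborel)"
    proof (rule integral_mono[OF _ I2 bd])
      show "integrable lborel (\<lambda>\<xi>. norm (exp (\<i> * complex_of_real (x \<bullet> \<xi>)) * (?E \<xi> * f \<xi>)))"
        by (rule Bochner_Integration.integrable_bound[OF I2]) (measurable, use bd in \<open>auto intro: order_trans\<close>)
    qed
    finally show ?thesis by (simp add: K_def)
  qed
  have z: "((\<lambda>h::'a. K * norm h) \<longlongrightarrow> 0) (at 0)"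
    by (auto intro!: tendsto_eq_intros)
  show "(\<lambda>h. norm (ft f (x + h) - ft f x - ?D h) / norm h) \<midarrow>0\<rightarrow> 0"
  proof (rule Lim_null_comparison[OF _ z])
    have "norm (norm (ft f (x + h) - ft f x - ?D h) / norm h) \<le> K * norm h" if "h \<noteq> 0" for h
      using rem[of h] that by (simp add: divide_le_eq power2_eq_square mult.assoc)
    then show "\<forall>\<^sub>F h in at 0. norm (norm (ft f (x + h) - ft f x - ?D h) / norm h) \<le> K * norm h"
      by (simp add: eventually_at_filter)
  qed
qed

lemma ft_iter_pderiv_axis:
  assumes "schwartz f" "e \<in> Basis"
  shows "ft (iter_pderiv (replicate k e) f) x = (- \<i> * complex_of_real (x \<bullet> e)) ^ k * ft f x"
proof (induction k)
  case (Suc k)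
  have s: "schwartz (iter_pderiv (replicate j e) f)" for j
    using assms by (intro schwartz_iter_pderiv) auto
  have "ft (iter_pderiv (replicate (Suc k) e) f) x = - \<i> * complex_of_real (x \<bullet> e) * ft (iter_pderiv (replicate k e) f) x"
  proof (rule ft_pderiv)
    show "continuous_on UNIV (iter_pderiv (replicate k e) f)" by (rule schwartz_continuous[OF s])
    show "integrable lborel (iter_pderiv (replicate k e) f)" by (rule schwartz_integrable[OF s])
    show "integrable lborel (iter_pderiv (replicate (Suc k) e) f)" by (rule schwartz_integrable[OF s])
  qed (use assms(2) schwartz_differentiable[OF s] nonzero_Basis in auto)
  then show ?case using Suc by simp
qed simp

text \<open>The k-th power of the largest coordinate of x is a pure derivative on the other side, so
  k derivatives along the axes control the k-th power of the bracket; for |x| \<le> 1 the integral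
  of |f| does.\<close>

lemma ft_schwartz_rapid:
  assumes "schwartz f"
  shows "bounded (range (\<lambda>x. complex_of_real (japanese_bracket x ^ k) * ft f x))"
proof -
  let ?d = "real DIM('a)"
  define B where "B = (\<integral>\<xi>. norm (f \<xi>) \<partial>lborel) + (\<Sum>e\<in>Basis. \<integral>\<xi>. norm (iter_pderiv (replicate k e) f \<xi>) \<partial>lborel)"
  have B0: "0 \<le> B" unfolding B_def by (intro add_nonneg_nonneg sum_nonneg integral_nonneg_AE) auto
  have b1: "norm (ft f x) \<le> B" for x
  proof -
    have "0 \<le> (\<Sum>e\<in>Basis. \<integral>\<xi>. norm (iter_pderiv (replicate k e) f \<xi>) \<partial>lborel)"
      by (intro sum_nonneg integral_nonneg_AE) auto
    then show ?thesis using norm_ft_le[of f x] by (simp add: B_def)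
  qed
  have b2: "\<bar>x \<bullet> e\<bar> ^ k * norm (ft f x) \<le> B" if "e \<in> Basis" for x e
  proof -
    have "\<bar>x \<bullet> e\<bar> ^ k * norm (ft f x) = norm (ft (iter_pderiv (replicate k e) f) x)"
      using that by (simp add: ft_iter_pderiv_axis[OF assms] norm_mult norm_power)
    also have "\<dots> \<le> (\<integral>\<xi>. norm (iter_pderiv (replicate k e) f \<xi>) \<partial>lborel)" by (rule norm_ft_le)
    also have "\<dots> \<le> (\<Sum>e\<in>Basis. \<integral>\<xi>. norm (iter_pderiv (replicate k e) f \<xi>) \<partial>lborel)"
      using that by (intro member_le_sum integral_nonneg_AE) auto
    also have "\<dots> \<le> B" unfolding B_def by (simp add: integral_nonneg_AE)
    finally show ?thesis .
  qed
  have "japanese_bracket x ^ k * norm (ft f x) \<le> (2 ^ k + (2 * ?d) ^ k) * B" for x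
  proof -
    obtain e where e: "e \<in> Basis" "norm x \<le> ?d * \<bar>x \<bullet> e\<bar>" by (rule exists_large_coordinate)
    have "japanese_bracket x ^ k \<le> 2 ^ k + (2 * ?d) ^ k * \<bar>x \<bullet> e\<bar> ^ k"
    proof (cases "norm x \<le> 1")
      case True
      have "japanese_bracket x ^ k \<le> 2 ^ k"
        using japanese_bracket_le[of x] True japanese_bracket_pos[of x] by (intro power_mono) auto
      moreover have "0 \<le> (2 * ?d) ^ k * \<bar>x \<bullet> e\<bar> ^ k" by simp
      ultimately show ?thesis by linarith
    next
      case False
      then have "japanese_bracket x \<le> 2 * ?d * \<bar>x \<bullet> e\<bar>" using japanese_bracket_le[of x] e(2) by simp
      then have "japanese_bracket x ^ k \<le> (2 * ?d * \<bar>x \<bullet> e\<bar>) ^ k"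
        using japanese_bracket_pos[of x] by (intro power_mono) auto
      moreover have "(0::real) \<le> 2 ^ k" by simp
      ultimately show ?thesis unfolding power_mult_distrib by linarith
    qed
    then have "japanese_bracket x ^ k * norm (ft f x) \<le> (2 ^ k + (2 * ?d) ^ k * \<bar>x \<bullet> e\<bar> ^ k) * norm (ft f x)"
      by (intro mult_right_mono) auto
    also have "\<dots> = 2 ^ k * norm (ft f x) + (2 * ?d) ^ k * (\<bar>x \<bullet> e\<bar> ^ k * norm (ft f x))"
      by (simp add: algebra_simps)
    also have "\<dots> \<le> 2 ^ k * B + (2 * ?d) ^ k * B"
      using b1[of x] b2[OF e(1), of x] by (intro add_mono mult_left_mono) auto
    finally show ?thesis by (simp add: algebra_simps)
  qed
  then show ?thesis
    unfolding bounded_iff using japanese_bracket_pos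
    by (intro exI[of _ "(2 ^ k + (2 * ?d) ^ k) * B"]) (auto simp: norm_mult norm_power)
qed

lemma schwartz_ft_has_derivative:
  assumes "schwartz f"
  shows "(ft f has_derivative (\<lambda>h. ft (\<lambda>\<xi>. \<i> * complex_of_real (\<xi> \<bullet> h) * f \<xi>) x)) (at x)"
  using assms by (intro ft_has_derivative schwartz_integrable_power borel_measurable_continuous_onI schwartz_continuous)

text \<open>Every iterated derivative of \<open>ft f\<close> is again the transform of a Schwartz
  function, namely of f times coordinates; smoothness and rapid decay thus reduce to the two
  preceding facts.\<close>

theorem schwartz_ft:
  assumes "schwartz f"
  shows "schwartz (ft f)"
proof -
  have *: "\<exists>g. schwartz g \<and> iter_pderiv vs (ft f) = ft g" if "set vs \<subseteq> Basis" for vs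
    using that
  proof (induction vs)
    case Nil
    then show ?case using assms by auto
  next
    case (Cons v vs)
    then obtain g where g: "schwartz g" "iter_pderiv vs (ft f) = ft g" by auto
    have "iter_pderiv (v # vs) (ft f) = ft (\<lambda>\<xi>. \<i> * complex_of_real (\<xi> \<bullet> v) * g \<xi>)"
      using fun_cong[OF frechet_derivative_at[OF schwartz_ft_has_derivative[OF g(1)]], where x=v]
      unfolding iter_pderiv.simps g(2) by (intro ext) simp
    then show ?case using schwartz_mult_coord[OF g(1)] by blast
  qed
  show ?thesis
    unfolding schwartz_def smooth_on_def differentiable_on_def
  proof (intro conjI allI impI ballI)
    fix vs :: "'a list" and x assume "set vs \<subseteq> Basis"
    then obtain g where g: "schwartz g" "iter_pderiv vs (ft f) = ft g" using * by blast
    show "iter_pderiv vs (ft f) differentiable (at x within UNIV)"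
      unfolding g(2) by (rule differentiableI[OF schwartz_ft_has_derivative[OF g(1)]])
  next
    fix k and vs :: "'a list" assume "set vs \<subseteq> Basis"
    then obtain g where g: "schwartz g" "iter_pderiv vs (ft f) = ft g" using * by blast
    show "bounded (range (\<lambda>x. complex_of_real (japanese_bracket x ^ k) * iter_pderiv vs (ft f) x))"
      unfolding g(2) by (rule ft_schwartz_rapid[OF g(1)])
  qed
qed

definition two_sided_weight :: "nat \<Rightarrow> 'a::euclidean_space \<Rightarrow> real" where
  "two_sided_weight j \<xi> = (norm \<xi> + inverse (norm \<xi>)) ^ j"

text \<open>The weight \<open>two_sided_weight\<close> blows up at the origin and at infinity; it dominates all symbol weights in use, and
  functions flat at both ends beat every power of it.\<close>

lemma flat_schwartz:
  fixes f :: "'a::euclidean_space \<Rightarrow> complex"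
  assumes f0: "f 0 = 0"
    and symbol_class: "\<And>L L' n. symbol_class punctured UNIV n (bounded_by punctured UNIV (\<lambda>j \<xi>. (\<xi> \<bullet> \<xi>) ^ L * inverse ((\<xi> \<bullet> \<xi>) ^ L') * two_sided_weight j \<xi>)) (\<lambda>_::unit. f)"
  shows "schwartz f"
proof -
  have bd: "\<exists>C. \<forall>\<xi>. \<xi> \<noteq> 0 \<longrightarrow> norm (iter_pderiv vs f \<xi>) \<le> C * ((\<xi> \<bullet> \<xi>) ^ L * inverse ((\<xi> \<bullet> \<xi>) ^ L') * two_sided_weight (length vs) \<xi>)"
    and d: "\<And>\<xi>. \<xi> \<noteq> 0 \<Longrightarrow> iter_pderiv vs f differentiable (at \<xi>)"
    if "set vs \<subseteq> Basis" for vs L L'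
    using symbol_class_iter_pderiv[OF symbol_class[of "Suc (length vs)" L L'] that] by (auto simp: bounded_by_def)
  \<comment> \<open>With \<open>L = Suc (length vs)\<close> the factor |\<xi>|^(2 j + 2) beats the
    weight, which is at most (2 / |\<xi>|)^j here, and a margin of |\<xi>|^2 remains; a quadratic
    bound is what makes the next derivative at 0 vanish.\<close>
  have near: "\<exists>C\<ge>0. \<forall>\<xi>. \<xi> \<noteq> 0 \<longrightarrow> norm \<xi> \<le> 1 \<longrightarrow> norm (iter_pderiv vs f \<xi>) \<le> C * (norm \<xi>)\<^sup>2" if vs: "set vs \<subseteq> Basis" for vs
  proof -
    let ?j = "length vs"
    obtain C where C: "\<And>\<xi>. \<xi> \<noteq> 0 \<Longrightarrow> norm (iter_pderiv vs f \<xi>) \<le> C * ((\<xi> \<bullet> \<xi>) ^ Suc ?j * inverse ((\<xi> \<bullet> \<xi>) ^ 0) * two_sided_weight ?j \<xi>)"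
      using bd[OF vs, of "Suc ?j" 0] by blast
    have "norm (iter_pderiv vs f \<xi>) \<le> (\<bar>C\<bar> * 2 ^ ?j) * (norm \<xi>)\<^sup>2" if \<xi>: "\<xi> \<noteq> 0" "norm \<xi> \<le> 1" for \<xi>
    proof -
      have n: "0 < norm \<xi>" using \<xi> by simp
      have "norm \<xi> \<le> inverse (norm \<xi>)" using n \<xi>(2) one_le_inverse[OF n \<xi>(2)] by linarith
      then have "two_sided_weight ?j \<xi> \<le> (2 * inverse (norm \<xi>)) ^ ?j"
        unfolding two_sided_weight_def using n by (intro power_mono) auto
      then have "(\<xi> \<bullet> \<xi>) ^ Suc ?j * two_sided_weight ?j \<xi> \<le> (\<xi> \<bullet> \<xi>) ^ Suc ?j * (2 * inverse (norm \<xi>)) ^ ?j"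
        by (intro mult_left_mono) auto
      also have "\<dots> = 2 ^ ?j * norm \<xi> ^ ?j * (norm \<xi>)\<^sup>2"
      proof -
        have "(\<xi> \<bullet> \<xi>) ^ ?j * (inverse (norm \<xi>)) ^ ?j = norm \<xi> ^ ?j"
        proof -
          have "(\<xi> \<bullet> \<xi>) * inverse (norm \<xi>) = norm \<xi>"
            using n by (simp add: power2_norm_eq_inner[symmetric] power2_eq_square)
          then show ?thesis by (simp only: power_mult_distrib[symmetric])
        qed
        then show ?thesis by (simp add: power_mult_distrib power2_norm_eq_inner mult_ac)
      qed
      also have "\<dots> \<le> 2 ^ ?j * 1 * (norm \<xi>)\<^sup>2"
        using \<xi>(2) by (intro mult_right_mono mult_left_mono power_le_one) auto
      finally have "\<bar>C\<bar> * ((\<xi> \<bullet> \<xi>) ^ Suc ?j * two_sided_weight ?j \<xi>) \<le> \<bar>C\<bar> * (2 ^ ?j * (norm \<xi>)\<^sup>2)"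
        by (intro mult_left_mono) auto
      moreover have "C * ((\<xi> \<bullet> \<xi>) ^ Suc ?j * two_sided_weight ?j \<xi>) \<le> \<bar>C\<bar> * ((\<xi> \<bullet> \<xi>) ^ Suc ?j * two_sided_weight ?j \<xi>)"
        by (intro mult_right_mono) (auto simp: two_sided_weight_def)
      ultimately show ?thesis using C[OF \<xi>(1)] by (simp add: mult.assoc)
    qed
    then show ?thesis by (intro exI[of _ "\<bar>C\<bar> * 2 ^ ?j"]) auto
  qed
  \<comment> \<open>Induction on the order: a function that is 0 at the origin and quadratically
    small around it has derivative 0 there, which is the value at the origin of the next partial
    derivative.\<close>
  have zero: "iter_pderiv vs f 0 = 0 \<and> iter_pderiv vs f differentiable (at 0)" if "set vs \<subseteq> Basis" for vs
    using that
  proof (induction vs)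
    have D: "(g has_derivative (\<lambda>_. 0)) (at 0)" if g0: "g 0 = 0"
      and C: "0 \<le> C" "\<And>\<xi>. \<xi> \<noteq> 0 \<Longrightarrow> norm \<xi> \<le> 1 \<Longrightarrow> norm (g \<xi>) \<le> C * (norm \<xi>)\<^sup>2" for g :: "'a \<Rightarrow> complex" and C
      unfolding has_derivative_at
    proof
      have z: "((\<lambda>h::'a. C * norm h) \<longlongrightarrow> 0) (at 0)" by (auto intro!: tendsto_eq_intros)
      show "(\<lambda>h. norm (g (0 + h) - g 0 - 0) / norm h) \<midarrow>0\<rightarrow> 0"
      proof (rule Lim_null_comparison[OF _ z])
        have "\<forall>\<^sub>F h in at 0. norm (h::'a) < 1 \<and> h \<noteq> 0"
          by (auto simp: eventually_at intro!: exI[of _ 1])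
        then show "\<forall>\<^sub>F h in at 0. norm (norm (g (0 + h) - g 0 - 0) / norm h) \<le> C * norm h"
          by eventually_elim (use C g0 in \<open>auto simp: divide_le_eq power2_eq_square mult.assoc\<close>)
      qed
    qed auto
    {
      case Nil
      then show ?case using D[of f] near[of "[]"] f0 unfolding differentiable_def by auto
    next
      case (Cons v vs)
      obtain C where "0 \<le> C" "\<And>\<xi>. \<xi> \<noteq> 0 \<Longrightarrow> norm \<xi> \<le> 1 \<Longrightarrow> norm (iter_pderiv vs f \<xi>) \<le> C * (norm \<xi>)\<^sup>2"
        using near[of vs] Cons.prems by auto
      from D[OF _ this] have "(iter_pderiv vs f has_derivative (\<lambda>_. 0)) (at 0)" using Cons by simp
      then have 0: "iter_pderiv (v # vs) f 0 = 0" by (simp add: frechet_derivative_at[symmetric])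
      obtain C where "0 \<le> C" "\<And>\<xi>. \<xi> \<noteq> 0 \<Longrightarrow> norm \<xi> \<le> 1 \<Longrightarrow> norm (iter_pderiv (v # vs) f \<xi>) \<le> C * (norm \<xi>)\<^sup>2"
        using near[of "v # vs"] Cons.prems by auto
      from D[OF 0 this] 0 show ?case unfolding differentiable_def by blast
    }
  qed
  \<comment> \<open>With \<open>L' = k + length vs\<close> the weight, at most (2 |\<xi>|)^j for
    |\<xi>| \<ge> 1, is absorbed and at least k powers of decay remain.\<close>
  have far: "\<exists>C. \<forall>\<xi>. 1 \<le> norm \<xi> \<longrightarrow> norm (iter_pderiv vs f \<xi>) \<le> C * inverse (norm \<xi> ^ k)" if vs: "set vs \<subseteq> Basis" for vs k
  proof -
    let ?j = "length vs"
    obtain C where C: "\<And>\<xi>. \<xi> \<noteq> 0 \<Longrightarrow> norm (iter_pderiv vs f \<xi>) \<le> C * ((\<xi> \<bullet> \<xi>) ^ 0 * inverse ((\<xi> \<bullet> \<xi>) ^ (k + ?j)) * two_sided_weight ?j \<xi>)"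
      using bd[OF vs, of 0 "k + ?j"] by blast
    have "norm (iter_pderiv vs f \<xi>) \<le> (\<bar>C\<bar> * 2 ^ ?j) * inverse (norm \<xi> ^ k)" if \<xi>: "1 \<le> norm \<xi>" for \<xi>
    proof -
      have n: "0 < norm \<xi>" using \<xi> by linarith
      have "inverse (norm \<xi>) \<le> norm \<xi>" using n \<xi> inverse_le_1_iff[of "norm \<xi>"] by linarith
      then have "two_sided_weight ?j \<xi> \<le> (2 * norm \<xi>) ^ ?j"
        unfolding two_sided_weight_def using n by (intro power_mono) auto
      then have "inverse ((\<xi> \<bullet> \<xi>) ^ (k + ?j)) * two_sided_weight ?j \<xi> \<le> inverse ((\<xi> \<bullet> \<xi>) ^ (k + ?j)) * (2 * norm \<xi>) ^ ?j"
        by (intro mult_left_mono) auto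
      also have "\<dots> = 2 ^ ?j * inverse (norm \<xi> ^ k) * inverse (norm \<xi> ^ (k + ?j))"
        using n by (simp add: power2_norm_eq_inner[symmetric] power2_eq_square power_mult_distrib power_add field_simps)
      also have "\<dots> \<le> 2 ^ ?j * inverse (norm \<xi> ^ k) * 1"
        using \<xi> by (intro mult_left_mono) (auto simp: inverse_le_1_iff)
      finally have "\<bar>C\<bar> * (inverse ((\<xi> \<bullet> \<xi>) ^ (k + ?j)) * two_sided_weight ?j \<xi>) \<le> \<bar>C\<bar> * (2 ^ ?j * inverse (norm \<xi> ^ k))"
        by (intro mult_left_mono) auto
      moreover have "C * (inverse ((\<xi> \<bullet> \<xi>) ^ (k + ?j)) * two_sided_weight ?j \<xi>) \<le> \<bar>C\<bar> * (inverse ((\<xi> \<bullet> \<xi>) ^ (k + ?j)) * two_sided_weight ?j \<xi>)"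
        by (intro mult_right_mono) (auto simp: two_sided_weight_def)
      moreover have "norm (iter_pderiv vs f \<xi>) \<le> C * (inverse ((\<xi> \<bullet> \<xi>) ^ (k + ?j)) * two_sided_weight ?j \<xi>)"
        using C[of \<xi>] n by simp
      ultimately have "norm (iter_pderiv vs f \<xi>) \<le> \<bar>C\<bar> * (2 ^ ?j * inverse (norm \<xi> ^ k))" by linarith
      then show ?thesis by (simp only: mult.assoc)
    qed
    then show ?thesis by blast
  qed
  show ?thesis
    unfolding schwartz_def smooth_on_def differentiable_on_def
  proof (intro conjI allI impI ballI)
    fix vs :: "'a list" and x :: 'a assume "set vs \<subseteq> Basis"
    then show "iter_pderiv vs f differentiable (at x within UNIV)" using zero d by (cases "x = 0") auto
  next
    fix k and vs :: "'a list" assume vs: "set vs \<subseteq> Basis"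
    obtain C where C: "0 \<le> C" "\<And>\<xi>. \<xi> \<noteq> 0 \<Longrightarrow> norm \<xi> \<le> 1 \<Longrightarrow> norm (iter_pderiv vs f \<xi>) \<le> C * (norm \<xi>)\<^sup>2"
      using near[OF vs] by auto
    obtain C' where C': "\<And>\<xi>. 1 \<le> norm \<xi> \<Longrightarrow> norm (iter_pderiv vs f \<xi>) \<le> C' * inverse (norm \<xi> ^ k)"
      using far[OF vs, of k] by auto
    have "japanese_bracket x ^ k * norm (iter_pderiv vs f x) \<le> 2 ^ k * (C + \<bar>C'\<bar>)" for x
    proof (cases "norm x \<le> 1")
      case True
      have "norm (iter_pderiv vs f x) \<le> C"
      proof (cases "x = 0")
        case False
        have "norm (iter_pderiv vs f x) \<le> C * (norm x)\<^sup>2" by (rule C(2)[OF False True])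
        also have "\<dots> \<le> C * 1" using True C(1) by (intro mult_left_mono power_le_one) auto
        finally show ?thesis by simp
      qed (use zero[OF vs] C(1) in simp)
      then have "japanese_bracket x ^ k * norm (iter_pderiv vs f x) \<le> 2 ^ k * (C + \<bar>C'\<bar>)"
        using japanese_bracket_le[of x] True japanese_bracket_pos[of x] C(1) by (intro mult_mono power_mono) auto
      then show ?thesis .
    next
      case False
      have "japanese_bracket x ^ k * norm (iter_pderiv vs f x) \<le> (2 * norm x) ^ k * (\<bar>C'\<bar> * inverse (norm x ^ k))"
      proof (intro mult_mono power_mono)
        have "C' * inverse (norm x ^ k) \<le> \<bar>C'\<bar> * inverse (norm x ^ k)" by (intro mult_right_mono) auto
        then show "norm (iter_pderiv vs f x) \<le> \<bar>C'\<bar> * inverse (norm x ^ k)" using C'[of x] False by simp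
      qed (use japanese_bracket_le[of x] japanese_bracket_pos[of x] False in auto)
      also have "\<dots> = 2 ^ k * \<bar>C'\<bar>"
      proof -
        have "norm x ^ k \<noteq> 0" using False by auto
        then show ?thesis by (simp add: power_mult_distrib)
      qed
      also have "\<dots> \<le> 2 ^ k * (C + \<bar>C'\<bar>)" using C(1) by (intro mult_left_mono) auto
      finally show ?thesis .
    qed
    then show "bounded (range (\<lambda>x. complex_of_real (japanese_bracket x ^ k) * iter_pderiv vs f x))"
      unfolding bounded_iff using japanese_bracket_pos
      by (intro exI[of _ "2 ^ k * (C + \<bar>C'\<bar>)"]) (auto simp: norm_mult norm_power)
  qed
qed

section \<open>Kernels of the inverse of an elliptic symbol\<close>

text \<open>The class yields one constant for each direction and order, uniform in the parameter.
  Summing over the finitely many directions gives a single A with which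
  \<open>ft_kernel_bound\<close> treats all parameters at once.\<close>

lemma symbol_class_kernel_bound:
  fixes f :: "'s \<Rightarrow> 'a::euclidean_space \<Rightarrow> complex"
  assumes a: "0 \<le> a" "a < 1"
    and f: "symbol_class punctured T (Suc (Suc DIM('a))) (bounded_by punctured T (power_weight (\<lambda>_. 1) (- a))) f"
    and I: "\<And>t. t \<in> T \<Longrightarrow> integrable lborel (f t)"
  obtains C where "0 \<le> C" "\<And>t x. t \<in> T \<Longrightarrow> x \<noteq> 0 \<Longrightarrow> norm (ft (f t) x) \<le> C * norm x powr (a - real DIM('a))"
proof -
  let ?N = "Suc DIM('a)"
  have pos: "0 \<le> power_weight (\<lambda>_. 1) (- a) j \<xi>" for j and \<xi> :: 'a by (simp add: power_weight_def)
  have "\<exists>A\<ge>0. \<forall>t\<in>T. \<forall>\<xi>\<in>punctured. norm (iter_pderiv (replicate j e) (f t) \<xi>) \<le> A * power_weight (\<lambda>_. 1) (- a) j \<xi>"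
    if "e \<in> Basis" "j \<le> ?N" for e j
  proof -
    have "bounded_by punctured T (power_weight (\<lambda>_. 1) (- a)) j (\<lambda>t. iter_pderiv (replicate j e) (f t))"
      using symbol_class_iter_pderiv[OF f, of "replicate j e"] that by (simp add: set_replicate_conv_if)
    then show ?thesis by (rule bndE_nonneg[OF _ pos]) blast
  qed
  then obtain A where A: "\<And>e j. e \<in> Basis \<Longrightarrow> j \<le> ?N \<Longrightarrow> 0 \<le> A e j"
    "\<And>e j t \<xi>. e \<in> Basis \<Longrightarrow> j \<le> ?N \<Longrightarrow> t \<in> T \<Longrightarrow> \<xi> \<noteq> 0 \<Longrightarrow>
      norm (iter_pderiv (replicate j e) (f t) \<xi>) \<le> A e j * power_weight (\<lambda>_. 1) (- a) j \<xi>"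
    by (simp add: Bex_def Ball_def) metis
  define B where "B = (\<Sum>e\<in>Basis. A e 0 + A e ?N)"
  have AB: "A e 0 \<le> B" "A e ?N \<le> B" if "e \<in> Basis" for e
  proof -
    have "A e 0 + A e ?N \<le> B"
      unfolding B_def using that A(1) by (intro member_le_sum) auto
    then show "A e 0 \<le> B" "A e ?N \<le> B" using A(1)[OF that, of 0] A(1)[OF that, of ?N] by auto
  qed
  have B0: "0 \<le> B" unfolding B_def using A(1) by (intro sum_nonneg add_nonneg_nonneg) auto
  obtain C where C: "0 \<le> C"
    "\<And>(f :: 'a \<Rightarrow> complex) A x. integrable lborel f \<Longrightarrow>
      (\<And>\<xi>. \<xi> \<noteq> 0 \<Longrightarrow> norm (f \<xi>) \<le> A * norm \<xi> powr (-a)) \<Longrightarrow>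
      (\<And>e j \<xi>. e \<in> Basis \<Longrightarrow> j \<le> DIM('a) \<Longrightarrow> \<xi> \<noteq> 0 \<Longrightarrow> iter_pderiv (replicate j e) f differentiable (at \<xi>)) \<Longrightarrow>
      (\<And>e \<xi>. e \<in> Basis \<Longrightarrow> \<xi> \<noteq> 0 \<Longrightarrow>
        norm (iter_pderiv (replicate (Suc DIM('a)) e) f \<xi>) \<le> A * norm \<xi> powr (- a - real (Suc DIM('a)))) \<Longrightarrow>
      x \<noteq> 0 \<Longrightarrow> norm (ft f x) \<le> C * A * norm x powr (a - real DIM('a))"
    using ft_kernel_bound[OF a, where 'a='a] by blast
  have "norm (ft (f t) x) \<le> (C * B) * norm x powr (a - real DIM('a))" if t: "t \<in> T" and x: "x \<noteq> 0" for t x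
  proof (rule C(2)[OF I[OF t]])
    fix \<xi> :: 'a assume \<xi>: "\<xi> \<noteq> 0"
    obtain e :: 'a where e: "e \<in> Basis" using nonempty_Basis by blast
    have "norm (f t \<xi>) \<le> A e 0 * norm \<xi> powr (-a)" using A(2)[OF e _ t \<xi>, of 0] by (simp add: power_weight_def)
    also have "\<dots> \<le> B * norm \<xi> powr (-a)" using AB[OF e] by (intro mult_right_mono) auto
    finally show "norm (f t \<xi>) \<le> B * norm \<xi> powr (-a)" .
  next
    fix e \<xi> :: 'a and j assume e: "e \<in> Basis" "j \<le> DIM('a)" "\<xi> \<noteq> 0"
    then show "iter_pderiv (replicate j e) (f t) differentiable (at \<xi>)"
      using symbol_class_iter_pderiv[OF f, of "replicate j e"] t by (simp add: set_replicate_conv_if)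
  next
    fix e \<xi> :: 'a assume e: "e \<in> Basis" and \<xi>: "\<xi> \<noteq> 0"
    have "norm (iter_pderiv (replicate ?N e) (f t) \<xi>) \<le> A e ?N * norm \<xi> powr (- a - real ?N)"
      using A(2)[OF e order_refl t \<xi>] by (simp add: power_weight_def)
    also have "\<dots> \<le> B * norm \<xi> powr (- a - real ?N)" using AB[OF e] by (intro mult_right_mono) auto
    finally show "norm (iter_pderiv (replicate ?N e) (f t) \<xi>) \<le> B * norm \<xi> powr (- a - real ?N)" .
  qed (rule x)
  then show ?thesis using that[of "C * B"] C(1) B0 by simp
qed

lemma measurable_punctured:
  fixes f :: "'a::euclidean_space \<Rightarrow> complex"
  assumes "\<And>\<xi>. \<xi> \<noteq> 0 \<Longrightarrow> f differentiable (at \<xi>)"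
  shows "f \<in> borel_measurable borel"
proof (rule borel_measurable_continuous_countable_exceptions[of "{0}"])
  have "isCont f \<xi>" if "\<xi> \<noteq> 0" for \<xi> using assms[OF that] by (rule differentiable_imp_continuous_within)
  then show "continuous_on (- {0}) f" by (intro continuous_at_imp_continuous_on) auto
qed simp

lemma integrable_punctured:
  fixes f :: "'a::euclidean_space \<Rightarrow> complex"
  assumes d: "\<And>\<xi>. \<xi> \<noteq> 0 \<Longrightarrow> f differentiable (at \<xi>)"
    and a: "0 \<le> a" "a < 1"
    and near: "\<And>\<xi>. \<xi> \<noteq> 0 \<Longrightarrow> norm \<xi> \<le> 1 \<Longrightarrow> norm (f \<xi>) \<le> C * norm \<xi> powr (- a)"
    and far: "\<And>\<xi>. 1 \<le> norm \<xi> \<Longrightarrow> norm (f \<xi>) \<le> C' * norm \<xi> powr (- real (Suc DIM('a)))"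
  shows "integrable lborel f"
proof (rule Bochner_Integration.integrable_bound)
  let ?g = "\<lambda>\<xi>::'a. \<bar>C\<bar> * (indicator {\<xi>. norm \<xi> \<le> 1} \<xi> * norm \<xi> powr (- a))
    + \<bar>C'\<bar> * (indicator {\<xi>. 1 \<le> norm \<xi>} \<xi> * norm \<xi> powr (- real (Suc DIM('a))))"
  have "a < real DIM('a)" using a(2) DIM_positive[where 'a='a] by linarith
  then show "integrable lborel ?g"
    using a(1) by (intro Bochner_Integration.integrable_add integrable_mult_right impI integrable_norm_powr_near_0
        integral_norm_powr_outer(1)) auto
  show "f \<in> borel_measurable lborel" using measurable_punctured[OF d] by simp
  have "AE \<xi>::'a in lborel. \<xi> \<noteq> 0" by (rule AE_lborel_singleton)
  then show "AE \<xi> in lborel. norm (f \<xi>) \<le> norm (?g \<xi>)"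
  proof (rule AE_mp, intro AE_I2 impI)
    fix \<xi> :: 'a assume \<xi>: "\<xi> \<noteq> 0"
    have g0: "0 \<le> \<bar>C\<bar> * (indicator {\<xi>. norm \<xi> \<le> 1} \<xi> * norm \<xi> powr (- a))"
      "0 \<le> \<bar>C'\<bar> * (indicator {\<xi>. 1 \<le> norm \<xi>} \<xi> * norm \<xi> powr (- real (Suc DIM('a))))" by auto
    have "norm (f \<xi>) \<le> ?g \<xi>"
    proof (cases "norm \<xi> \<le> 1")
      case True
      have "norm (f \<xi>) \<le> C * norm \<xi> powr (- a)" by (rule near[OF \<xi> True])
      also have "\<dots> \<le> \<bar>C\<bar> * norm \<xi> powr (- a)" by (intro mult_right_mono) auto
      also have "\<dots> = \<bar>C\<bar> * (indicator {\<xi>. norm \<xi> \<le> 1} \<xi> * norm \<xi> powr (- a))" using True by simp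
      finally show ?thesis using g0(2) by linarith
    next
      case False
      have "norm (f \<xi>) \<le> C' * norm \<xi> powr (- real (Suc DIM('a)))" using far[of \<xi>] False by simp
      also have "\<dots> \<le> \<bar>C'\<bar> * norm \<xi> powr (- real (Suc DIM('a)))" by (intro mult_right_mono) auto
      also have "\<dots> = \<bar>C'\<bar> * (indicator {\<xi>. 1 \<le> norm \<xi>} \<xi> * norm \<xi> powr (- real (Suc DIM('a))))" using False by simp
      finally show ?thesis using g0(1) by linarith
    qed
    then show "norm (f \<xi>) \<le> norm (?g \<xi>)" by simp
  qed
qed

lemma ft_cong_off_0:
  fixes f g :: "'a::euclidean_space \<Rightarrow> complex"
  assumes "f \<in> borel_measurable borel" "g \<in> borel_measurable borel" "\<And>\<xi>. \<xi> \<noteq> 0 \<Longrightarrow> f \<xi> = g \<xi>"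
  shows "ft f x = ft g x" and "integrable lborel f \<longleftrightarrow> integrable lborel g"
proof -
  have ae: "AE \<xi>::'a in lborel. f \<xi> = g \<xi>"
  proof (rule AE_mp[OF AE_lborel_singleton[of 0]], rule AE_I2, rule impI)
    show "f \<xi> = g \<xi>" if "\<xi> \<noteq> 0" for \<xi> using that by (rule assms(3))
  qed
  note [measurable] = assms(1,2)
  show "ft f x = ft g x"
    unfolding ft_def
  proof (rule integral_cong_AE)
    show "AE \<xi> in lborel. exp (\<i> * complex_of_real (x \<bullet> \<xi>)) * f \<xi> = exp (\<i> * complex_of_real (x \<bullet> \<xi>)) * g \<xi>"
      using ae by eventually_elim simp
  qed measurable
  show "integrable lborel f \<longleftrightarrow> integrable lborel g"
    by (rule integrable_cong_AE[OF _ _ ae]) measurable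
qed

text \<open>The value at the origin is replaced by the limit L, which changes no integral and makes
  the function continuous. Without such a limit a jump could occur in dimension one, and its
  distributional derivative would contain a point mass.\<close>

lemma ft_pderiv_punctured:
  fixes f :: "'a::euclidean_space \<Rightarrow> complex"
  assumes e: "e \<noteq> 0" and d: "\<And>\<xi>. \<xi> \<noteq> 0 \<Longrightarrow> f differentiable (at \<xi>)"
    and L: "(f \<longlongrightarrow> L) (at 0)" and If: "integrable lborel f"
    and Ig: "integrable lborel (\<lambda>\<xi>. frechet_derivative f (at \<xi>) e)"
  shows "ft (\<lambda>\<xi>. frechet_derivative f (at \<xi>) e) x = - \<i> * complex_of_real (x \<bullet> e) * ft f x"
proof -
  define F where "F \<xi> = (if \<xi> = 0 then L else f \<xi>)" for \<xi>
  have Ff: "F \<xi> = f \<xi>" if "\<xi> \<in> - {0}" for \<xi> using that by (simp add: F_def)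
  have D: "(F has_derivative frechet_derivative f (at \<xi>)) (at \<xi>)" if "\<xi> \<noteq> 0" for \<xi>
  proof (rule has_derivative_transform_within_open)
    show "(f has_derivative frechet_derivative f (at \<xi>)) (at \<xi>)" using d[OF that] by (simp add: frechet_derivative_works)
    show "open (- {0::'a})" "\<xi> \<in> - {0}" using that by auto
    show "f \<eta> = F \<eta>" if "\<eta> \<in> - {0}" for \<eta> using Ff[OF that] ..
  qed
  have dF: "F differentiable (at \<xi>)" if "\<xi> \<noteq> 0" for \<xi> using D[OF that] by (auto simp: differentiable_def)
  have mF: "F \<in> borel_measurable borel" using dF by (rule measurable_punctured)
  have "isCont F \<xi>" for \<xi>
  proof (cases "\<xi> = 0")
    case True
    have "(F \<longlongrightarrow> L) (at 0)"
      by (rule Lim_transform_eventually[OF L]) (auto simp: eventually_at_filter F_def)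
    then show ?thesis using True by (simp add: isCont_def F_def)
  next
    case False
    show ?thesis using dF[OF False] by (rule differentiable_imp_continuous_within)
  qed
  then have "continuous_on UNIV F" by (simp add: continuous_at_imp_continuous_on)
  then have "ft (\<lambda>\<xi>. frechet_derivative f (at \<xi>) e) x = - \<i> * complex_of_real (x \<bullet> e) * ft F x"
  proof (rule ft_pderiv[OF _ e dF _ _ Ig])
    show "frechet_derivative f (at \<xi>) e = frechet_derivative F (at \<xi>) e" if "\<xi> \<noteq> 0" for \<xi>
      using frechet_derivative_at[OF D[OF that]] by simp
    show "integrable lborel F"
      using ft_cong_off_0(2)[OF mF measurable_punctured[OF d]] If by (simp add: F_def)
  qed
  also have "ft F x = ft f x"
    using ft_cong_off_0(1)[OF mF measurable_punctured[OF d]] by (simp add: F_def)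
  finally show ?thesis .
qed

lemma integrable_gauss_cutoff: "s \<noteq> 0 \<Longrightarrow> integrable lborel (gauss_cutoff s :: 'a::euclidean_space \<Rightarrow> complex)"
proof -
  assume s: "s \<noteq> 0"
  have "gauss_cutoff s = (\<lambda>\<xi>::'a. complex_of_real (sqrt (2 * pi) ^ DIM('a) * gauss (0 + s *\<^sub>R \<xi>)))"
    by (simp add: fun_eq_iff gauss_cutoff_def gauss_def power_divide power_mult_distrib power2_norm_eq_inner[symmetric])
  moreover have "integrable lborel (\<lambda>\<xi>::'a. sqrt (2 * pi) ^ DIM('a) * gauss (0 + s *\<^sub>R \<xi>))"
    using integrable_lborel_affine(1)[OF s, of gauss "0::'a"] integrable_gauss[where 'a='a]
    by (intro integrable_mult_right) blast
  ultimately show ?thesis by (simp only: integrable_of_real)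
qed

lemma measurable_gauss_cutoff [measurable]: "gauss_cutoff s \<in> borel_measurable borel"
  and measurable_flat_cutoff [measurable]: "flat_cutoff s \<in> borel_measurable borel"
  unfolding gauss_cutoff_def[abs_def] flat_cutoff_def[abs_def] by measurable

section \<open>Kernel bounds uniform in the width of the Gaussian\<close>

context elliptic_symbol
begin

lemma M_pos: "0 < M" using m_pos m_le_M by simp

lemma measurable_q [measurable]: "(\<lambda>\<xi>. inverse (p \<xi>)) \<in> borel_measurable borel"
proof (rule measurable_punctured)
  fix \<xi> :: 'a assume "\<xi> \<noteq> 0"
  then show "(\<lambda>\<xi>. inverse (p \<xi>)) differentiable (at \<xi>)"
    using symbol_class_q[of "UNIV :: unit set" "Suc 0"] by simp
qed

lemma norm_q_le: "norm (inverse (p \<xi>)) \<le> inverse c0"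
proof -
  have "japanese_bracket \<xi> powr (- M) \<le> 1"
    using powr_mono2'[of "-M" 1 "japanese_bracket \<xi>"] japanese_bracket_ge_1[of \<xi>] M_pos by simp
  then have "inverse c0 * japanese_bracket \<xi> powr (- M) \<le> inverse c0 * 1"
    using c0_pos by (intro mult_left_mono) auto
  then show ?thesis using inverse_p_bound[of \<xi>] by simp
qed

text \<open>Only the decay at infinity is retained, as it governs the kernel near 0. At the origin
  the coarser weight dominates because \<open>min 0 (m - j)\<close> is at least -j, hence at least
  -a - j.\<close>

lemma symbol_class_q_power_weight:
  assumes "0 \<le> a" "a \<le> M"
  shows "symbol_class punctured T n (bounded_by punctured T (power_weight (\<lambda>_. 1) (- a))) (\<lambda>_ \<xi>. inverse (p \<xi>))"
proof -
  have "symbol_class punctured T n (bounded_by punctured T (mixed_weight m (- M))) (\<lambda>_ \<xi>. inverse (p \<xi>))"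
    by (rule symbol_class_mono[OF _ symbol_class_q]) (auto simp: mixed_class_def)
  then show ?thesis
  proof (rule symbol_class_bounded_by_weaken[where K="\<lambda>_. 1"])
    fix j and \<xi> :: 'a assume "\<xi> \<in> punctured"
    then show "mixed_weight m (- M) j \<xi> \<le> 1 * power_weight (\<lambda>_. 1) (- a) j \<xi>"
      using assms m_pos by (cases "norm \<xi> \<le> 1") (simp_all add: mixed_weight_def power_weight_def powr_mono' powr_mono)
  qed auto
qed

lemma symbol_class_gauss_q: "symbol_class punctured {-1..1} n (mixed_class m k (- M) {-1..1}) (\<lambda>s \<xi>. gauss_cutoff s \<xi> * inverse (p \<xi>))"
  using symbol_class_mixed_class_mult[OF less_imp_le[OF m_pos] symbol_class_mixed_class_gauss_cutoff[OF less_imp_le[OF m_pos]] symbol_class_q] by simp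

lemma integrable_gauss_q: "s \<noteq> 0 \<Longrightarrow> integrable lborel (\<lambda>\<xi>. gauss_cutoff s \<xi> * inverse (p \<xi>))"
proof -
  assume "s \<noteq> 0"
  then have "integrable lborel (\<lambda>\<xi>::'a. inverse c0 *\<^sub>R (gauss_cutoff s \<xi> :: complex))" using integrable_gauss_cutoff[of s, where 'a='a] by simp
  then show ?thesis
  proof (rule Bochner_Integration.integrable_bound)
    show "AE \<xi> in lborel. norm (gauss_cutoff s \<xi> * inverse (p \<xi>)) \<le> norm (inverse c0 *\<^sub>R (gauss_cutoff s \<xi> :: complex))"
      using norm_q_le c0_pos mult_left_mono[OF norm_q_le norm_ge_zero[of "gauss_cutoff s _"]] by (auto simp: norm_mult mult.commute)
  qed measurable
qed

text \<open>The Gaussian has order 0 uniformly in s and 1/p has order -a. The restriction a < 1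
  comes from the finite-difference bound; a positive a makes |x|^(a - d) integrable near 0.\<close>

lemma local_kernel:
  assumes "0 \<le> a" "a < 1" "a \<le> M"
  obtains C where "0 \<le> C"
    "\<And>s x. s \<in> {-1..1} - {0} \<Longrightarrow> x \<noteq> 0 \<Longrightarrow> norm (ft (\<lambda>\<xi>. gauss_cutoff s \<xi> * inverse (p \<xi>)) x) \<le> C * norm x powr (a - real DIM('a))"
proof (rule symbol_class_kernel_bound[OF assms(1,2), of "{-1..1} - {0}" "\<lambda>s \<xi>. gauss_cutoff s \<xi> * inverse (p \<xi>)"])
  have X: "symbol_class punctured {-1..1} n (bounded_by punctured {-1..1} (power_weight (\<lambda>_. 1) (- a))) (\<lambda>s \<xi>. gauss_cutoff s \<xi> * inverse (p \<xi>))" for n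
    using symbol_class_power_weight_mult[OF symbol_class_gauss_cutoff symbol_class_q_power_weight[OF assms(1,3)]] by simp
  show "symbol_class punctured ({-1..1} - {0}) (Suc (Suc DIM('a))) (bounded_by punctured ({-1..1} - {0}) (power_weight (\<lambda>_. 1) (- a))) (\<lambda>s \<xi>. gauss_cutoff s \<xi> * inverse (p \<xi>))"
    by (rule symbol_class_bounded_by_subset[OF X]) auto
qed (use integrable_gauss_q that in auto)

text \<open>Near the origin the exponent \<open>min 0 (m - i)\<close> is at least m - k > -1 for i
  \<le> k; at infinity the Gaussian with fixed s supplies 2 (d + 1) powers. The latter constant
  depends on s, which does no harm to a statement of integrability.\<close>

lemma integrable_iter_pderiv_gauss_q:
  assumes s: "s \<in> {-1..1} - {0}" and e: "e \<in> Basis" and i: "i \<le> k"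
  shows "integrable lborel (iter_pderiv (replicate i e) (\<lambda>\<xi>. gauss_cutoff s \<xi> * inverse (p \<xi>)))" (is "integrable _ ?f")
proof -
  have vs: "set (replicate i e) \<subseteq> Basis" using e by (simp add: set_replicate_conv_if)
  have "bounded_by punctured {-1..1} (mixed_weight m (- M)) i (\<lambda>s. iter_pderiv (replicate i e) (\<lambda>\<xi>. gauss_cutoff s \<xi> * inverse (p \<xi>)))"
    using symbol_class_iter_pderiv[OF symbol_class_gauss_q vs, of i] by (simp add: mixed_class_def)
  then obtain C where C: "0 \<le> C" "\<And>\<xi>. \<xi> \<noteq> 0 \<Longrightarrow> norm (?f \<xi>) \<le> C * mixed_weight m (- M) i \<xi>"
    by (rule bndE_nonneg) (use s in auto)
  let ?L = "Suc DIM('a)"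
  have X: "symbol_class punctured {s} n (bounded_by punctured {s} (power_weight (\<lambda>\<xi>. inverse ((\<xi> \<bullet> \<xi>) ^ ?L) * 1) (0 + (- 0)))) (\<lambda>s \<xi>. gauss_cutoff s \<xi> * inverse (p \<xi>))" for n
    using s M_pos by (intro symbol_class_power_weight_mult symbol_class_gauss_cutoff_decay symbol_class_q_power_weight) auto
  have "bounded_by punctured {s} (power_weight (\<lambda>\<xi>. inverse ((\<xi> \<bullet> \<xi>) ^ ?L) * 1) (0 + (- 0))) i (\<lambda>s. iter_pderiv (replicate i e) (\<lambda>\<xi>. gauss_cutoff s \<xi> * inverse (p \<xi>)))"
    using symbol_class_iter_pderiv[OF X vs, of i] by simp
  then obtain C' where C': "0 \<le> C'" "\<And>\<xi>. \<xi> \<noteq> 0 \<Longrightarrow> norm (?f \<xi>) \<le> C' * (inverse ((\<xi> \<bullet> \<xi>) ^ ?L) * norm \<xi> powr (- real i))"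
    by (rule bndE_nonneg) (auto simp: power_weight_def)
  show ?thesis
  proof (rule integrable_punctured)
    show "?f differentiable (at \<xi>)" if "\<xi> \<noteq> 0" for \<xi>
      using symbol_class_iter_pderiv[OF symbol_class_gauss_q vs, of "Suc i"] s that by simp
    show "0 \<le> real k - m" "real k - m < 1" using k_ge k_le by auto
    show "norm (?f \<xi>) \<le> C * norm \<xi> powr (- (real k - m))" if "\<xi> \<noteq> 0" "norm \<xi> \<le> 1" for \<xi>
    proof -
      have "mixed_weight m (- M) i \<xi> \<le> norm \<xi> powr (- (real k - m))"
        using that i k_ge by (auto simp: mixed_weight_def intro!: powr_mono')
      then have "C * mixed_weight m (- M) i \<xi> \<le> C * norm \<xi> powr (- (real k - m))" using C(1) by (rule mult_left_mono)
      then show ?thesis using C(2)[OF that(1)] by linarith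
    qed
    show "norm (?f \<xi>) \<le> C' * norm \<xi> powr (- real (Suc DIM('a)))" if \<xi>: "1 \<le> norm \<xi>" for \<xi>
    proof -
      have n: "0 < norm \<xi>" using \<xi> by linarith
      have "inverse ((\<xi> \<bullet> \<xi>) ^ ?L) = norm \<xi> powr (- real (2 * ?L))"
        using n by (simp add: power2_norm_eq_inner[symmetric] powr_minus powr_realpow power_mult del: power_Suc of_nat_mult of_nat_Suc mult_Suc_right)
      then have "inverse ((\<xi> \<bullet> \<xi>) ^ ?L) * norm \<xi> powr (- real i) = norm \<xi> powr (- real (2 * ?L) + (- real i))"
        by (simp only: powr_add)
      also have "\<dots> \<le> norm \<xi> powr (- real ?L)" using \<xi> by (intro powr_mono) auto
      finally have "C' * (inverse ((\<xi> \<bullet> \<xi>) ^ ?L) * norm \<xi> powr (- real i)) \<le> C' * norm \<xi> powr (- real ?L)"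
        using C'(1) by (rule mult_left_mono)
      moreover have "\<xi> \<noteq> 0" using n by auto
      ultimately show ?thesis using C'(2)[of \<xi>] by linarith
    qed
  qed
qed

text \<open>Each integration by parts differentiates a function of order i < k, and exactly those
  orders are known to have a limit at the origin; of the k-th derivative only integrability is
  asked.\<close>

lemma ft_iter_pderiv_gauss_q:
  assumes s: "s \<in> {-1..1} - {0}" and e: "e \<in> Basis" and i: "i \<le> k"
  shows "ft (iter_pderiv (replicate i e) (\<lambda>\<xi>. gauss_cutoff s \<xi> * inverse (p \<xi>))) x
    = (- \<i> * complex_of_real (x \<bullet> e)) ^ i * ft (\<lambda>\<xi>. gauss_cutoff s \<xi> * inverse (p \<xi>)) x"
  using i
proof (induction i)
  case (Suc i)
  let ?f = "iter_pderiv (replicate i e) (\<lambda>\<xi>. gauss_cutoff s \<xi> * inverse (p \<xi>))"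
  have vs: "set (replicate i e) \<subseteq> Basis" using e by (simp add: set_replicate_conv_if)
  have "ft (\<lambda>\<xi>. frechet_derivative ?f (at \<xi>) e) x = - \<i> * complex_of_real (x \<bullet> e) * ft ?f x"
  proof -
    have "mixed_class m k (- M) {-1..1} i (\<lambda>s. iter_pderiv (replicate i e) (\<lambda>\<xi>. gauss_cutoff s \<xi> * inverse (p \<xi>)))"
      using symbol_class_iter_pderiv[OF symbol_class_gauss_q vs, of i] by simp
    then obtain L where L: "(?f \<longlongrightarrow> L) (at 0)"
      unfolding mixed_class_def limit_at_0_def using s Suc.prems by (meson DiffD1 Suc_le_lessD)
    show ?thesis
    proof (rule ft_pderiv_punctured[OF _ _ L])
      show "?f differentiable (at \<xi>)" if "\<xi> \<noteq> 0" for \<xi>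
        using symbol_class_iter_pderiv[OF symbol_class_gauss_q vs, of "Suc i"] s that by simp
      show "integrable lborel (\<lambda>\<xi>. frechet_derivative ?f (at \<xi>) e)"
        using integrable_iter_pderiv_gauss_q[OF s e Suc.prems] by simp
    qed (use integrable_iter_pderiv_gauss_q[OF s e] Suc.prems e nonzero_Basis in auto)
  qed
  then show ?case using Suc by simp
qed simp

text \<open>The k-th derivative along the dominant axis of x is a symbol of order -(k - m),
  uniformly in s, with 0 \<le> k - m < 1. Its transform is bounded by |x|^(k - m - d), and division
  by |x|^k gives the rate -m - d.\<close>

lemma tail_kernel:
  obtains C where "0 \<le> C"
    "\<And>s x. s \<in> {-1..1} - {0} \<Longrightarrow> x \<noteq> 0 \<Longrightarrow> norm (ft (\<lambda>\<xi>. gauss_cutoff s \<xi> * inverse (p \<xi>)) x) \<le> C * norm x powr (- m - real DIM('a))"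
proof -
  let ?T = "{-1..1} - {0::real}" and ?d = "real DIM('a)"
  let ?f = "\<lambda>s \<xi>. gauss_cutoff s \<xi> * inverse (p \<xi>)"
  have a: "0 \<le> real k - m" "real k - m < 1" using k_ge k_le by auto
  have "\<exists>C\<ge>0. \<forall>s\<in>?T. \<forall>x. x \<noteq> 0 \<longrightarrow> norm (ft (iter_pderiv (replicate k e) (?f s)) x) \<le> C * norm x powr (real k - m - ?d)"
    if e: "e \<in> Basis" for e
  proof (rule symbol_class_kernel_bound[OF a, of ?T "\<lambda>s. iter_pderiv (replicate k e) (?f s)"])
    have vs: "set (replicate k e) \<subseteq> Basis" using e by (simp add: set_replicate_conv_if)
    have 1: "symbol_class punctured {-1..1} n (\<lambda>j. mixed_class m k (- M) {-1..1} (j + k)) (\<lambda>s. iter_pderiv (replicate k e) (?f s))" for n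
      using vs by (intro symbol_class_iter_pderiv_symbol_class[OF symbol_class_gauss_q]) auto
    have X: "symbol_class punctured {-1..1} n (bounded_by punctured {-1..1} (power_weight (\<lambda>_. 1) (- (real k - m)))) (\<lambda>s. iter_pderiv (replicate k e) (?f s))" for n
    proof (rule symbol_class_mono[OF _ 1])
      fix j and g :: "real \<Rightarrow> 'a \<Rightarrow> complex" assume "mixed_class m k (- M) {-1..1} (j + k) g"
      then have "bounded_by punctured {-1..1} (mixed_weight m (- M)) (j + k) g" by (simp add: mixed_class_def)
      then obtain C where C: "0 \<le> C" "\<And>t \<xi>. t \<in> {-1..1} \<Longrightarrow> \<xi> \<in> punctured \<Longrightarrow> norm (g t \<xi>) \<le> C * mixed_weight m (- M) (j + k) \<xi>"
        by (rule bndE_nonneg) auto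
      show "bounded_by punctured {-1..1} (power_weight (\<lambda>_. 1) (- (real k - m))) j g"
      proof (rule bndI)
        fix t :: real and \<xi> :: 'a assume t: "t \<in> {-1..1}" "\<xi> \<in> punctured"
        \<comment> \<open>Inside the unit ball the two exponents agree, since k \<ge> m makes m - (j
          + k) nonpositive; outside, -M \<le> m suffices.\<close>
        have "mixed_weight m (- M) (j + k) \<xi> \<le> power_weight (\<lambda>_. 1) (- (real k - m)) j \<xi>"
          using t(2) k_ge m_pos M_pos by (cases "norm \<xi> \<le> 1") (simp_all add: mixed_weight_def power_weight_def powr_mono' powr_mono)
        then have "C * mixed_weight m (- M) (j + k) \<xi> \<le> C * power_weight (\<lambda>_. 1) (- (real k - m)) j \<xi>" using C(1) by (rule mult_left_mono)
        then show "norm (g t \<xi>) \<le> C * power_weight (\<lambda>_. 1) (- (real k - m)) j \<xi>" using C(2)[OF t] by linarith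
      qed
    qed
    show "symbol_class punctured ?T (Suc (Suc DIM('a))) (bounded_by punctured ?T (power_weight (\<lambda>_. 1) (- (real k - m)))) (\<lambda>s. iter_pderiv (replicate k e) (?f s))"
      by (rule symbol_class_bounded_by_subset[OF X]) auto
  qed (use integrable_iter_pderiv_gauss_q[OF _ e order_refl] in blast)+
  then have "\<forall>e\<in>Basis. \<exists>C. 0 \<le> C \<and> (\<forall>s\<in>?T. \<forall>x. x \<noteq> 0 \<longrightarrow> norm (ft (iter_pderiv (replicate k e) (?f s)) x) \<le> C * norm x powr (real k - m - ?d))"
    by blast
  from bchoice[OF this] obtain C where C': "\<forall>e\<in>Basis. 0 \<le> C e \<and> (\<forall>s\<in>?T. \<forall>x. x \<noteq> 0 \<longrightarrow> norm (ft (iter_pderiv (replicate k e) (?f s)) x) \<le> C e * norm x powr (real k - m - ?d))"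
    by blast
  have C: "e \<in> Basis \<Longrightarrow> 0 \<le> C e"
    "e \<in> Basis \<Longrightarrow> s \<in> ?T \<Longrightarrow> x \<noteq> 0 \<Longrightarrow> norm (ft (iter_pderiv (replicate k e) (?f s)) x) \<le> C e * norm x powr (real k - m - ?d)" for e s x
    using C' by blast+
  define B where "B = sum C Basis"
  have CB: "C e \<le> B" if "e \<in> Basis" for e unfolding B_def using that C(1) by (intro member_le_sum) auto
  have B0: "0 \<le> B" unfolding B_def using C(1) by (rule sum_nonneg)
  have "norm (ft (?f s) x) \<le> (?d ^ k * B) * norm x powr (- m - ?d)" if s: "s \<in> ?T" and x: "x \<noteq> 0" for s x
  proof -
    obtain e where e: "e \<in> Basis" "norm x \<le> ?d * \<bar>x \<bullet> e\<bar>" by (rule exists_large_coordinate)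
    have "norm x ^ k * norm (ft (?f s) x) \<le> (?d * \<bar>x \<bullet> e\<bar>) ^ k * norm (ft (?f s) x)"
      using e(2) by (intro mult_right_mono power_mono) auto
    also have "\<dots> = ?d ^ k * norm (ft (iter_pderiv (replicate k e) (?f s)) x)"
      by (simp add: ft_iter_pderiv_gauss_q[OF s e(1) order_refl] norm_mult norm_power power_mult_distrib)
    also have "\<dots> \<le> ?d ^ k * (C e * norm x powr (real k - m - ?d))"
      using C(2)[OF e(1) s x] by (intro mult_left_mono) auto
    also have "\<dots> \<le> ?d ^ k * (B * norm x powr (real k - m - ?d))"
      using CB[OF e(1)] by (intro mult_left_mono mult_right_mono) auto
    also have "norm x powr (real k - m - ?d) = norm x ^ k * norm x powr (- m - ?d)"
    proof -
      have "norm x ^ k * norm x powr (- m - ?d) = norm x powr (real k + (- m - ?d))"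
        using x by (simp only: powr_add powr_realpow zero_less_norm_iff simp_thms)
      then show ?thesis by (simp add: algebra_simps)
    qed
    finally have "norm x ^ k * norm (ft (?f s) x) \<le> norm x ^ k * ((?d ^ k * B) * norm x powr (- m - ?d))"
      by (simp only: mult_ac)
    then show ?thesis using x by (simp only: mult_le_cancel_left_pos zero_less_power zero_less_norm_iff simp_thms)
  qed
  then show ?thesis using that[of "?d ^ k * B"] B0 by simp
qed

end

section \<open>The equation tested against mollifiers\<close>

text \<open>Bounded symbols of order 0. The two members in use are the constant 1, for the side of
  the equation with \<open>u\<close>, and 1/p, for the side with \<open>F(u)\<close>; both then pass
  through the same limit.\<close>

definition admissible :: "('a::euclidean_space \<Rightarrow> complex) \<Rightarrow> bool" where
  "admissible r \<longleftrightarrow> r \<in> borel_measurable borel \<and> (\<exists>B. \<forall>\<xi>. norm (r \<xi>) \<le> B) \<and>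
    (\<forall>n. symbol_class punctured UNIV n (bounded_by punctured UNIV (power_weight (\<lambda>_. 1) 0)) (\<lambda>_::unit. r))"

lemma admissible_1: "admissible (\<lambda>_. 1)"
  unfolding admissible_def using symbol_class_power_weight_const by auto

lemma admissible_symbol_class:
  assumes "admissible r"
  shows "symbol_class punctured T n (bounded_by punctured T (power_weight (\<lambda>_. 1) 0)) (\<lambda>_. r)"
  using assms symbol_class_bounded_by_reparam[of "\<lambda>_. ()" T UNIV punctured n "power_weight (\<lambda>_. 1) 0" "\<lambda>_. r"] by (simp add: admissible_def)

lemma integrable_cutoffs:
  fixes r :: "'a::euclidean_space \<Rightarrow> complex"
  assumes r: "admissible r" and s: "s \<noteq> 0"
  obtains B where "0 \<le> B" "\<And>\<epsilon> \<xi>. norm (flat_cutoff \<epsilon> \<xi> * gauss_cutoff s \<xi> * r \<xi>) \<le> B * norm (gauss_cutoff s \<xi>)"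
    "\<And>\<epsilon>. integrable lborel (\<lambda>\<xi>. flat_cutoff \<epsilon> \<xi> * gauss_cutoff s \<xi> * r \<xi>)"
    "\<And>\<xi>. norm (gauss_cutoff s \<xi> * r \<xi>) \<le> B * norm (gauss_cutoff s \<xi>)"
    "integrable lborel (\<lambda>\<xi>. gauss_cutoff s \<xi> * r \<xi>)"
proof -
  have [measurable]: "r \<in> borel_measurable borel" using r by (simp add: admissible_def)
  obtain B where B: "\<And>\<xi>. norm (r \<xi>) \<le> B" using r by (auto simp: admissible_def)
  have B0: "0 \<le> B" using order_trans[OF norm_ge_zero B] .
  have 2: "norm (gauss_cutoff s \<xi> * r \<xi>) \<le> B * norm (gauss_cutoff s \<xi>)" for \<xi>
    using mult_right_mono[OF B, of "norm (gauss_cutoff s \<xi>)" \<xi>] by (simp add: norm_mult mult.commute)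
  have 1: "norm (flat_cutoff \<epsilon> \<xi> * gauss_cutoff s \<xi> * r \<xi>) \<le> B * norm (gauss_cutoff s \<xi>)" for \<epsilon> \<xi>
    using mult_mono[OF norm_flat_cutoff_le[of \<epsilon> \<xi>] 2[of \<xi>]] by (simp add: norm_mult mult.assoc)
  have I: "integrable lborel (\<lambda>\<xi>::'a. B *\<^sub>R (gauss_cutoff s \<xi> :: complex))"
    using integrable_gauss_cutoff[OF s, where 'a='a] by simp
  show ?thesis
  proof (rule that[OF B0 1 _ 2])
    show "integrable lborel (\<lambda>\<xi>. flat_cutoff \<epsilon> \<xi> * gauss_cutoff s \<xi> * r \<xi>)" for \<epsilon>
      by (rule Bochner_Integration.integrable_bound[OF I]) (measurable, use 1 B0 in auto)
    show "integrable lborel (\<lambda>\<xi>. gauss_cutoff s \<xi> * r \<xi>)"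
      by (rule Bochner_Integration.integrable_bound[OF I]) (measurable, use 2 B0 in auto)
  qed
qed

text \<open>Uniformly in \<epsilon> the product has order 0 and no more, so the kernel bound applies
  with a = 0; for |x| \<le> 1 the integral of the symbol is used instead.\<close>

lemma cutoffs_bound:
  fixes r :: "'a::euclidean_space \<Rightarrow> complex"
  assumes r: "admissible r" and s: "s \<noteq> 0"
  obtains C where "0 \<le> C"
    "\<And>\<epsilon> x. norm (ft (\<lambda>\<xi>. flat_cutoff \<epsilon> \<xi> * gauss_cutoff s \<xi> * r \<xi>) x) \<le> C * japanese_bracket x powr (- real DIM('a))"
proof -
  let ?d = "real DIM('a)"
  obtain B where B: "0 \<le> B" "\<And>\<epsilon> \<xi>. norm (flat_cutoff \<epsilon> \<xi> * gauss_cutoff s \<xi> * r \<xi>) \<le> B * norm (gauss_cutoff s \<xi>)"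
    "\<And>\<epsilon>. integrable lborel (\<lambda>\<xi>. flat_cutoff \<epsilon> \<xi> * gauss_cutoff s \<xi> * r \<xi>)"
    "\<And>\<xi>. norm (gauss_cutoff s \<xi> * r \<xi>) \<le> B * norm (gauss_cutoff s \<xi>)"
    "integrable lborel (\<lambda>\<xi>. gauss_cutoff s \<xi> * r \<xi>)"
    by (rule integrable_cutoffs[OF r s]) (rule that)
  have g: "symbol_class punctured UNIV n (bounded_by punctured UNIV (power_weight (\<lambda>_. 1) 0)) (\<lambda>_::real. gauss_cutoff s :: 'a \<Rightarrow> complex)" for n
    by (rule symbol_class_bounded_by_reparam[of "\<lambda>_. s" UNIV UNIV punctured n _ gauss_cutoff]) (auto intro: symbol_class_gauss_cutoff)
  have "symbol_class punctured UNIV n (bounded_by punctured UNIV (power_weight (\<lambda>_. 1) (- 0))) (\<lambda>\<epsilon> \<xi>. flat_cutoff \<epsilon> \<xi> * gauss_cutoff s \<xi> * r \<xi>)" for n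
    using symbol_class_power_weight_mult[OF symbol_class_power_weight_mult[OF symbol_class_flat_cutoff g] admissible_symbol_class[OF r]] by simp
  then obtain C1 where C1: "0 \<le> C1"
    "\<And>\<epsilon> x. \<epsilon> \<in> UNIV \<Longrightarrow> x \<noteq> 0 \<Longrightarrow> norm (ft (\<lambda>\<xi>. flat_cutoff \<epsilon> \<xi> * gauss_cutoff s \<xi> * r \<xi>) x) \<le> C1 * norm x powr (0 - ?d)"
    by (rule symbol_class_kernel_bound[rotated 2]) (use B(3) in auto)
  define C2 where "C2 = (\<integral>(\<xi>::'a). B * norm (gauss_cutoff s \<xi>) \<partial>lborel)"
  have C2: "norm (ft (\<lambda>\<xi>. flat_cutoff \<epsilon> \<xi> * gauss_cutoff s \<xi> * r \<xi>) x) \<le> C2" for \<epsilon> x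
  proof -
    have "norm (ft (\<lambda>\<xi>. flat_cutoff \<epsilon> \<xi> * gauss_cutoff s \<xi> * r \<xi>) x) \<le> (\<integral>\<xi>. norm (flat_cutoff \<epsilon> \<xi> * gauss_cutoff s \<xi> * r \<xi>) \<partial>lborel)" by (rule norm_ft_le)
    also have "\<dots> \<le> C2" unfolding C2_def
    proof (rule integral_mono)
      show "integrable lborel (\<lambda>\<xi>::'a. B * norm (gauss_cutoff s \<xi>))" using integrable_gauss_cutoff[OF s, where 'a='a] by simp
    qed (use B in auto)
    finally show ?thesis .
  qed
  have C20: "0 \<le> C2" using order_trans[OF norm_ge_zero C2] .
  show ?thesis
  proof (rule that[of "2 powr ?d * (C1 + C2)"])
    fix \<epsilon> and x :: 'a
    let ?v = "norm (ft (\<lambda>\<xi>. flat_cutoff \<epsilon> \<xi> * gauss_cutoff s \<xi> * r \<xi>) x)"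
    have j: "2 powr ?d * japanese_bracket x powr (- ?d) = (japanese_bracket x / 2) powr (- ?d)"
      by (simp add: powr_divide powr_minus field_simps)
    have le: "C1 * (2 powr ?d * japanese_bracket x powr (- ?d)) \<le> (C1 + C2) * (2 powr ?d * japanese_bracket x powr (- ?d))"
      "C2 * (2 powr ?d * japanese_bracket x powr (- ?d)) \<le> (C1 + C2) * (2 powr ?d * japanese_bracket x powr (- ?d))"
      using C1(1) C20 by (auto intro!: mult_right_mono)
    have "?v \<le> (C1 + C2) * (2 powr ?d * japanese_bracket x powr (- ?d))"
    proof (cases "norm x \<le> 1")
      case True
      then have "japanese_bracket x / 2 \<le> 1" using japanese_bracket_le[of x] by simp
      then have "1 powr (- ?d) \<le> (japanese_bracket x / 2) powr (- ?d)"
        by (intro powr_mono2') auto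
      then have "C2 * 1 \<le> C2 * (2 powr ?d * japanese_bracket x powr (- ?d))"
        unfolding j using C20 by (intro mult_left_mono) auto
      then show ?thesis using C2[of \<epsilon> x] le(2) by linarith
    next
      case False
      then have x: "x \<noteq> 0" by auto
      have "japanese_bracket x / 2 \<le> norm x" using japanese_bracket_le[of x] False by simp
      then have "norm x powr (- ?d) \<le> (japanese_bracket x / 2) powr (- ?d)"
        by (intro powr_mono2') auto
      then have "C1 * norm x powr (0 - ?d) \<le> C1 * (2 powr ?d * japanese_bracket x powr (- ?d))"
        unfolding j using C1(1) by (intro mult_left_mono) auto
      moreover have "?v \<le> C1 * norm x powr (0 - ?d)" using C1(2)[of \<epsilon> x] x by blast
      ultimately show ?thesis using le(1) by linarith
    qed
    then show "?v \<le> 2 powr ?d * (C1 + C2) * japanese_bracket x powr (- ?d)" by (simp add: mult_ac)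
  qed (use C1(1) C20 in auto)
qed

lemma flat_cutoff_tendsto:
  assumes "\<xi> \<noteq> 0" "e \<longlonglongrightarrow> 0"
  shows "(\<lambda>n. flat_cutoff (e n) \<xi>) \<longlonglongrightarrow> 1"
proof -
  have "(\<lambda>n. complex_of_real (exp (- ((e n)\<^sup>2 / (\<xi> \<bullet> \<xi>))))) \<longlonglongrightarrow> complex_of_real (exp (- (0\<^sup>2 / (\<xi> \<bullet> \<xi>))))"
    using assms by (intro tendsto_of_real tendsto_exp tendsto_minus tendsto_divide tendsto_power tendsto_const) auto
  then show ?thesis using assms(1) by (simp add: flat_cutoff_def)
qed

lemma cutoffs_tendsto:
  fixes r :: "'a::euclidean_space \<Rightarrow> complex"
  assumes r: "admissible r" and s: "s \<noteq> 0" and e: "e \<longlonglongrightarrow> 0"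
  shows "(\<lambda>n. ft (\<lambda>\<xi>. flat_cutoff (e n) \<xi> * gauss_cutoff s \<xi> * r \<xi>) x) \<longlonglongrightarrow> ft (\<lambda>\<xi>. gauss_cutoff s \<xi> * r \<xi>) x"
proof -
  have [measurable]: "r \<in> borel_measurable borel" using r by (simp add: admissible_def)
  obtain B where B: "0 \<le> B" "\<And>\<epsilon> \<xi>. norm (flat_cutoff \<epsilon> \<xi> * gauss_cutoff s \<xi> * r \<xi>) \<le> B * norm (gauss_cutoff s \<xi>)"
    "\<And>\<epsilon>. integrable lborel (\<lambda>\<xi>. flat_cutoff \<epsilon> \<xi> * gauss_cutoff s \<xi> * r \<xi>)"
    "\<And>\<xi>. norm (gauss_cutoff s \<xi> * r \<xi>) \<le> B * norm (gauss_cutoff s \<xi>)"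
    "integrable lborel (\<lambda>\<xi>. gauss_cutoff s \<xi> * r \<xi>)"
    by (rule integrable_cutoffs[OF r s]) (rule that)
  show ?thesis
    unfolding ft_def
  proof (rule integral_dominated_convergence[where w="\<lambda>\<xi>. B * norm (gauss_cutoff s \<xi>)"])
    show "integrable lborel (\<lambda>\<xi>::'a. B * norm (gauss_cutoff s \<xi>))" using integrable_gauss_cutoff[OF s, where 'a='a] by simp
    show "AE \<xi> in lborel. (\<lambda>n. exp (\<i> * complex_of_real (x \<bullet> \<xi>)) * (flat_cutoff (e n) \<xi> * gauss_cutoff s \<xi> * r \<xi>))
      \<longlonglongrightarrow> exp (\<i> * complex_of_real (x \<bullet> \<xi>)) * (gauss_cutoff s \<xi> * r \<xi>)"
    proof (rule AE_mp[OF AE_lborel_singleton[of 0]], rule AE_I2, rule impI)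
      fix \<xi> :: 'a assume "\<xi> \<noteq> 0"
      then have "(\<lambda>n. exp (\<i> * complex_of_real (x \<bullet> \<xi>)) * (flat_cutoff (e n) \<xi> * gauss_cutoff s \<xi> * r \<xi>))
        \<longlonglongrightarrow> exp (\<i> * complex_of_real (x \<bullet> \<xi>)) * (1 * gauss_cutoff s \<xi> * r \<xi>)"
        by (intro tendsto_mult tendsto_const flat_cutoff_tendsto e)
      then show "(\<lambda>n. exp (\<i> * complex_of_real (x \<bullet> \<xi>)) * (flat_cutoff (e n) \<xi> * gauss_cutoff s \<xi> * r \<xi>))
        \<longlonglongrightarrow> exp (\<i> * complex_of_real (x \<bullet> \<xi>)) * (gauss_cutoff s \<xi> * r \<xi>)" by simp
    qed
    show "AE \<xi> in lborel. norm (exp (\<i> * complex_of_real (x \<bullet> \<xi>)) * (flat_cutoff (e n) \<xi> * gauss_cutoff s \<xi> * r \<xi>)) \<le> B * norm (gauss_cutoff s \<xi>)" for n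
      using B(2) by (simp add: norm_mult)
  qed measurable
qed

lemma two_sided_weight_ge: "\<xi> \<noteq> 0 \<Longrightarrow> 1 \<le> two_sided_weight j \<xi>" "\<xi> \<noteq> 0 \<Longrightarrow> norm \<xi> powr (- real j) \<le> two_sided_weight j \<xi>"
proof -
  assume \<xi>: "\<xi> \<noteq> 0"
  have "1 \<le> norm \<xi> + inverse (norm \<xi>)"
  proof (cases "norm \<xi> \<le> 1")
    case True
    have "1 \<le> inverse (norm \<xi>)" using one_le_inverse[of "norm \<xi>"] True \<xi> by simp
    then show ?thesis using norm_ge_zero[of \<xi>] by linarith
  next
    case False
    moreover have "0 \<le> inverse (norm \<xi>)" by simp
    ultimately show ?thesis by linarith
  qed
  then show "1 \<le> two_sided_weight j \<xi>" unfolding two_sided_weight_def by (rule one_le_power)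
  have "norm \<xi> powr (- real j) = inverse (norm \<xi>) ^ j" using \<xi> by (simp add: powr_minus powr_realpow power_inverse)
  also have "\<dots> \<le> two_sided_weight j \<xi>" unfolding two_sided_weight_def by (intro power_mono) auto
  finally show "norm \<xi> powr (- real j) \<le> two_sided_weight j \<xi>" .
qed

lemma two_sided_weight_add: "two_sided_weight i \<xi> * two_sided_weight j \<xi> = two_sided_weight (i + j) \<xi>"
  by (simp add: two_sided_weight_def power_add)

text \<open>The flat factor supplies any power L at the origin and the Gaussian any power L' at
  infinity. Derivatives of the character gain nothing at infinity, so the bound |\<xi>|^(-j) is
  first weakened to \<open>two_sided_weight\<close>, which is at least 1 and tolerates them.\<close>

lemma cutoffs_schwartz:
  fixes r :: "'a::euclidean_space \<Rightarrow> complex"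
  assumes r: "admissible r" and s: "s \<noteq> 0" and \<epsilon>: "\<epsilon> \<noteq> 0"
  shows "schwartz (\<lambda>\<xi>. exp (\<i> * complex_of_real (a \<bullet> \<xi>)) * (flat_cutoff \<epsilon> \<xi> * gauss_cutoff s \<xi> * r \<xi>))"
proof (rule flat_schwartz)
  fix L L' n
  let ?w = "\<lambda>\<xi>::'a. (\<xi> \<bullet> \<xi>) ^ L * inverse ((\<xi> \<bullet> \<xi>) ^ L')"
  have w: "0 \<le> ?w \<xi>" for \<xi> by simp
  have f: "symbol_class punctured UNIV n (bounded_by punctured UNIV (power_weight (\<lambda>\<xi>. (\<xi> \<bullet> \<xi>) ^ L) 0)) (\<lambda>_::unit. flat_cutoff \<epsilon> :: 'a \<Rightarrow> complex)"
    using symbol_class_bounded_by_reparam[of "\<lambda>_. \<epsilon>" UNIV "{\<epsilon>}", OF _ symbol_class_flat_cutoff_flat[OF \<epsilon>]] by simp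
  have g: "symbol_class punctured UNIV n (bounded_by punctured UNIV (power_weight (\<lambda>\<xi>. inverse ((\<xi> \<bullet> \<xi>) ^ L')) 0)) (\<lambda>_::unit. gauss_cutoff s :: 'a \<Rightarrow> complex)"
    using symbol_class_bounded_by_reparam[of "\<lambda>_. s" UNIV "{s}", OF _ symbol_class_gauss_cutoff_decay[OF s]] by simp
  have "symbol_class punctured UNIV n (bounded_by punctured UNIV (power_weight ?w 0)) (\<lambda>(_::unit) \<xi>. flat_cutoff \<epsilon> \<xi> * gauss_cutoff s \<xi> * r \<xi>)"
    using symbol_class_power_weight_mult[OF symbol_class_power_weight_mult[OF f g] admissible_symbol_class[OF r]] by simp
  then have 1: "symbol_class punctured UNIV n (bounded_by punctured UNIV (\<lambda>j \<xi>. ?w \<xi> * two_sided_weight j \<xi>)) (\<lambda>(_::unit) \<xi>. flat_cutoff \<epsilon> \<xi> * gauss_cutoff s \<xi> * r \<xi>)"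
  proof (rule symbol_class_bounded_by_weaken[where K="\<lambda>_. 1"])
    fix j and \<xi> :: 'a assume "\<xi> \<in> punctured"
    then show "power_weight ?w 0 j \<xi> \<le> 1 * (?w \<xi> * two_sided_weight j \<xi>)"
      using mult_left_mono[OF two_sided_weight_ge(2)[of \<xi> j] w[of \<xi>]] by (simp add: power_weight_def)
  qed (simp add: power_weight_def)
  have 2: "symbol_class punctured UNIV n (bounded_by punctured UNIV (\<lambda>_ _. 1)) (\<lambda>(_::unit) \<xi>. exp (\<i> * complex_of_real (a \<bullet> \<xi>)))"
    using symbol_class_character[where k=1] by simp
  show "symbol_class punctured UNIV n (bounded_by punctured UNIV (\<lambda>j \<xi>. ?w \<xi> * two_sided_weight j \<xi>)) (\<lambda>(_::unit) \<xi>. exp (\<i> * complex_of_real (a \<bullet> \<xi>)) * (flat_cutoff \<epsilon> \<xi> * gauss_cutoff s \<xi> * r \<xi>))"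
  proof (rule symbol_class_bounded_by_mult[OF _ 2 1, where K=1])
    fix i j and \<xi> :: 'a assume \<xi>: "\<xi> \<in> punctured"
    have "two_sided_weight j \<xi> * 1 \<le> two_sided_weight j \<xi> * two_sided_weight i \<xi>"
      using \<xi> two_sided_weight_ge(1)[of \<xi>] order_trans[OF zero_le_one two_sided_weight_ge(1)[of \<xi> j]] by (intro mult_left_mono) auto
    then have "?w \<xi> * two_sided_weight j \<xi> \<le> ?w \<xi> * two_sided_weight (i + j) \<xi>"
      using w[of \<xi>] by (intro mult_left_mono) (simp_all add: two_sided_weight_add add.commute)
    then show "1 * (?w \<xi> * two_sided_weight j \<xi>) \<le> 1 * (?w \<xi> * two_sided_weight (i + j) \<xi>)" by simp
  qed (auto simp: two_sided_weight_def)
qed (simp add: flat_cutoff_def)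

section \<open>The test function that cancels \<open>p\<close>\<close>

lemma fourier_eq_ft:
  assumes [measurable]: "f \<in> borel_measurable borel"
  shows "fourier f \<xi> = ft f (- \<xi>)"
  unfolding fourier_def ft_def by (subst integral_completion) (auto simp: inner_commute)

lemma schwartz_inversion:
  fixes f :: "'a::euclidean_space \<Rightarrow> complex"
  assumes "schwartz f"
  shows "ft (ft f) \<xi> = complex_of_real ((2 * pi) ^ DIM('a)) * f (- \<xi>)"
proof -
  obtain C where "\<And>\<xi>. norm (f \<xi>) \<le> C * inverse (japanese_bracket \<xi> ^ 0)"
    using schwartz_decay[OF assms] by blast
  then show ?thesis
    by (intro ft_inversion[where B=C] schwartz_continuous schwartz_integrable schwartz_ft assms) auto
qed

lemma measurable_ft [measurable]:
  assumes [measurable]: "f \<in> borel_measurable borel"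
  shows "ft f \<in> borel_measurable borel"
  unfolding ft_def[abs_def] by measurable

context elliptic_symbol
begin

lemma admissible_q: "admissible (\<lambda>\<xi>. inverse (p \<xi>))"
  unfolding admissible_def using symbol_class_q_power_weight[of 0] M_pos norm_q_le by auto

text \<open>The transform of \<phi> is a multiple of \<xi> \<mapsto> g (-\<xi>), and g contains 1/p;
  multiplication by p (-\<xi>) cancels the reciprocal pointwise, as ellipticity excludes zeros, and
  leaves the bare cutoffs. The character in g translates by a, so both sides become convolutions
  evaluated at a.\<close>

lemma test_identity:
  assumes sol: "distribution_solution p F u" and s: "s \<noteq> 0" and \<epsilon>: "\<epsilon> \<noteq> 0"
  shows "(\<integral>y. u y * ft (\<lambda>\<xi>. flat_cutoff \<epsilon> \<xi> * gauss_cutoff s \<xi> * 1) (a - y) \<partial>lebesgue)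
    = (\<integral>y. F (u y) * ft (\<lambda>\<xi>. flat_cutoff \<epsilon> \<xi> * gauss_cutoff s \<xi> * inverse (p \<xi>)) (a - y) \<partial>lebesgue)"
proof -
  let ?c = "complex_of_real ((2 * pi) ^ DIM('a))"
  have c: "?c \<noteq> 0" by simp
  let ?G = "\<lambda>\<xi>. flat_cutoff \<epsilon> \<xi> * gauss_cutoff s \<xi> * inverse (p \<xi>)" and ?H = "\<lambda>\<xi>. flat_cutoff \<epsilon> \<xi> * gauss_cutoff s \<xi> * 1"
  define g where "g \<xi> = exp (\<i> * complex_of_real (a \<bullet> \<xi>)) * ?G \<xi>" for \<xi>
  have g: "schwartz g" unfolding g_def[abs_def] by (rule cutoffs_schwartz[OF admissible_q s \<epsilon>])
  \<comment> \<open>Three transforms instead of one: by inversion this is a multiple of the reflected \<open>ft g\<close>.\<close>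
  define \<phi> where "\<phi> = ft (ft (ft g))"
  have \<phi>: "schwartz \<phi>" unfolding \<phi>_def by (intro schwartz_ft g)
  have \<phi>_eq: "\<phi> y = ?c * ft ?G (a - y)" for y
    unfolding \<phi>_def schwartz_inversion[OF schwartz_ft[OF g]]
    by (simp add: g_def[abs_def] ft_modulate)
  have [measurable]: "\<phi> \<in> borel_measurable borel"
    by (intro borel_measurable_continuous_onI schwartz_continuous \<phi>)
  have F\<phi>: "fourier \<phi> \<xi> = ?c * (?c * g (- \<xi>))" for \<xi>
  proof -
    have "fourier \<phi> \<xi> = ft (ft (ft (ft g))) (- \<xi>)" unfolding \<phi>_def[symmetric] by (rule fourier_eq_ft) measurable
    also have "\<dots> = ?c * ft (ft g) \<xi>" using schwartz_inversion[OF schwartz_ft[OF schwartz_ft[OF g]], of "- \<xi>"] by simp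
    also have "\<dots> = ?c * (?c * g (- \<xi>))" using schwartz_inversion[OF g, of \<xi>] by simp
    finally show ?thesis .
  qed
  have M\<phi>: "fourier_multiplier (\<lambda>\<xi>. p (- \<xi>)) \<phi> y = ?c * ft ?H (a - y)" for y
  proof -
    let ?w = "\<lambda>\<xi>. exp (\<i> * complex_of_real (a \<bullet> \<xi>)) * ?H \<xi>"
    have pg: "p (- \<xi>) * fourier \<phi> \<xi> = ?c * ?c * ?w (- \<xi>)" for \<xi>
      unfolding F\<phi> g_def using p_nonzero[of "- \<xi>"] by (simp add: field_simps)
    have [measurable]: "?w \<in> borel_measurable borel" by measurable
    have "fourier_multiplier (\<lambda>\<xi>. p (- \<xi>)) \<phi> y = complex_of_real (1 / (2 * pi) ^ DIM('a)) *
        (\<integral>\<xi>. exp (\<i> * complex_of_real (y \<bullet> \<xi>)) * (?c * ?c * ?w (- \<xi>)) \<partial>lebesgue)"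
      unfolding fourier_multiplier_def inverse_fourier_def pg ..
    also have "(\<integral>\<xi>. exp (\<i> * complex_of_real (y \<bullet> \<xi>)) * (?c * ?c * ?w (- \<xi>)) \<partial>lebesgue) = ft (\<lambda>\<xi>. ?c * ?c * ?w (- \<xi>)) y"
      unfolding ft_def by (rule integral_completion) measurable
    also have "\<dots> = ?c * ?c * ft ?H (a - y)"
      unfolding ft_cmult ft_reflect[of ?w] ft_modulate by simp
    finally show ?thesis by simp
  qed
  have "(\<integral>y. u y * (?c * ft ?H (a - y)) \<partial>lebesgue) = (\<integral>y. F (u y) * (?c * ft ?G (a - y)) \<partial>lebesgue)"
    using sol[unfolded distribution_solution_def multiplier_distribution_def function_distribution_def, rule_format, OF \<phi>]
    by (simp only: M\<phi> \<phi>_eq)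
  then have "?c * (\<integral>y. u y * ft ?H (a - y) \<partial>lebesgue) = ?c * (\<integral>y. F (u y) * ft ?G (a - y) \<partial>lebesgue)"
    by (simp only: mult.left_commute[of _ ?c] integral_mult_right_zero)
  then show ?thesis by (rule iffD1[OF mult_left_cancel[OF c]])
qed

end

text \<open>The smaller of the two brackets takes over both exponents. A product of powers at
  different points is thereby bounded by functions of one point each.\<close>

lemma japanese_bracket_powr_mult_le:
  assumes "0 \<le> \<alpha>" "0 \<le> \<beta>"
  shows "japanese_bracket x powr (- \<alpha>) * japanese_bracket y powr (- \<beta>)
    \<le> japanese_bracket x powr (- (\<alpha> + \<beta>)) + japanese_bracket y powr (- (\<alpha> + \<beta>))"
proof (cases "japanese_bracket x \<le> japanese_bracket y")
  case True
  have "japanese_bracket x powr (- \<alpha>) * japanese_bracket y powr (- \<beta>) \<le> japanese_bracket x powr (- \<alpha>) * japanese_bracket x powr (- \<beta>)"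
    using True assms by (intro mult_left_mono powr_mono2') auto
  also have "\<dots> = japanese_bracket x powr (- (\<alpha> + \<beta>))" by (simp add: powr_add[symmetric])
  finally show ?thesis using powr_ge_zero[of "japanese_bracket y" "- (\<alpha> + \<beta>)"] by linarith
next
  case False
  have "japanese_bracket x powr (- \<alpha>) * japanese_bracket y powr (- \<beta>) \<le> japanese_bracket y powr (- \<alpha>) * japanese_bracket y powr (- \<beta>)"
    using False assms by (intro mult_right_mono powr_mono2') auto
  also have "\<dots> = japanese_bracket y powr (- (\<alpha> + \<beta>))" by (simp add: powr_add[symmetric])
  finally show ?thesis using powr_ge_zero[of "japanese_bracket x" "- (\<alpha> + \<beta>)"] by linarith
qed

lemma integrable_reflect_translate:
  fixes f :: "'a::euclidean_space \<Rightarrow> 'b::{banach, second_countable_topology}"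
  shows "integrable lborel (\<lambda>y. f (a - y)) \<longleftrightarrow> integrable lborel f"
    and "(\<integral>y. f (a - y) \<partial>lborel) = integral\<^sup>L lborel f"
  using integrable_lborel_affine[of "-1" f a] by simp_all

lemma integrable_japanese_bracket_conv:
  assumes "0 \<le> \<alpha>" "0 \<le> \<beta>" "real DIM('a) < \<alpha> + \<beta>"
  shows "integrable lborel (\<lambda>y::'a::euclidean_space. japanese_bracket y powr (- \<alpha>) * japanese_bracket (a - y) powr (- \<beta>))"
proof (rule Bochner_Integration.integrable_bound)
  have "integrable lborel (\<lambda>y::'a. japanese_bracket y powr (- (\<alpha> + \<beta>)))"
    by (rule integrable_japanese_bracket_powr[OF assms(3)])
  then show "integrable lborel (\<lambda>y::'a. japanese_bracket y powr (- (\<alpha> + \<beta>)) + japanese_bracket (a - y) powr (- (\<alpha> + \<beta>)))"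
    by (intro Bochner_Integration.integrable_add) (simp_all only: integrable_reflect_translate(1)[of "\<lambda>y. japanese_bracket y powr (- (\<alpha> + \<beta>))"])
  show "AE y in lborel. norm (japanese_bracket y powr (- \<alpha>) * japanese_bracket (a - y) powr (- \<beta>))
    \<le> norm (japanese_bracket y powr (- (\<alpha> + \<beta>)) + japanese_bracket (a - y) powr (- (\<alpha> + \<beta>)))"
  proof (rule AE_I2)
    fix y :: 'a
    have "0 \<le> japanese_bracket y powr (- \<alpha>) * japanese_bracket (a - y) powr (- \<beta>)" by simp
    then show "norm (japanese_bracket y powr (- \<alpha>) * japanese_bracket (a - y) powr (- \<beta>))
      \<le> norm (japanese_bracket y powr (- (\<alpha> + \<beta>)) + japanese_bracket (a - y) powr (- (\<alpha> + \<beta>)))"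
      using japanese_bracket_powr_mult_le[OF assms(1,2), of y "a - y"] unfolding real_norm_def by linarith
  qed
qed measurable

text \<open>Dominated convergence with majorant \<langle>y\<rangle>^(-\<sigma>) \<langle>a -
  y\<rangle>^(-d): the exponents add up to more than d precisely because \<sigma> is
  positive.\<close>

lemma cutoffs_conv_tendsto:
  fixes r w :: "'a::euclidean_space \<Rightarrow> complex"
  assumes r: "admissible r" and s: "s \<noteq> 0" and e: "e \<longlonglongrightarrow> 0"
    and w: "w \<in> borel_measurable lebesgue" and \<sigma>: "0 < \<sigma>"
    and B: "AE y in lebesgue. norm (w y) \<le> B * japanese_bracket y powr (- \<sigma>)"
  shows "(\<lambda>n. \<integral>y. w y * ft (\<lambda>\<xi>. flat_cutoff (e n) \<xi> * gauss_cutoff s \<xi> * r \<xi>) (a - y) \<partial>lebesgue)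
    \<longlonglongrightarrow> (\<integral>y. w y * ft (\<lambda>\<xi>. gauss_cutoff s \<xi> * r \<xi>) (a - y) \<partial>lebesgue)"
proof -
  have [measurable]: "r \<in> borel_measurable borel" using r by (simp add: admissible_def)
  obtain C where C: "0 \<le> C"
    "\<And>\<epsilon> x. norm (ft (\<lambda>\<xi>. flat_cutoff \<epsilon> \<xi> * gauss_cutoff s \<xi> * r \<xi>) x) \<le> C * japanese_bracket x powr (- real DIM('a))"
    by (rule cutoffs_bound[OF r s]) (rule that)
  have m: "(\<lambda>y. w y * ft f (a - y)) \<in> borel_measurable lebesgue" if "f \<in> borel_measurable borel" for f
  proof -
    have "(\<lambda>y. ft f (a - y)) \<in> borel_measurable lborel" using that by measurable
    then have "(\<lambda>y. ft f (a - y)) \<in> borel_measurable lebesgue" by (rule measurable_completion)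
    then show ?thesis using w by measurable
  qed
  show ?thesis
  proof (rule integral_dominated_convergence[where w="\<lambda>y. B * C * (japanese_bracket y powr (- \<sigma>) * japanese_bracket (a - y) powr (- real DIM('a)))"])
    show "(\<lambda>y. w y * ft (\<lambda>\<xi>. gauss_cutoff s \<xi> * r \<xi>) (a - y)) \<in> borel_measurable lebesgue" by (rule m) measurable
    show "(\<lambda>y. w y * ft (\<lambda>\<xi>. flat_cutoff (e n) \<xi> * gauss_cutoff s \<xi> * r \<xi>) (a - y)) \<in> borel_measurable lebesgue" for n by (rule m) measurable
    have "integrable lborel (\<lambda>y. B * C * (japanese_bracket y powr (- \<sigma>) * japanese_bracket (a - y) powr (- real DIM('a))))"
      using \<sigma> by (intro integrable_mult_right impI integrable_japanese_bracket_conv) auto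
    then show "integrable lebesgue (\<lambda>y. B * C * (japanese_bracket y powr (- \<sigma>) * japanese_bracket (a - y) powr (- real DIM('a))))"
      by (subst integrable_completion) auto
    show "AE y in lebesgue. (\<lambda>n. w y * ft (\<lambda>\<xi>. flat_cutoff (e n) \<xi> * gauss_cutoff s \<xi> * r \<xi>) (a - y)) \<longlonglongrightarrow> w y * ft (\<lambda>\<xi>. gauss_cutoff s \<xi> * r \<xi>) (a - y)"
      by (intro AE_I2 tendsto_mult tendsto_const cutoffs_tendsto r s e)
    show "AE y in lebesgue. norm (w y * ft (\<lambda>\<xi>. flat_cutoff (e n) \<xi> * gauss_cutoff s \<xi> * r \<xi>) (a - y))
      \<le> B * C * (japanese_bracket y powr (- \<sigma>) * japanese_bracket (a - y) powr (- real DIM('a)))" for n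
      using B
    proof eventually_elim
      case (elim y)
      have "norm (w y) * norm (ft (\<lambda>\<xi>. flat_cutoff (e n) \<xi> * gauss_cutoff s \<xi> * r \<xi>) (a - y))
        \<le> (B * japanese_bracket y powr (- \<sigma>)) * (C * japanese_bracket (a - y) powr (- real DIM('a)))"
        using elim C(2) by (intro mult_mono order_trans[OF norm_ge_zero elim]) auto
      then show ?case by (simp add: norm_mult mult_ac)
    qed
  qed
qed

lemma (in elliptic_symbol) mollified_identity:
  assumes sol: "distribution_solution p F u" and s: "s \<noteq> 0" and \<sigma>: "0 < \<sigma>"
    and u: "u \<in> borel_measurable lebesgue" "AE y in lebesgue. norm (u y) \<le> B * japanese_bracket y powr (- \<sigma>)"
    and v: "(\<lambda>y. F (u y)) \<in> borel_measurable lebesgue" "AE y in lebesgue. norm (F (u y)) \<le> B' * japanese_bracket y powr (- \<sigma>)"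
  shows "(\<integral>y. u y * ft (gauss_cutoff s) (a - y) \<partial>lebesgue)
    = (\<integral>y. F (u y) * ft (\<lambda>\<xi>. gauss_cutoff s \<xi> * inverse (p \<xi>)) (a - y) \<partial>lebesgue)"
proof -
  define e where "e n = 1 / real (Suc n)" for n
  have e: "e \<longlonglongrightarrow> 0" "e n \<noteq> 0" for n
    unfolding e_def[abs_def] using LIMSEQ_inverse_real_of_nat by (auto simp: divide_inverse)
  note 1 = cutoffs_conv_tendsto[OF admissible_1 s e(1) u(1) \<sigma> u(2), of a]
  note 2 = cutoffs_conv_tendsto[OF admissible_q s e(1) v(1) \<sigma> v(2), of a]
  show ?thesis
    using LIMSEQ_unique[OF 1[unfolded test_identity[OF sol s e(2)]] 2] by simp
qed

section \<open>Decay of convolutions\<close>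

text \<open>Joins the local and the tail bound of the kernel in one function, integrable for a < d <
  \<tau>. The second term needs no indicator, being bounded on the unit ball.\<close>

definition kernel_majorant :: "real \<Rightarrow> real \<Rightarrow> 'a::euclidean_space \<Rightarrow> real" where
  "kernel_majorant a \<tau> z = indicator {z. norm z \<le> 1} z * norm z powr (- a) + japanese_bracket z powr (- \<tau>)"

lemma kernel_majorant_nonneg: "0 \<le> kernel_majorant a \<tau> z"
  by (simp add: kernel_majorant_def)

lemma measurable_kernel_majorant [measurable]: "kernel_majorant a \<tau> \<in> borel_measurable borel"
  unfolding kernel_majorant_def[abs_def] by measurable

text \<open>The exponent \<open>\<sigma>\<close> runs up to and including the decay rate \<open>\<tau>\<close> of the kernel: distributing
  \<open>\<langle>x\<rangle>\<^sup>\<sigma>\<close> over \<open>x - y\<close> and \<open>y\<close> leaves only terms controlled by \<open>\<langle>x - y\<rangle>\<^sup>-\<^sup>\<tau> + \<langle>y\<rangle>\<^sup>-\<^sup>\<tau>\<close>.\<close>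

lemma kernel_majorant_convolution_bound:
  fixes a \<tau> \<sigma> :: real
  assumes a: "0 \<le> a" "a < real DIM('a)" and \<tau>: "real DIM('a) < \<tau>" and \<sigma>: "0 \<le> \<sigma>" "\<sigma> \<le> \<tau>"
  obtains C where "0 \<le> C"
    "\<And>x::'a::euclidean_space. integrable lborel (\<lambda>y. kernel_majorant a \<tau> (x - y) * japanese_bracket y powr (- \<sigma>))"
    "\<And>x::'a. (\<integral>y. kernel_majorant a \<tau> (x - y) * japanese_bracket y powr (- \<sigma>) \<partial>lborel) \<le> C * japanese_bracket x powr (- \<sigma>)"
proof -
  let ?J = "\<lambda>z::'a. indicator {z. norm z \<le> 1} z * norm z powr (- a)"
  \<comment> \<open>From \<langle>x\<rangle>^\<sigma> \<le> 2^\<sigma> (\<langle>x -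
    y\<rangle>^\<sigma> + \<langle>y\<rangle>^\<sigma>): \<open>?W\<close> gathers the terms in x -
    y and \<open>?V\<close> the one in y, so both integrals are constants independent of x. The
    additional 2^\<sigma> on the singular part bounds \<langle>x - y\<rangle>^\<sigma> where |x - y|
    \<le> 1.\<close>
  let ?W = "\<lambda>z::'a. 2 powr \<sigma> * kernel_majorant a \<tau> z + 2 powr \<sigma> * 2 powr \<sigma> * ?J z + 2 powr \<sigma> * japanese_bracket z powr (- \<tau>)"
  let ?V = "\<lambda>z::'a. 2 powr \<sigma> * japanese_bracket z powr (- \<tau>)"
  have IJ: "integrable lborel ?J" by (rule integrable_norm_powr_near_0[OF a])
  have It: "integrable lborel (\<lambda>z::'a. japanese_bracket z powr (- \<tau>))" by (rule integrable_japanese_bracket_powr[OF \<tau>])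
  have Ik: "integrable lborel (kernel_majorant a \<tau> :: 'a \<Rightarrow> real)"
    unfolding kernel_majorant_def[abs_def] by (intro Bochner_Integration.integrable_add IJ It)
  have IW: "integrable lborel ?W" and IV: "integrable lborel ?V"
    by (intro Bochner_Integration.integrable_add integrable_mult_right impI IJ It Ik)+
  define C where "C = integral\<^sup>L lborel ?W + integral\<^sup>L lborel ?V"
  have C: "0 \<le> C" unfolding C_def
    by (intro add_nonneg_nonneg integral_nonneg_AE AE_I2 mult_nonneg_nonneg kernel_majorant_nonneg) auto
  have pw: "japanese_bracket x powr \<sigma> * (kernel_majorant a \<tau> (x - y) * japanese_bracket y powr (- \<sigma>)) \<le> ?W (x - y) + ?V y" for x y :: 'a
  proof -
    let ?z = "x - y"
    let ?X = "japanese_bracket x" and ?Y = "japanese_bracket y" and ?Z = "japanese_bracket ?z"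
    have "?X \<le> ?Z + ?Y" using japanese_bracket_add[of ?z y] by simp
    then have "?X \<le> 2 * max ?Z ?Y" by linarith
    then have "?X powr \<sigma> \<le> (2 * max ?Z ?Y) powr \<sigma>" using \<sigma>(1) by (intro powr_mono2) auto
    also have "\<dots> = 2 powr \<sigma> * max ?Z ?Y powr \<sigma>" by (rule powr_mult)
    also have "max ?Z ?Y powr \<sigma> \<le> ?Z powr \<sigma> + ?Y powr \<sigma>" by (simp add: max_def)
    finally have 1: "?X powr \<sigma> \<le> 2 powr \<sigma> * (?Z powr \<sigma> + ?Y powr \<sigma>)" by simp
    have Y1: "?Y powr \<sigma> * ?Y powr (- \<sigma>) = 1" by (simp add: powr_minus less_imp_neq[OF japanese_bracket_pos, symmetric])
    have Yle: "?Y powr (- \<sigma>) \<le> 1"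
      using powr_mono2'[of "- \<sigma>" 1 ?Y] japanese_bracket_ge_1[of y] \<sigma>(1) by simp
    have J: "?Z powr \<sigma> * ?J ?z \<le> 2 powr \<sigma> * ?J ?z"
    proof (cases "norm ?z \<le> 1")
      case True
      then have "?Z powr \<sigma> \<le> 2 powr \<sigma>" using japanese_bracket_le[of ?z] \<sigma>(1) by (intro powr_mono2) auto
      then show ?thesis by (intro mult_right_mono) auto
    qed simp
    have "?Z powr \<sigma> * kernel_majorant a \<tau> ?z * ?Y powr (- \<sigma>)
      = (?Z powr \<sigma> * ?J ?z) * ?Y powr (- \<sigma>) + ?Z powr (- (\<tau> - \<sigma>)) * ?Y powr (- \<sigma>)"
      by (simp add: kernel_majorant_def algebra_simps powr_add[symmetric] flip: powr_diff)
    also have "(?Z powr \<sigma> * ?J ?z) * ?Y powr (- \<sigma>) \<le> (2 powr \<sigma> * ?J ?z) * 1"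
      by (rule mult_mono[OF J Yle]) auto
    \<comment> \<open>The exponents \<tau> - \<sigma> and \<sigma> add up to \<tau>; in the endpoint
      case \<sigma> = \<tau> the first is 0 and the bound persists.\<close>
    also have "?Z powr (- (\<tau> - \<sigma>)) * ?Y powr (- \<sigma>) \<le> ?Z powr (- \<tau>) + ?Y powr (- \<tau>)"
      using japanese_bracket_powr_mult_le[of "\<tau> - \<sigma>" \<sigma> ?z y] \<sigma> by simp
    finally have 2: "?Z powr \<sigma> * kernel_majorant a \<tau> ?z * ?Y powr (- \<sigma>) \<le> 2 powr \<sigma> * ?J ?z + (?Z powr (- \<tau>) + ?Y powr (- \<tau>))" by simp
    have "?X powr \<sigma> * (kernel_majorant a \<tau> ?z * ?Y powr (- \<sigma>)) \<le> 2 powr \<sigma> * (?Z powr \<sigma> + ?Y powr \<sigma>) * (kernel_majorant a \<tau> ?z * ?Y powr (- \<sigma>))"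
      using 1 kernel_majorant_nonneg[of a \<tau> ?z] by (intro mult_right_mono) auto
    also have "\<dots> = 2 powr \<sigma> * (?Z powr \<sigma> * kernel_majorant a \<tau> ?z * ?Y powr (- \<sigma>)) + 2 powr \<sigma> * kernel_majorant a \<tau> ?z * (?Y powr \<sigma> * ?Y powr (- \<sigma>))"
      by (simp only: distrib_left distrib_right mult_ac)
    also have "\<dots> \<le> 2 powr \<sigma> * (2 powr \<sigma> * ?J ?z + (?Z powr (- \<tau>) + ?Y powr (- \<tau>))) + 2 powr \<sigma> * kernel_majorant a \<tau> ?z * 1"
      unfolding Y1 using 2 by (intro add_right_mono mult_left_mono) auto
    finally show ?thesis by (simp only: distrib_left mult.assoc mult_1_right)
  qed
  have IWx: "integrable lborel (\<lambda>y. ?W (x - y) + ?V y)" for x :: 'a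
    by (intro Bochner_Integration.integrable_add IV integrable_reflect_translate(1)[THEN iffD2, OF IW])
  have cancel: "japanese_bracket x powr (- \<sigma>) * (japanese_bracket x powr \<sigma> * k) = k" for x :: 'a and k
    by (simp add: powr_minus less_imp_neq[OF japanese_bracket_pos, symmetric])
  have I: "integrable lborel (\<lambda>y. japanese_bracket x powr \<sigma> * (kernel_majorant a \<tau> (x - y) * japanese_bracket y powr (- \<sigma>)))" for x :: 'a
  proof (rule Bochner_Integration.integrable_bound[OF IWx[of x]])
    show "AE y in lborel. norm (japanese_bracket x powr \<sigma> * (kernel_majorant a \<tau> (x - y) * japanese_bracket y powr (- \<sigma>))) \<le> norm (?W (x - y) + ?V y)"
    proof (rule AE_I2)
      fix y :: 'a
      have "0 \<le> japanese_bracket x powr \<sigma> * (kernel_majorant a \<tau> (x - y) * japanese_bracket y powr (- \<sigma>))"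
        by (intro mult_nonneg_nonneg kernel_majorant_nonneg) auto
      then show "norm (japanese_bracket x powr \<sigma> * (kernel_majorant a \<tau> (x - y) * japanese_bracket y powr (- \<sigma>))) \<le> norm (?W (x - y) + ?V y)"
        using pw[of x y] unfolding real_norm_def by linarith
    qed
  qed measurable
  show ?thesis
  proof (rule that[OF C])
    fix x :: 'a
    have eq: "kernel_majorant a \<tau> (x - y) * japanese_bracket y powr (- \<sigma>)
      = japanese_bracket x powr (- \<sigma>) * (japanese_bracket x powr \<sigma> * (kernel_majorant a \<tau> (x - y) * japanese_bracket y powr (- \<sigma>)))" for y
      by (rule cancel[symmetric])
    show "integrable lborel (\<lambda>y. kernel_majorant a \<tau> (x - y) * japanese_bracket y powr (- \<sigma>))"
      by (subst eq) (rule integrable_mult_right[OF I])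
    have "(\<integral>y. japanese_bracket x powr \<sigma> * (kernel_majorant a \<tau> (x - y) * japanese_bracket y powr (- \<sigma>)) \<partial>lborel) \<le> (\<integral>y. ?W (x - y) + ?V y \<partial>lborel)"
      by (rule integral_mono[OF I IWx pw])
    also have "\<dots> = C"
      unfolding C_def
      using Bochner_Integration.integral_add[OF integrable_reflect_translate(1)[THEN iffD2, OF IW] IV, of x]
        integrable_reflect_translate(2)[of ?W x] by simp
    finally have le: "(\<integral>y. japanese_bracket x powr \<sigma> * (kernel_majorant a \<tau> (x - y) * japanese_bracket y powr (- \<sigma>)) \<partial>lborel) \<le> C" .
    have "(\<integral>y. kernel_majorant a \<tau> (x - y) * japanese_bracket y powr (- \<sigma>) \<partial>lborel)
      = japanese_bracket x powr (- \<sigma>) * (\<integral>y. japanese_bracket x powr \<sigma> * (kernel_majorant a \<tau> (x - y) * japanese_bracket y powr (- \<sigma>)) \<partial>lborel)"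
      by (subst eq) (rule integral_mult_right_zero)
    also have "\<dots> \<le> japanese_bracket x powr (- \<sigma>) * C" using le by (intro mult_left_mono) auto
    finally show "(\<integral>y. kernel_majorant a \<tau> (x - y) * japanese_bracket y powr (- \<sigma>) \<partial>lborel) \<le> C * japanese_bracket x powr (- \<sigma>)"
      by (simp add: mult.commute)
  qed
qed

lemma ft_gauss_cutoff:
  assumes "0 < s"
  shows "ft (gauss_cutoff s) (x :: 'a::euclidean_space) = complex_of_real ((2 * pi) ^ DIM('a) / s ^ DIM('a) * gauss (x /\<^sub>R s))"
proof -
  have "gauss_cutoff s \<xi> = complex_of_real (exp (- (norm (s *\<^sub>R \<xi>))\<^sup>2 / 2))" for \<xi> :: 'a
    by (simp add: gauss_cutoff_def power_mult_distrib power2_norm_eq_inner)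
  then show ?thesis unfolding ft_def using gauss_scaled_ft[OF assms, of x] by simp
qed

context elliptic_symbol
begin

lemma kernel_kernel_majorant:
  obtains a C where "0 \<le> a" "a < real DIM('a)" "0 \<le> C"
    "\<And>s x. 0 < s \<Longrightarrow> s \<le> 1 \<Longrightarrow> x \<noteq> 0 \<Longrightarrow>
      norm (ft (\<lambda>\<xi>. gauss_cutoff s \<xi> * inverse (p \<xi>)) x) \<le> C * kernel_majorant a (m + real DIM('a)) x"
proof -
  let ?d = "real DIM('a)"
  \<comment> \<open>Any b with 0 < b < 1 and b \<le> M serves; the local singularity then has
    exponent d - b, strictly below d.\<close>
  define b where "b = min M (1 / 2)"
  have b: "0 < b" "b < 1" "b \<le> M" using M_pos by (auto simp: b_def)
  have d1: "1 \<le> ?d" by (simp add: Suc_le_eq)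
  have half: "(z / 2) powr (- t) = 2 powr t * z powr (- t)" for z t :: real
    by (simp add: powr_divide powr_minus field_simps)
  obtain C1 where C1: "0 \<le> C1"
    "\<And>s x. s \<in> {-1..1} - {0} \<Longrightarrow> x \<noteq> 0 \<Longrightarrow> norm (ft (\<lambda>\<xi>. gauss_cutoff s \<xi> * inverse (p \<xi>)) x) \<le> C1 * norm x powr (b - ?d)"
    by (rule local_kernel[OF less_imp_le[OF b(1)] b(2,3)]) (rule that)
  obtain C2 where C2: "0 \<le> C2"
    "\<And>s x. s \<in> {-1..1} - {0} \<Longrightarrow> x \<noteq> 0 \<Longrightarrow> norm (ft (\<lambda>\<xi>. gauss_cutoff s \<xi> * inverse (p \<xi>)) x) \<le> C2 * norm x powr (- m - ?d)"
    by (rule tail_kernel) (rule that)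
  have par: "0 \<le> ?d - b" "?d - b < ?d" "0 \<le> C1 + C2 * 2 powr (m + ?d)"
    using b d1 C1(1) C2(1) by (linarith, linarith, simp)
  show ?thesis
  proof (rule that[OF par])
    fix s :: real and x :: 'a assume s: "0 < s" "s \<le> 1" and x: "x \<noteq> 0"
    let ?v = "norm (ft (\<lambda>\<xi>. gauss_cutoff s \<xi> * inverse (p \<xi>)) x)" and ?k = "kernel_majorant (?d - b) (m + ?d) x"
    have s': "s \<in> {-1..1} - {0}" using s by auto
    have k: "0 \<le> C1 * ?k" "0 \<le> C2 * 2 powr (m + ?d) * ?k"
      using C1(1) C2(1) kernel_majorant_nonneg[of "?d - b" "m + ?d" x] by auto
    show "?v \<le> (C1 + C2 * 2 powr (m + ?d)) * ?k"
    proof (cases "norm x \<le> 1")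
      case True
      have "norm x powr (b - ?d) \<le> ?k" using True by (simp add: kernel_majorant_def)
      then have "C1 * norm x powr (b - ?d) \<le> C1 * ?k" using C1(1) by (rule mult_left_mono)
      then show ?thesis using C1(2)[OF s' x] k(2) by (simp only: distrib_right)
    next
      case False
      have "japanese_bracket x / 2 \<le> norm x" using japanese_bracket_le[of x] False by simp
      then have "norm x powr (- (m + ?d)) \<le> (japanese_bracket x / 2) powr (- (m + ?d))"
        using m_pos by (intro powr_mono2') auto
      also have "\<dots> = 2 powr (m + ?d) * japanese_bracket x powr (- (m + ?d))"
        by (rule half)
      also have "\<dots> \<le> 2 powr (m + ?d) * ?k" by (intro mult_left_mono) (auto simp: kernel_majorant_def)
      finally have "C2 * norm x powr (- m - ?d) \<le> C2 * (2 powr (m + ?d) * ?k)"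
        using C2(1) by (intro mult_left_mono) auto
      then show ?thesis using C2(2)[OF s' x] k(1) by (simp only: distrib_right mult.assoc)
    qed
  qed
qed

text \<open>The rate is that of the kernel convolved with \<open>F(u)\<close>; from the rate \<rho>
  of \<open>u\<close> only positivity enters, through the identity for the mollifications. The
  constant is independent of s, and so survives the limit of vanishing width.\<close>

lemma mollified_bound:
  assumes sol: "distribution_solution p F u" and \<rho>: "0 < \<rho>" and \<sigma>: "0 < \<sigma>" "\<sigma> \<le> m + real DIM('a)"
    and u: "u \<in> borel_measurable lebesgue" "AE y in lebesgue. norm (u y) \<le> B * japanese_bracket y powr (- \<rho>)"
    and v: "(\<lambda>y. F (u y)) \<in> borel_measurable lebesgue" "AE y in lebesgue. norm (F (u y)) \<le> B' * japanese_bracket y powr (- \<sigma>)"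
    and B': "0 \<le> B'"
  obtains C where "0 \<le> C" "\<And>s x. 0 < s \<Longrightarrow> s \<le> 1 \<Longrightarrow>
    norm (\<integral>y. u y * complex_of_real (gauss ((x - y) /\<^sub>R s) / s ^ DIM('a)) \<partial>lebesgue) \<le> C * japanese_bracket x powr (- \<sigma>)"
proof -
  let ?d = "real DIM('a)" and ?\<tau> = "m + real DIM('a)"
  let ?c = "(2 * pi) ^ DIM('a)"
  obtain a K where K: "0 \<le> a" "a < ?d" "0 \<le> K"
    "\<And>s x. 0 < s \<Longrightarrow> s \<le> 1 \<Longrightarrow> x \<noteq> 0 \<Longrightarrow> norm (ft (\<lambda>\<xi>. gauss_cutoff s \<xi> * inverse (p \<xi>)) x) \<le> K * kernel_majorant a ?\<tau> x"
    by (rule kernel_kernel_majorant) (rule that)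
  have \<tau>: "?d < ?\<tau>" using m_pos by simp
  obtain D where D: "0 \<le> D"
    "\<And>x::'a. integrable lborel (\<lambda>y. kernel_majorant a ?\<tau> (x - y) * japanese_bracket y powr (- \<sigma>))"
    "\<And>x::'a. (\<integral>y. kernel_majorant a ?\<tau> (x - y) * japanese_bracket y powr (- \<sigma>) \<partial>lborel) \<le> D * japanese_bracket x powr (- \<sigma>)"
    by (rule kernel_majorant_convolution_bound[OF K(1,2) \<tau> less_imp_le[OF \<sigma>(1)] \<sigma>(2)]) (rule that)
  have c: "1 \<le> ?c" using pi_gt3 by (intro one_le_power) simp
  \<comment> \<open>The identity for mollifications asks for one decay rate shared by
    \<open>u\<close> and \<open>F(u)\<close>.\<close>
  define \<mu> where "\<mu> = min \<rho> \<sigma>"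
  have \<mu>: "0 < \<mu>" using \<rho> \<sigma> by (simp add: \<mu>_def)
  have weak: "AE y in lebesgue. norm (w y :: complex) \<le> \<bar>E\<bar> * japanese_bracket y powr (- \<mu>)"
    if "AE y in lebesgue. norm (w y) \<le> E * japanese_bracket y powr (- e)" "\<mu> \<le> e" for w e E
    using that(1)
  proof eventually_elim
    case (elim y)
    have "E * japanese_bracket y powr (- e) \<le> \<bar>E\<bar> * japanese_bracket y powr (- e)" by (intro mult_right_mono) auto
    also have "\<dots> \<le> \<bar>E\<bar> * japanese_bracket y powr (- \<mu>)"
      using that(2) japanese_bracket_ge_1[of y] by (intro mult_left_mono powr_mono) auto
    finally show ?case using elim by linarith
  qed
  show ?thesis
  proof (rule that[of "B' * K * D"])
    fix s :: real and x :: 'a assume s: "0 < s" "s \<le> 1"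
    let ?I = "\<integral>y. u y * complex_of_real (gauss ((x - y) /\<^sub>R s) / s ^ DIM('a)) \<partial>lebesgue"
    have "complex_of_real ?c * ?I = (\<integral>y. complex_of_real ?c * (u y * complex_of_real (gauss ((x - y) /\<^sub>R s) / s ^ DIM('a))) \<partial>lebesgue)"
      by (rule integral_mult_right_zero[symmetric])
    also have "\<dots> = (\<integral>y. u y * ft (gauss_cutoff s) (x - y) \<partial>lebesgue)"
      unfolding ft_gauss_cutoff[OF s(1)] by (intro arg_cong[where f="integral\<^sup>L lebesgue"] ext) simp
    also have "\<dots> = (\<integral>y. F (u y) * ft (\<lambda>\<xi>. gauss_cutoff s \<xi> * inverse (p \<xi>)) (x - y) \<partial>lebesgue)"
      by (rule mollified_identity[OF sol _ \<mu> u(1) weak[OF u(2)] v(1) weak[OF v(2)]]) (use s in \<open>auto simp: \<mu>_def\<close>)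
    finally have eq: "complex_of_real ?c * ?I = (\<integral>y. F (u y) * ft (\<lambda>\<xi>. gauss_cutoff s \<xi> * inverse (p \<xi>)) (x - y) \<partial>lebesgue)" .
    let ?R = "\<lambda>y. B' * K * (kernel_majorant a ?\<tau> (x - y) * japanese_bracket y powr (- \<sigma>))"
    have IR: "integrable lborel ?R" by (intro integrable_mult_right impI D(2))
    have "norm ?I \<le> ?c * norm ?I" using mult_right_mono[OF c norm_ge_zero[of ?I]] by simp
    also have "\<dots> = norm (complex_of_real ?c * ?I)" by (simp only: norm_mult norm_of_real) simp
    also have "\<dots> \<le> (\<integral>y. ?R y \<partial>lebesgue)"
      unfolding eq
    proof (rule order_trans[OF integral_norm_bound integral_mono_AE])
      \<comment> \<open>The kernel bound excludes the origin, that is the single point y = x, which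
        is a null set.\<close>
      have AE0: "AE y in lebesgue. y \<noteq> x"
        using AE_lborel_singleton[of x] by (rule AE_completion)
      have bd: "AE y in lebesgue. norm (F (u y) * ft (\<lambda>\<xi>. gauss_cutoff s \<xi> * inverse (p \<xi>)) (x - y)) \<le> ?R y"
        using v(2) AE0
      proof eventually_elim
        case (elim y)
        have "norm (F (u y)) * norm (ft (\<lambda>\<xi>. gauss_cutoff s \<xi> * inverse (p \<xi>)) (x - y))
          \<le> (B' * japanese_bracket y powr (- \<sigma>)) * (K * kernel_majorant a ?\<tau> (x - y))"
          using elim K(4)[OF s, of "x - y"] B' by (intro mult_mono) auto
        then show ?case by (simp add: norm_mult mult_ac)
      qed
      show IR': "integrable lebesgue ?R" using IR by (subst integrable_completion) auto
      have "(\<lambda>y. ft (\<lambda>\<xi>. gauss_cutoff s \<xi> * inverse (p \<xi>)) (x - y)) \<in> borel_measurable lborel" by measurable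
      then have "(\<lambda>y. ft (\<lambda>\<xi>. gauss_cutoff s \<xi> * inverse (p \<xi>)) (x - y)) \<in> borel_measurable lebesgue" by (rule measurable_completion)
      then have mm: "(\<lambda>y. F (u y) * ft (\<lambda>\<xi>. gauss_cutoff s \<xi> * inverse (p \<xi>)) (x - y)) \<in> borel_measurable lebesgue"
        using v(1) by measurable
      show "integrable lebesgue (\<lambda>y. norm (F (u y) * ft (\<lambda>\<xi>. gauss_cutoff s \<xi> * inverse (p \<xi>)) (x - y)))"
        by (rule integrable_norm, rule Bochner_Integration.integrable_bound[OF IR' mm]) (use bd in \<open>eventually_elim, auto\<close>)
      show "AE y in lebesgue. norm (F (u y) * ft (\<lambda>\<xi>. gauss_cutoff s \<xi> * inverse (p \<xi>)) (x - y)) \<le> ?R y" by (rule bd)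
    qed
    also have "\<dots> = B' * K * (\<integral>y. kernel_majorant a ?\<tau> (x - y) * japanese_bracket y powr (- \<sigma>) \<partial>lborel)"
      using IR by (subst integral_completion) auto
    also have "\<dots> \<le> B' * K * (D * japanese_bracket x powr (- \<sigma>))"
      using D(3)[of x] B' K(3) by (intro mult_left_mono) auto
    finally show "norm ?I \<le> B' * K * D * japanese_bracket x powr (- \<sigma>)" by (simp add: mult.assoc)
  qed (use B' K(3) D(1) in auto)
qed

end

section \<open>From mollifications to pointwise bounds\<close>

lemma mollified_eq:
  fixes u :: "'a::euclidean_space \<Rightarrow> complex"
  assumes "0 < s"
  shows "(\<integral>y. u y * complex_of_real (gauss ((x - y) /\<^sub>R s) / s ^ DIM('a)) \<partial>lborel)
    = (\<integral>z. u (x + s *\<^sub>R z) * complex_of_real (gauss z) \<partial>lborel)"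
proof -
  let ?f = "\<lambda>y. u y * complex_of_real (gauss ((x - y) /\<^sub>R s) / s ^ DIM('a))"
  have g: "gauss ((x - (x + s *\<^sub>R z)) /\<^sub>R s) = gauss z" for z
    using assms by (simp add: gauss_def)
  have "integral\<^sup>L lborel ?f = s ^ DIM('a) *\<^sub>R (\<integral>z. ?f (x + s *\<^sub>R z) \<partial>lborel)"
    using integrable_lborel_affine(2)[of s ?f x] assms by simp
  also have "\<dots> = (\<integral>z. s ^ DIM('a) *\<^sub>R ?f (x + s *\<^sub>R z) \<partial>lborel)"
    by (rule integral_scaleR_right[symmetric])
  also have "\<dots> = (\<integral>z. u (x + s *\<^sub>R z) * complex_of_real (gauss z) \<partial>lborel)"
    unfolding g using assms by (intro arg_cong[where f="integral\<^sup>L lborel"] ext) (simp add: scaleR_conv_of_real)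
  finally show ?thesis .
qed

lemma integrable_indicator_cball: "integrable lborel (\<lambda>x::'a::euclidean_space. c * indicator (cball 0 R) x :: real)"
  using emeasure_bounded_finite[OF bounded_cball[of "0::'a" R]]
  by (intro integrable_mult_right impI integrable_real_indicator) auto

lemma integrable_compact_support:
  fixes g :: "'a::euclidean_space \<Rightarrow> 'b::{banach, second_countable_topology}"
  assumes "g \<in> borel_measurable borel" "\<And>x. norm (g x) \<le> B" "\<And>x. R < norm x \<Longrightarrow> g x = 0"
  shows "integrable lborel g"
proof (rule Bochner_Integration.integrable_bound)
  show "integrable lborel (\<lambda>x::'a. \<bar>B\<bar> * indicator (cball 0 R) x)"
    by (rule integrable_indicator_cball)
  show "AE x in lborel. norm (g x) \<le> norm (\<bar>B\<bar> * indicator (cball 0 R) x)"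
  proof (rule AE_I2)
    fix x show "norm (g x) \<le> norm (\<bar>B\<bar> * indicator (cball 0 R) x)"
      using assms(2)[of x] assms(3)[of x] by (cases "norm x \<le> R") (auto simp: mem_cball dist_norm)
  qed
qed (use assms(1) in simp)

text \<open>Testing with continuous functions first: by Fubini the mollification moves to the test function,
  where it converges by dominated convergence.\<close>

lemma mollified_test_continuous:
  fixes u g :: "'a::euclidean_space \<Rightarrow> complex" and b :: "'a \<Rightarrow> real"
  assumes [measurable]: "u \<in> borel_measurable borel" and B: "\<And>x. norm (u x) \<le> B"
    and g: "continuous_on UNIV g" "\<And>x. norm (g x) \<le> 1" "\<And>x. R < norm x \<Longrightarrow> g x = 0"
    and b: "b \<in> borel_measurable borel" "\<And>x. 0 \<le> b x" "\<And>x. b x \<le> Bb"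
    and moll: "\<And>s x. 0 < s \<Longrightarrow> s \<le> 1 \<Longrightarrow> norm (\<integral>z. u (x + s *\<^sub>R z) * complex_of_real (gauss z) \<partial>lborel) \<le> b x"
  shows "norm (\<integral>y. u y * g y \<partial>lborel) \<le> (\<integral>y. b y * norm (g y) \<partial>lborel)"
proof -
  note [measurable] = b(1)
  have gm [measurable]: "g \<in> borel_measurable borel" using g(1) by (rule borel_measurable_continuous_onI)
  have B0: "0 \<le> B" using order_trans[OF norm_ge_zero B] .
  have Bb0: "0 \<le> Bb" using order_trans[OF b(2,3)] .
  have Ig: "integrable lborel g" by (rule integrable_compact_support[OF gm g(2,3)])
  have Iug: "integrable lborel (\<lambda>y. u y * g (y - z))" for z
  proof (rule Bochner_Integration.integrable_bound)
    show "integrable lborel (\<lambda>y. B *\<^sub>R g (y - z))"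
      using integrable_translate(1)[of g "- z"] Ig by simp
    show "AE y in lborel. norm (u y * g (y - z)) \<le> norm (B *\<^sub>R g (y - z))"
      using B B0 by (auto simp: norm_mult intro!: mult_right_mono)
  qed measurable
  define s where "s n = 1 / real (Suc n)" for n
  have s: "s \<longlonglongrightarrow> 0" "0 < s n" "s n \<le> 1" for n
    unfolding s_def[abs_def] using LIMSEQ_inverse_real_of_nat by (auto simp: divide_inverse inverse_le_1_iff)
  \<comment> \<open>The correlation of u with g: h 0 is the pairing to be estimated, and testing a
    mollification of u against g gives the Gaussian average of h at scale s. Continuity of g makes h
    continuous at 0 along the scaled points, though u is only measurable.\<close>
  define h where "h z = (\<integral>y. u y * g (y - z) \<partial>lborel)" for z
  have hB: "norm (h z) \<le> B * (\<integral>y. norm (g y) \<partial>lborel)" for z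
  proof -
    have "norm (h z) \<le> (\<integral>y. norm (u y * g (y - z)) \<partial>lborel)" unfolding h_def by (rule integral_norm_bound)
    also have "\<dots> \<le> (\<integral>y. B * norm (g (y - z)) \<partial>lborel)"
    proof (rule integral_mono)
      show "integrable lborel (\<lambda>y. B * norm (g (y - z)))"
        using integrable_translate(1)[of g "- z"] Ig by (intro integrable_mult_right impI integrable_norm) simp
      show "integrable lborel (\<lambda>y. norm (u y * g (y - z)))" by (rule integrable_norm[OF Iug])
      show "norm (u y * g (y - z)) \<le> B * norm (g (y - z))" for y
        unfolding norm_mult by (rule mult_right_mono[OF B]) simp
    qed
    also have "\<dots> = B * (\<integral>y. norm (g y) \<partial>lborel)"
      using integrable_translate(2)[of "\<lambda>y. norm (g y)" "- z"] by simp
    finally show ?thesis .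
  qed
  have hm [measurable]: "h \<in> borel_measurable borel"
    unfolding h_def[abs_def] by measurable
  have lim_h: "(\<lambda>n. h (s n *\<^sub>R z)) \<longlonglongrightarrow> h 0" for z
    unfolding h_def
  \<comment> \<open>All scales are at most 1, so the translated supports stay in one ball of radius
    R + |z|.\<close>
  proof (rule integral_dominated_convergence[where w="\<lambda>y. B * indicator (cball 0 (R + norm z)) y"])
    show "integrable lborel (\<lambda>y::'a. B * indicator (cball 0 (R + norm z)) y)"
      by (rule integrable_indicator_cball)
    show "AE y in lborel. (\<lambda>n. u y * g (y - s n *\<^sub>R z)) \<longlonglongrightarrow> u y * g (y - 0)"
    proof (rule AE_I2)
      fix y
      have "(\<lambda>n. y - s n *\<^sub>R z) \<longlonglongrightarrow> y - 0 *\<^sub>R z" by (intro tendsto_intros s)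
      then have "(\<lambda>n. g (y - s n *\<^sub>R z)) \<longlonglongrightarrow> g (y - 0)"
        using g(1) by (auto simp: continuous_on_eq_continuous_at intro: isCont_tendsto_compose)
      then show "(\<lambda>n. u y * g (y - s n *\<^sub>R z)) \<longlonglongrightarrow> u y * g (y - 0)" by (intro tendsto_intros)
    qed
    show "AE y in lborel. norm (u y * g (y - s n *\<^sub>R z)) \<le> B * indicator (cball 0 (R + norm z)) y" for n
    proof (rule AE_I2)
      fix y
      show "norm (u y * g (y - s n *\<^sub>R z)) \<le> B * indicator (cball 0 (R + norm z)) y"
      proof (cases "norm y \<le> R + norm z")
        case True
        have "norm (u y) * norm (g (y - s n *\<^sub>R z)) \<le> B * 1" using B B0 g(2) by (intro mult_mono) auto
        then show ?thesis using True by (simp add: norm_mult mem_cball dist_norm)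
      next
        case False
        have "norm (s n *\<^sub>R z) \<le> 1 * norm z" using mult_right_mono[OF s(3)[of n] norm_ge_zero[of z]] s(2)[of n] by simp
        then have "R < norm (y - s n *\<^sub>R z)" using False norm_triangle_ineq2[of y "s n *\<^sub>R z"] by linarith
        then show ?thesis using g(3) B0 by simp
      qed
    qed
  qed measurable
  have "(\<lambda>n. \<integral>z. h (s n *\<^sub>R z) * complex_of_real (gauss z) \<partial>lborel) \<longlonglongrightarrow> (\<integral>(z::'a). h 0 * complex_of_real (gauss z) \<partial>lborel)"
  proof (rule integral_dominated_convergence[where w="\<lambda>z. B * (\<integral>y. norm (g y) \<partial>lborel) * gauss z"])
    show "integrable lborel (\<lambda>z::'a. B * (\<integral>y. norm (g y) \<partial>lborel) * gauss z)"
      by (intro integrable_mult_right impI integrable_gauss)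
    show "AE z in lborel. (\<lambda>n. h (s n *\<^sub>R z) * complex_of_real (gauss z)) \<longlonglongrightarrow> h 0 * complex_of_real (gauss z)"
      by (intro AE_I2 tendsto_mult tendsto_const lim_h)
    show "AE z in lborel. norm (h (s n *\<^sub>R z) * complex_of_real (gauss z)) \<le> B * (\<integral>y. norm (g y) \<partial>lborel) * gauss z" for n
      using hB by (auto simp: norm_mult intro!: mult_right_mono)
  qed measurable
  moreover have one: "(\<integral>(z::'a). h 0 * complex_of_real (gauss z) \<partial>lborel) = h 0"
    using integral_gauss[where 'a='a] by simp
  ultimately have lim: "(\<lambda>n. \<integral>z. h (s n *\<^sub>R z) * complex_of_real (gauss z) \<partial>lborel) \<longlonglongrightarrow> h 0" unfolding one by blast
  have Ibg: "integrable lborel (\<lambda>y. b y * norm (g y))"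
  proof (rule integrable_compact_support)
    show "norm (b y * norm (g y)) \<le> Bb * 1" for y
      using b(2,3)[of y] g(2)[of y] mult_mono[of "b y" Bb "norm (g y)" 1] Bb0 by simp
  qed (use g(3) in auto)
  have "norm (\<integral>z. h (s n *\<^sub>R z) * complex_of_real (gauss z) \<partial>lborel) \<le> (\<integral>y. b y * norm (g y) \<partial>lborel)" for n
  proof -
    let ?F = "\<lambda>x z. u (x + s n *\<^sub>R z) * complex_of_real (gauss z) * g x"
    have bdF: "norm (?F x z) \<le> B * norm (g x) * gauss z" for x z
      using mult_right_mono[OF B[of "x + s n *\<^sub>R z"], of "gauss z * norm (g x)"] by (simp add: norm_mult mult_ac)
    have IF: "integrable lborel (\<lambda>z. ?F x z)" for x
    proof (rule Bochner_Integration.integrable_bound)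
      show "integrable lborel (\<lambda>z::'a. B * norm (g x) * gauss z)" by (intro integrable_mult_right impI integrable_gauss)
      show "AE z in lborel. norm (?F x z) \<le> norm (B * norm (g x) * gauss z)"
        unfolding real_norm_def by (intro AE_I2 order_trans[OF bdF abs_ge_self])
    qed measurable
    have "integrable (lborel \<Otimes>\<^sub>M lborel) (case_prod ?F)"
    proof (rule lborel_pair.Fubini_integrable)
      show "case_prod ?F \<in> borel_measurable (lborel \<Otimes>\<^sub>M lborel)" by measurable
      show "AE x in lborel. integrable lborel (\<lambda>z. case_prod ?F (x, z))" using IF by simp
      show "integrable lborel (\<lambda>x. \<integral>z. norm (case_prod ?F (x, z)) \<partial>lborel)"
      proof (rule Bochner_Integration.integrable_bound)
        show "integrable lborel (\<lambda>x. B *\<^sub>R g x)" using Ig by simp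
        show "(\<lambda>x. \<integral>z. norm (case_prod ?F (x, z)) \<partial>lborel) \<in> borel_measurable lborel" by measurable
        show "AE x in lborel. norm (\<integral>z. norm (case_prod ?F (x, z)) \<partial>lborel) \<le> norm (B *\<^sub>R g x)"
        proof (rule AE_I2)
          fix x
          have "(\<integral>z. norm (?F x z) \<partial>lborel) \<le> (\<integral>(z::'a). B * norm (g x) * gauss z \<partial>lborel)"
            by (rule integral_mono[OF integrable_norm[OF IF] _ bdF]) (intro integrable_mult_right impI integrable_gauss)
          also have "\<dots> = B * norm (g x)" using integral_gauss[where 'a='a] by simp
          finally have le: "(\<integral>z. norm (?F x z) \<partial>lborel) \<le> B * norm (g x)" .
          have "0 \<le> (\<integral>z. norm (?F x z) \<partial>lborel)" by (rule integral_nonneg_AE) simp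
          with le show "norm (\<integral>z. norm (case_prod ?F (x, z)) \<partial>lborel) \<le> norm (B *\<^sub>R g x)" using B0 by simp
        qed
      qed
    qed
    from lborel_pair.Fubini_integral[OF this]
    have fub: "(\<integral>z. (\<integral>x. ?F x z \<partial>lborel) \<partial>lborel) = (\<integral>x. (\<integral>z. ?F x z \<partial>lborel) \<partial>lborel)" .
    have "(\<integral>x. ?F x z \<partial>lborel) = h (s n *\<^sub>R z) * complex_of_real (gauss z)" for z
    proof -
      have "(\<integral>x. ?F x z \<partial>lborel) = (\<integral>x. (\<lambda>y. u y * g (y - s n *\<^sub>R z)) (x + s n *\<^sub>R z) * complex_of_real (gauss z) \<partial>lborel)"
        by (intro arg_cong[where f="integral\<^sup>L lborel"] ext) (simp add: mult_ac)
      also have "\<dots> = (\<integral>x. (\<lambda>y. u y * g (y - s n *\<^sub>R z)) (x + s n *\<^sub>R z) \<partial>lborel) * complex_of_real (gauss z)"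
        by (rule integral_mult_left_zero)
      also have "\<dots> = h (s n *\<^sub>R z) * complex_of_real (gauss z)"
        unfolding h_def by (subst integrable_translate(2)) simp
      finally show ?thesis .
    qed
    then have "norm (\<integral>z. h (s n *\<^sub>R z) * complex_of_real (gauss z) \<partial>lborel)
      = norm (\<integral>x. (\<integral>z. u (x + s n *\<^sub>R z) * complex_of_real (gauss z) \<partial>lborel) * g x \<partial>lborel)"
      using fub by simp
    also have "\<dots> \<le> (\<integral>x. norm ((\<integral>z. u (x + s n *\<^sub>R z) * complex_of_real (gauss z) \<partial>lborel) * g x) \<partial>lborel)"
      by (rule integral_norm_bound)
    also have "\<dots> \<le> (\<integral>x. b x * norm (g x) \<partial>lborel)"
    proof (rule integral_mono[OF _ Ibg])
      have bd: "norm ((\<integral>z. u (x + s n *\<^sub>R z) * complex_of_real (gauss z) \<partial>lborel) * g x) \<le> b x * norm (g x)" for x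
        using moll[OF s(2,3)[of n]] by (simp only: norm_mult) (intro mult_right_mono, auto)
      then show "norm ((\<integral>z. u (x + s n *\<^sub>R z) * complex_of_real (gauss z) \<partial>lborel) * g x) \<le> b x * norm (g x)" for x .
      show "integrable lborel (\<lambda>x. norm ((\<integral>z. u (x + s n *\<^sub>R z) * complex_of_real (gauss z) \<partial>lborel) * g x))"
      proof (rule Bochner_Integration.integrable_bound[OF Ibg])
        show "AE x in lborel. norm (norm ((\<integral>z. u (x + s n *\<^sub>R z) * complex_of_real (gauss z) \<partial>lborel) * g x)) \<le> norm (b x * norm (g x))"
          unfolding real_norm_def abs_norm_cancel by (intro AE_I2 order_trans[OF bd abs_ge_self])
      qed measurable
    qed
    finally show ?thesis .
  qed
  then have "norm (h 0) \<le> (\<integral>y. b y * norm (g y) \<partial>lborel)"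
    by (intro tendsto_upperbound[OF tendsto_norm[OF lim]]) auto
  then show ?thesis by (simp add: h_def)
qed

text \<open>A measurable function is an almost everywhere limit of continuous ones. These are
  clipped to modulus at most 1 and cut off outside a slightly larger ball, after which both sides
  converge by domination.\<close>

lemma mollified_test_measurable:
  fixes u w :: "'a::euclidean_space \<Rightarrow> complex" and b :: "'a \<Rightarrow> real"
  assumes u [measurable]: "u \<in> borel_measurable borel" and B: "\<And>x. norm (u x) \<le> B"
    and w [measurable]: "w \<in> borel_measurable borel" and w1: "\<And>x. norm (w x) \<le> 1" "\<And>x. R < norm x \<Longrightarrow> w x = 0"
    and b [measurable]: "b \<in> borel_measurable borel" and b0: "\<And>x. 0 \<le> b x" "\<And>x. b x \<le> Bb"
    and moll: "\<And>s x. 0 < s \<Longrightarrow> s \<le> 1 \<Longrightarrow> norm (\<integral>z. u (x + s *\<^sub>R z) * complex_of_real (gauss z) \<partial>lborel) \<le> b x"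
  shows "norm (\<integral>y. u y * w y \<partial>lborel) \<le> (\<integral>y. b y * norm (w y) \<partial>lborel)"
proof -
  have B0: "0 \<le> B" using order_trans[OF norm_ge_zero B] .
  have Bb0: "0 \<le> Bb" using order_trans[OF b0] .
  have "w \<in> borel_measurable lborel" using w by simp
  then have "w \<in> borel_measurable lebesgue" by (rule measurable_completion)
  then have "w measurable_on UNIV" by (rule lebesgue_measurable_imp_measurable_on) simp
  then obtain N g where N: "negligible N" and gc: "\<And>n. continuous_on UNIV (g n)"
    and gl: "\<And>x. x \<notin> N \<Longrightarrow> (\<lambda>n. g n x) \<longlonglongrightarrow> w x"
    unfolding measurable_on_def by auto
  have "AE x in lebesgue. x \<notin> N" using N AE_not_in negligible_iff_null_sets by blast
  then have aeN: "AE x in lborel. x \<notin> N" by (simp add: AE_completion_iff)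
  define \<eta> :: "'a \<Rightarrow> real" where "\<eta> x = max 0 (min 1 (R + 1 - norm x))" for x
  \<comment> \<open>Dividing by \<open>max 1 (norm (g n x))\<close> clips the modulus continuously;
    in the limit it divides by 1, since |w| \<le> 1, and \<eta> equals 1 wherever w may be
    nonzero.\<close>
  define G where "G n x = (\<eta> x / max 1 (norm (g n x))) *\<^sub>R g n x" for n x
  have Gc: "continuous_on UNIV (G n)" for n
    unfolding G_def[abs_def] \<eta>_def by (intro continuous_intros gc) auto
  have [measurable]: "G n \<in> borel_measurable borel" for n using Gc by (rule borel_measurable_continuous_onI)
  have \<eta>: "0 \<le> \<eta> x" "\<eta> x \<le> 1" for x by (auto simp: \<eta>_def)
  have G1: "norm (G n x) \<le> 1" for n x
  proof -
    have "norm (g n x) / max 1 (norm (g n x)) \<le> 1" by (simp add: divide_le_eq)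
    then have "\<eta> x * (norm (g n x) / max 1 (norm (g n x))) \<le> 1 * 1" using \<eta>[of x] by (intro mult_mono) auto
    then show ?thesis using \<eta>[of x] by (simp add: G_def)
  qed
  have G0: "R + 1 < norm x \<Longrightarrow> G n x = 0" for n x by (simp add: G_def \<eta>_def)
  have Gl: "(\<lambda>n. G n x) \<longlonglongrightarrow> w x" if "x \<notin> N" for x
  proof -
    have "(\<lambda>n. G n x) \<longlonglongrightarrow> (\<eta> x / max 1 (norm (w x))) *\<^sub>R w x"
      unfolding G_def by (intro tendsto_intros gl that) auto
    also have "(\<eta> x / max 1 (norm (w x))) *\<^sub>R w x = w x"
    proof (cases "R < norm x")
      case False
      then have "\<eta> x = 1" by (simp add: \<eta>_def)
      then show ?thesis using w1(1)[of x] by (simp add: max_def)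
    qed (use w1(2) in simp)
    finally show ?thesis .
  qed
  have Ic: "integrable lborel (\<lambda>y::'a. c * indicator (cball 0 (R + 1)) y)" for c :: real
    by (rule integrable_indicator_cball)
  have L1: "(\<lambda>n. \<integral>y. u y * G n y \<partial>lborel) \<longlonglongrightarrow> (\<integral>y. u y * w y \<partial>lborel)"
  proof (rule integral_dominated_convergence[OF _ _ Ic[of B]])
    show "AE y in lborel. (\<lambda>n. u y * G n y) \<longlonglongrightarrow> u y * w y"
      using aeN by eventually_elim (intro tendsto_mult tendsto_const Gl)
    show "AE y in lborel. norm (u y * G n y) \<le> B * indicator (cball 0 (R + 1)) y" for n
    proof (rule AE_I2)
      fix y
      have "norm (u y) * norm (G n y) \<le> B * 1" using B G1 B0 by (intro mult_mono) auto
      then show "norm (u y * G n y) \<le> B * indicator (cball 0 (R + 1)) y"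
        using G0[of y n] by (cases "norm y \<le> R + 1") (auto simp: norm_mult mem_cball dist_norm)
    qed
  qed measurable
  have L2: "(\<lambda>n. \<integral>y. b y * norm (G n y) \<partial>lborel) \<longlonglongrightarrow> (\<integral>y. b y * norm (w y) \<partial>lborel)"
  proof (rule integral_dominated_convergence[OF _ _ Ic[of Bb]])
    show "AE y in lborel. (\<lambda>n. b y * norm (G n y)) \<longlonglongrightarrow> b y * norm (w y)"
      using aeN by eventually_elim (intro tendsto_mult tendsto_const tendsto_norm Gl)
    show "AE y in lborel. norm (b y * norm (G n y)) \<le> Bb * indicator (cball 0 (R + 1)) y" for n
    proof (rule AE_I2)
      fix y
      have "b y * norm (G n y) \<le> Bb * 1" using b0 G1 Bb0 by (intro mult_mono) auto
      then show "norm (b y * norm (G n y)) \<le> Bb * indicator (cball 0 (R + 1)) y"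
        using G0[of y n] b0(1)[of y] by (cases "norm y \<le> R + 1") (auto simp: mem_cball dist_norm)
    qed
  qed measurable
  show ?thesis
    by (rule LIMSEQ_le[OF tendsto_norm[OF L1] L2])
       (use mollified_test_continuous[OF u B Gc G1 G0 b b0 moll] in blast)
qed

text \<open>Testing with the conjugate sign of u on the part of a ball where |u| > b shows that the
  integral of |u| over that set is at most that of b. The difference |u| - b is nonnegative there,
  hence zero almost everywhere; countably many balls exhaust the space.\<close>

lemma ae_bound_borel:
  fixes u :: "'a::euclidean_space \<Rightarrow> complex" and b :: "'a \<Rightarrow> real"
  assumes u [measurable]: "u \<in> borel_measurable borel" and B: "\<And>x. norm (u x) \<le> B"
    and b [measurable]: "b \<in> borel_measurable borel" and b0: "\<And>x. 0 \<le> b x" "\<And>x. b x \<le> Bb"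
    and moll: "\<And>s x. 0 < s \<Longrightarrow> s \<le> 1 \<Longrightarrow> norm (\<integral>z. u (x + s *\<^sub>R z) * complex_of_real (gauss z) \<partial>lborel) \<le> b x"
  shows "AE x in lborel. norm (u x) \<le> b x"
proof -
  have B0: "0 \<le> B" using order_trans[OF norm_ge_zero B] .
  have "AE x in lborel. norm x \<le> real R \<longrightarrow> norm (u x) \<le> b x" for R :: nat
  proof -
    let ?S = "{x. b x < norm (u x) \<and> norm x \<le> real R}"
    define w where "w x = indicator ?S x *\<^sub>R cnj (sgn (u x))" for x
    have [measurable]: "(\<lambda>x. cnj (sgn (u x))) \<in> borel_measurable borel"
      by (rule borel_measurable_continuous_on[of cnj, OF _ ]) (auto intro!: continuous_intros)
    have wm: "w \<in> borel_measurable borel" unfolding w_def[abs_def] by measurable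
    have uw: "u x * w x = complex_of_real (indicator ?S x * norm (u x))" for x
    proof -
      have "u x * cnj (sgn (u x)) = complex_of_real (norm (u x))"
        by (cases "u x = 0") (simp_all add: sgn_div_norm scaleR_conv_of_real complex_norm_square[symmetric] power2_eq_square field_simps)
      then show ?thesis by (simp add: w_def scaleR_conv_of_real mult_ac)
    qed
    have bw: "b x * norm (w x) = indicator ?S x * b x" for x
      using b0(1)[of x] by (auto simp: w_def indicator_def norm_sgn)
    have "norm (\<integral>y. u y * w y \<partial>lborel) \<le> (\<integral>y. b y * norm (w y) \<partial>lborel)"
      by (rule mollified_test_measurable[OF u B wm _ _ b b0 moll, where R="real R"])
         (auto simp: w_def indicator_def norm_sgn)
    then have le: "(\<integral>y. indicator ?S y * norm (u y) \<partial>lborel) \<le> (\<integral>y. indicator ?S y * b y \<partial>lborel)"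
      unfolding uw bw integral_complex_of_real by simp
    have I1: "integrable lborel (\<lambda>y. indicator ?S y * norm (u y))"
      by (rule integrable_compact_support[where B=B and R="real R"]) (use B B0 in \<open>auto simp: indicator_def\<close>)
    have Bb0: "0 \<le> Bb" using order_trans[OF b0] .
    have I2: "integrable lborel (\<lambda>y. indicator ?S y * b y)"
      by (rule integrable_compact_support[where B=Bb and R="real R"]) (use b0 Bb0 in \<open>auto simp: indicator_def\<close>)
    have nn: "AE y in lborel. 0 \<le> indicator ?S y * norm (u y) - indicator ?S y * b y"
      by (auto simp: indicator_def)
    have "(\<integral>y. indicator ?S y * norm (u y) - indicator ?S y * b y \<partial>lborel) = 0"
      using le I1 I2 integral_nonneg_AE[OF nn] by (subst (asm) Bochner_Integration.integral_diff) (auto simp: Bochner_Integration.integral_diff)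
    then have "AE y in lborel. indicator ?S y * norm (u y) - indicator ?S y * b y = 0"
      using integral_nonneg_eq_0_iff_AE[OF Bochner_Integration.integrable_diff[OF I1 I2] nn] by simp
    then show ?thesis by eventually_elim (auto simp: indicator_def split: if_splits)
  qed
  then have "AE x in lborel. \<forall>R::nat. norm x \<le> real R \<longrightarrow> norm (u x) \<le> b x"
    unfolding AE_all_countable by blast
  then show ?thesis by eventually_elim (use real_arch_simple in blast)
qed

text \<open>A Lebesgue measurable u agrees almost everywhere with a Borel function, obtained from
  the real and imaginary parts; the mollifications are integrals and do not see the
  difference.\<close>

lemma ae_bound_of_mollified:
  fixes u :: "'a::euclidean_space \<Rightarrow> complex" and b :: "'a \<Rightarrow> real"
  assumes u: "u \<in> borel_measurable lebesgue" and B: "AE x in lebesgue. norm (u x) \<le> B"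
    and b: "b \<in> borel_measurable borel" "\<And>x. 0 \<le> b x" "\<And>x. b x \<le> Bb"
    and moll: "\<And>s x. 0 < s \<Longrightarrow> s \<le> 1 \<Longrightarrow>
      norm (\<integral>y. u y * complex_of_real (gauss ((x - y) /\<^sub>R s) / s ^ DIM('a)) \<partial>lebesgue) \<le> b x"
  shows "AE x in lebesgue. norm (u x) \<le> b x"
proof -
  have m: "(\<lambda>x. Re (u x)) \<in> borel_measurable lebesgue" "(\<lambda>x. Im (u x)) \<in> borel_measurable lebesgue"
    using u by measurable
  obtain f where f [measurable]: "f \<in> borel_measurable lborel" and aef: "AE x in lborel. Re (u x) = f x"
    using completion_ex_borel_measurable_real[OF m(1)] by blast
  obtain g where g [measurable]: "g \<in> borel_measurable lborel" and aeg: "AE x in lborel. Im (u x) = g x"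
    using completion_ex_borel_measurable_real[OF m(2)] by blast
  define v where "v x = Complex (f x) (g x)" for x
  have "v = (\<lambda>x. complex_of_real (f x) + \<i> * complex_of_real (g x))"
    by (simp add: v_def fun_eq_iff Complex_eq)
  then have vm [measurable]: "v \<in> borel_measurable borel" using f g by simp
  have uv: "AE x in lborel. u x = v x" using aef aeg by eventually_elim (simp add: v_def complex_eq_iff)
  \<comment> \<open>Truncation at |B| changes v on a null set at most and makes the bound hold
    everywhere, as the Fubini and domination arguments require.\<close>
  define w where "w x = (if norm (v x) \<le> \<bar>B\<bar> then v x else 0)" for x
  have wm [measurable]: "w \<in> borel_measurable borel" unfolding w_def[abs_def] by measurable
  have wB: "norm (w x) \<le> \<bar>B\<bar>" for x by (simp add: w_def)
  have "AE x in lborel. norm (u x) \<le> B" using B by (simp add: AE_completion_iff)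
  with uv have "AE x in lborel. u x = w x" by eventually_elim (auto simp: w_def)
  then have uw: "AE x in lebesgue. u x = w x" by (rule AE_completion)
  have "AE x in lborel. norm (w x) \<le> b x"
  proof (rule ae_bound_borel[OF wm wB b])
    fix s :: real and x :: 'a assume s: "0 < s" "s \<le> 1"
    let ?k = "\<lambda>y. complex_of_real (gauss ((x - y) /\<^sub>R s) / s ^ DIM('a))"
    have km: "?k \<in> borel_measurable lebesgue" by (rule measurable_completion) measurable
    have wm': "w \<in> borel_measurable lebesgue" by (rule measurable_completion) measurable
    have "(\<integral>y. u y * ?k y \<partial>lebesgue) = (\<integral>y. w y * ?k y \<partial>lebesgue)"
    proof (rule integral_cong_AE)
      show "(\<lambda>y. u y * ?k y) \<in> borel_measurable lebesgue" "(\<lambda>y. w y * ?k y) \<in> borel_measurable lebesgue"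
        using u wm' km by measurable
      show "AE y in lebesgue. u y * ?k y = w y * ?k y" using uw by eventually_elim simp
    qed
    also have "\<dots> = (\<integral>y. w y * ?k y \<partial>lborel)" by (rule integral_completion) measurable
    also have "\<dots> = (\<integral>z. w (x + s *\<^sub>R z) * complex_of_real (gauss z) \<partial>lborel)" by (rule mollified_eq[OF s(1)])
    finally show "norm (\<integral>z. w (x + s *\<^sub>R z) * complex_of_real (gauss z) \<partial>lborel) \<le> b x" using moll[OF s, of x] by simp
  qed
  then have "AE x in lebesgue. norm (w x) \<le> b x" by (rule AE_completion)
  with uw show ?thesis by eventually_elim simp
qed

section \<open>Bootstrap of the decay exponent\<close>

context elliptic_symbol
begin

text \<open>The power bound on \<open>F\<close> multiplies the rate by r, and convolution with the
  kernel preserves any rate up to its own, m + d; the pointwise estimate of \<open>u\<close> is then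
  recovered from its mollifications.\<close>

lemma decay_step:
  assumes sol: "distribution_solution p F u" and F: "F \<in> borel_measurable borel" and r: "1 < r"
    and F_bound: "\<And>K. compact K \<Longrightarrow> \<exists>C. \<forall>z\<in>K. norm (F z) \<le> C * norm z powr r"
    and u: "u \<in> borel_measurable lebesgue" "AE y in lebesgue. norm (u y) \<le> B * japanese_bracket y powr (- \<rho>)"
    and \<rho>: "0 < \<rho>"
  shows "\<exists>B'. AE y in lebesgue. norm (u y) \<le> B' * japanese_bracket y powr (- min (r * \<rho>) (m + real DIM('a)))"
proof -
  let ?\<sigma> = "min (r * \<rho>) (m + real DIM('a))"
  have \<sigma>: "0 < ?\<sigma>" "?\<sigma> \<le> m + real DIM('a)" "?\<sigma> \<le> r * \<rho>" using r \<rho> m_pos by (auto intro: add_pos_nonneg)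
  have jb1: "japanese_bracket y powr (- e) \<le> 1" if "0 \<le> e" for e and y :: 'a
    using powr_mono2'[of "- e" 1 "japanese_bracket y"] japanese_bracket_ge_1[of y] that by simp
  have ub: "AE y in lebesgue. norm (u y) \<le> \<bar>B\<bar>"
    using u(2)
  proof eventually_elim
    case (elim y)
    have "B * japanese_bracket y powr (- \<rho>) \<le> \<bar>B\<bar> * japanese_bracket y powr (- \<rho>)" by (intro mult_right_mono) auto
    also have "\<dots> \<le> \<bar>B\<bar> * 1" using jb1[of \<rho> y] \<rho> by (intro mult_left_mono) auto
    finally show ?case using elim by linarith
  qed
  \<comment> \<open>Almost all values of u lie in the closed ball of radius |B|, so one compact set
    determines the constant for \<open>F\<close>.\<close>
  obtain C where C: "\<And>z. norm z \<le> \<bar>B\<bar> \<Longrightarrow> norm (F z) \<le> C * norm z powr r"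
    using F_bound[of "cball 0 \<bar>B\<bar>"] unfolding Ball_def mem_cball_0 by auto
  have Fm: "(\<lambda>y. F (u y)) \<in> borel_measurable lebesgue" by (rule measurable_compose[OF u(1) F])
  let ?D = "\<bar>C\<bar> * \<bar>B\<bar> powr r"
  have Fb: "AE y in lebesgue. norm (F (u y)) \<le> ?D * japanese_bracket y powr (- ?\<sigma>)"
    using u(2) ub
  proof eventually_elim
    case (elim y)
    have "norm (u y) \<le> \<bar>B\<bar> * japanese_bracket y powr (- \<rho>)"
      using elim(1) mult_right_mono[OF abs_ge_self[of B], of "japanese_bracket y powr (- \<rho>)"] by simp
    then have "norm (u y) powr r \<le> (\<bar>B\<bar> * japanese_bracket y powr (- \<rho>)) powr r"
      using r by (intro powr_mono2) auto
    also have "\<dots> = \<bar>B\<bar> powr r * japanese_bracket y powr (- (r * \<rho>))"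
      by (simp add: powr_mult powr_powr mult.commute)
    also have "\<dots> \<le> \<bar>B\<bar> powr r * japanese_bracket y powr (- ?\<sigma>)"
      using \<sigma>(3) japanese_bracket_ge_1[of y] by (intro mult_left_mono powr_mono) auto
    finally have 1: "norm (u y) powr r \<le> \<bar>B\<bar> powr r * japanese_bracket y powr (- ?\<sigma>)" .
    have "norm (F (u y)) \<le> C * norm (u y) powr r" by (rule C[OF elim(2)])
    also have "\<dots> \<le> \<bar>C\<bar> * norm (u y) powr r" by (intro mult_right_mono) auto
    also have "\<dots> \<le> \<bar>C\<bar> * (\<bar>B\<bar> powr r * japanese_bracket y powr (- ?\<sigma>))" using 1 by (rule mult_left_mono) simp
    finally show ?case by (simp only: mult.assoc)
  qed
  obtain E where E: "0 \<le> E" "\<And>s x. 0 < s \<Longrightarrow> s \<le> 1 \<Longrightarrow>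
    norm (\<integral>y. u y * complex_of_real (gauss ((x - y) /\<^sub>R s) / s ^ DIM('a)) \<partial>lebesgue) \<le> E * japanese_bracket x powr (- ?\<sigma>)"
    by (rule mollified_bound[OF sol \<rho> \<sigma>(1,2) u Fm Fb]) (simp, rule that)
  have "AE x in lebesgue. norm (u x) \<le> E * japanese_bracket x powr (- ?\<sigma>)"
  proof (rule ae_bound_of_mollified[OF u(1) ub _ _ _ E(2)])
    show "(\<lambda>x::'a. E * japanese_bracket x powr (- ?\<sigma>)) \<in> borel_measurable borel" by measurable
    show "0 \<le> E * japanese_bracket x powr (- ?\<sigma>)" for x :: 'a using E(1) by simp
    show "E * japanese_bracket x powr (- ?\<sigma>) \<le> E * 1" for x :: 'a
      using jb1[of ?\<sigma> x] \<sigma>(1) E(1) by (intro mult_left_mono) auto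
  qed
  then show ?thesis by blast
qed

theorem solution_decay:
  assumes sol: "distribution_solution p F u" and F: "F \<in> borel_measurable borel" and r: "1 < r"
    and F_bound: "\<And>K. compact K \<Longrightarrow> \<exists>C. \<forall>z\<in>K. norm (F z) \<le> C * norm z powr r"
    and \<epsilon>: "0 < \<epsilon>" and u: "Linfty (\<lambda>x. complex_of_real (japanese_bracket x powr \<epsilon>) * u x)"
  shows "Linfty (\<lambda>x. complex_of_real (japanese_bracket x powr (m + real DIM('a))) * u x)"
proof -
  let ?\<tau> = "m + real DIM('a)"
  have jm: "(\<lambda>x::'a. complex_of_real (japanese_bracket x powr e)) \<in> borel_measurable lebesgue" for e
    by (rule measurable_completion) measurable
  \<comment> \<open>Measurability is known only for the weighted function; dividing by the positive
    continuous weight recovers it for u.\<close>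
  have um: "u \<in> borel_measurable lebesgue"
  proof -
    have u': "(\<lambda>x. complex_of_real (japanese_bracket x powr \<epsilon>) * u x) \<in> borel_measurable lebesgue"
      using u unfolding Linfty_def by blast
    have "(\<lambda>x. complex_of_real (japanese_bracket x powr (- \<epsilon>)) * (complex_of_real (japanese_bracket x powr \<epsilon>) * u x)) \<in> borel_measurable lebesgue"
      by (rule borel_measurable_times[OF jm u'])
    moreover have "(\<lambda>x. complex_of_real (japanese_bracket x powr (- \<epsilon>)) * (complex_of_real (japanese_bracket x powr \<epsilon>) * u x)) = u"
      by (simp add: fun_eq_iff powr_minus less_imp_neq[OF japanese_bracket_pos, symmetric])
    ultimately show ?thesis by (simp only:)
  qed
  have iff: "norm (complex_of_real (japanese_bracket x powr e) * u x) \<le> C \<longleftrightarrow> norm (u x) \<le> C * japanese_bracket x powr (- e)" for e C x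
    by (simp add: norm_mult powr_minus field_simps less_imp_neq[OF japanese_bracket_pos, symmetric])
  have "\<exists>B. AE y in lebesgue. norm (u y) \<le> B * japanese_bracket y powr (- min (r ^ n * \<epsilon>) ?\<tau>)" for n
  proof (induction n)
    case 0
    obtain C where "AE x in lebesgue. norm (complex_of_real (japanese_bracket x powr \<epsilon>) * u x) \<le> C"
      using u unfolding Linfty_def by blast
    then have "AE y in lebesgue. norm (u y) \<le> \<bar>C\<bar> * japanese_bracket y powr (- min (r ^ 0 * \<epsilon>) ?\<tau>)"
    proof eventually_elim
      case (elim y)
      then have "norm (u y) \<le> C * japanese_bracket y powr (- \<epsilon>)" unfolding iff .
      also have "\<dots> \<le> \<bar>C\<bar> * japanese_bracket y powr (- \<epsilon>)" by (intro mult_right_mono) auto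
      also have "\<dots> \<le> \<bar>C\<bar> * japanese_bracket y powr (- min (r ^ 0 * \<epsilon>) ?\<tau>)"
        using japanese_bracket_ge_1[of y] by (intro mult_left_mono powr_mono) auto
      finally show ?case .
    qed
    then show ?case by blast
  next
    case (Suc n)
    then obtain B where B: "AE y in lebesgue. norm (u y) \<le> B * japanese_bracket y powr (- min (r ^ n * \<epsilon>) ?\<tau>)" by blast
    let ?\<rho> = "min (r ^ n * \<epsilon>) ?\<tau>"
    have \<rho>: "0 < ?\<rho>" using r \<epsilon> m_pos by (auto intro: add_pos_nonneg)
    obtain B' where B': "AE y in lebesgue. norm (u y) \<le> B' * japanese_bracket y powr (- min (r * ?\<rho>) ?\<tau>)"
      using decay_step[OF sol F r F_bound um B \<rho>] by blast
    have \<tau>: "?\<tau> \<le> r * ?\<tau>" using r m_pos mult_right_mono[of 1 r ?\<tau>] by simp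
    \<comment> \<open>Capping at m + d before or after multiplication by r makes no difference,
      since r > 1 keeps a capped rate at the cap; the rate after n steps is therefore
      \<open>min (r ^ n * \<epsilon>) ?\<tau>\<close>.\<close>
    have "min (r * A) t = min (r * min A t) t" if "t \<le> r * t" for A t :: real
    proof (cases "A \<le> t")
      case False
      then have "r * t \<le> r * A" using r by (intro mult_left_mono) auto
      with False that have "min (r * A) t = t" "min A t = t" "min (r * t) t = t" by linarith+
      then show ?thesis by simp
    qed (simp add: min_absorb1)
    from this[OF \<tau>, of "r ^ n * \<epsilon>"] have "min (r ^ Suc n * \<epsilon>) ?\<tau> = min (r * ?\<rho>) ?\<tau>"
      by (simp only: power_Suc mult.assoc)
    then show ?case using B' by metis
  qed
  moreover obtain n where n: "?\<tau> / \<epsilon> < r ^ n" using real_arch_pow[OF r] by blast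
  moreover have "min (r ^ n * \<epsilon>) ?\<tau> = ?\<tau>" using n \<epsilon> by (simp add: field_simps min_def)
  ultimately obtain B where "AE y in lebesgue. norm (u y) \<le> B * japanese_bracket y powr (- ?\<tau>)" by metis
  then have "AE x in lebesgue. norm (complex_of_real (japanese_bracket x powr ?\<tau>) * u x) \<le> B" unfolding iff .
  moreover have "(\<lambda>x. complex_of_real (japanese_bracket x powr ?\<tau>) * u x) \<in> borel_measurable lebesgue"
    using um jm by measurable
  ultimately show ?thesis unfolding Linfty_def by blast
qed

end

section \<open>Degrees of the homogeneous terms and the passage to Euclidean coordinates\<close>

theorem theorem1p1:
  fixes p :: "real ^ 'd \<Rightarrow> complex" and p0 :: complex
    and P :: "nat \<Rightarrow> real ^ 'd \<Rightarrow> complex" and ms :: "nat \<Rightarrow> real" and h :: nat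
    and m M r \<epsilon>0 :: real
    and F :: "complex \<Rightarrow> complex" and u :: "real ^ 'd \<Rightarrow> complex"
  assumes p_eq: "\<And>\<xi>. p \<xi> = p0 + (\<Sum>j=1..h. P j \<xi>)"
    and h_pos: "1 \<le> h"
    and ms_pos: "\<And>j. j \<in> {1..h} \<Longrightarrow> 0 < ms j"
    and ms_mono: "strict_mono_on {1..h} ms"
    and M_eq: "M = ms h"
    and P_smooth: "\<And>j. j \<in> {1..h} \<Longrightarrow> smooth_on (UNIV - {0}) (P j)"
    and P_hom: "\<And>j. j \<in> {1..h} \<Longrightarrow> pos_homogeneous (ms j) (P j)"
    and elliptic: "\<exists>C>0. \<forall>\<xi>. norm (p \<xi>) \<ge> C * japanese_bracket \<xi> powr M"
    and nonsmooth: "\<exists>j\<in>{1..h}. \<not> smooth_on UNIV (P j)"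
    and m_eq: "m = Min {ms j | j. j \<in> {1..h} \<and> \<not> smooth_on UNIV (P j)}"
    and F_meas: "F \<in> borel_measurable borel"
    and r_gt: "1 < r"
    and F_bound: "\<And>K. compact K \<Longrightarrow> \<exists>C. \<forall>z\<in>K. norm (F z) \<le> C * norm z powr r"
    and sol: "distribution_solution p F u"
    and eps_pos: "0 < \<epsilon>0"
    and u_decay: "Linfty (\<lambda>x. complex_of_real (japanese_bracket x powr \<epsilon>0) * u x)"
  shows "Linfty (\<lambda>x. complex_of_real (japanese_bracket x powr (m + real CARD('d))) * u x)"
proof -
  let ?S = "{ms j | j. j \<in> {1..h} \<and> \<not> smooth_on UNIV (P j)}"
  have fin: "finite ?S" and ne: "?S \<noteq> {}" using nonsmooth by auto
  have ms_le: "ms j \<le> M" if "j \<in> {1..h}" for j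
    using ms_mono that h_pos unfolding M_eq strict_mono_on_def by (cases "j = h") (auto intro!: less_imp_le)
  \<comment> \<open>The minimum of a finite nonempty set is attained, so m is itself one of the
    degrees and inherits positivity and the bound by M.\<close>
  have "m \<in> ?S" unfolding m_eq by (rule Min_in[OF fin ne])
  then have m: "0 < m" "m \<le> M" using ms_pos ms_le by auto
  have m_le: "m \<le> ms j" if "j \<in> {1..h}" "\<not> smooth_on UNIV (P j)" for j
    unfolding m_eq using that by (intro Min_le[OF fin]) auto
  obtain c0 where "0 < c0" "\<And>\<xi>. norm (p \<xi>) \<ge> c0 * japanese_bracket \<xi> powr M" using elliptic by blast
  then interpret elliptic_symbol p p0 P ms h m M c0
    using p_eq ms_le P_smooth P_hom m m_le by unfold_locales auto
  have "DIM(real ^ 'd) = CARD('d)" by simp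
  then show ?thesis using solution_decay[OF sol F_meas r_gt F_bound eps_pos u_decay] by simp
qed

end
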